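(* Let $S$ be a density operator on $L^2(\mathbb{R}^d)$, let $\Omega\subset\mathbb{R}^{2d}$ be a compact domain with $|\Omega|>0$, and fix $\delta\in(0,1)$. If $\{\lambda_k^{R\Omega}\}_{k\in\mathbb{N}}$ are the eigenvalues, counted with multiplicity, of $\chi_{R\Omega}\star S$, then $$\frac{\#\{k:\lambda_k^{R\Omega}>1-\delta\}}{R^{2d}|\Omega|}\to1\quad\text{as }R\to\infty .$$
   Context: Fix $d\ge 1$. For $z=(x,\omega)\in\mathbb{R}^{2d}$ let $\pi(z)\psi(t)=e^{2\pi i\omega\cdot t}\psi(t-x)$ on $L^2(\mathbb{R}^d)$, and for a bounded operator $A$ on $L^2(\mathbb{R}^d)$ let $\alpha_z(A)=\pi(z)A\pi(z)^*$. For $f\in L^1(\mathbb{R}^{2d})$ and a trace class operator $S$, $f\star S=\int_{\mathbb{R}^{2d}}f(z)\alpha_z(S)\,dz$ (weakly defined; a trace class operator). A density operator is a positive trace class operator $S$ with $\mathrm{tr}(S)=1$. A compact domain is a compact subset $\Omega\subset\mathbb{R}^{2d}$; $|\Omega|$ is its Lebesgue measure, $\chi_\Omega$ its characteristic function, and $R\Omega=\{Rz:z\in\Omega\}$. The operator $\chi_{R\Omega}\star S$ is positive and trace class. *)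

theory Defs
  imports "HOL-Analysis.Analysis" "HOL-Library.Equipollence"
begin

section \<open>The Hilbert space of square-integrable functions\<close>

definition square_integrable :: "('a::euclidean_space \<Rightarrow> complex) \<Rightarrow> bool" where
  "square_integrable f \<longleftrightarrow>
     f \<in> borel_measurable borel \<and> integrable lborel (\<lambda>t. (cmod (f t))\<^sup>2)"

definition l2_eq :: "('a::euclidean_space \<Rightarrow> complex) \<Rightarrow> ('a \<Rightarrow> complex) \<Rightarrow> bool" where
  "l2_eq f g \<longleftrightarrow> square_integrable f \<and> square_integrable g \<and> (AE t in lborel. f t = g t)"

lemma borel_measurable_mult_cnj:
  fixes f g :: "'a::euclidean_space \<Rightarrow> complex"
  assumes "f \<in> borel_measurable borel" and "g \<in> borel_measurable borel"
  shows "(\<lambda>t. f t * cnj (g t)) \<in> borel_measurable lborel"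
proof -
  have "cnj \<in> borel_measurable borel"
    by (intro borel_measurable_continuous_onI continuous_intros)
  from measurable_compose[OF assms(2) this] show ?thesis
    using assms(1) by simp
qed

lemma square_integrable_zero: "square_integrable (\<lambda>_. 0)"
  by (simp add: square_integrable_def)

lemma square_integrable_cmult:
  assumes "square_integrable f"
  shows "square_integrable (\<lambda>t. c * f t)"
  using assms by (auto simp: square_integrable_def norm_mult power_mult_distrib)

lemma square_integrable_add:
  assumes f: "square_integrable f" and g: "square_integrable g"
  shows "square_integrable (\<lambda>t. f t + g t)"
proof -
  have [measurable]: "f \<in> borel_measurable borel" "g \<in> borel_measurable borel"
    using f g by (auto simp: square_integrable_def)
  have bound: "(cmod (a + b))\<^sup>2 \<le> 2 * (cmod a)\<^sup>2 + 2 * (cmod b)\<^sup>2" for a b :: complex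
  proof -
    have "(cmod (a + b))\<^sup>2 \<le> (cmod a + cmod b)\<^sup>2"
      by (intro power_mono norm_triangle_ineq) auto
    also have "\<dots> \<le> 2 * (cmod a)\<^sup>2 + 2 * (cmod b)\<^sup>2"
      using sum_squares_bound[of "cmod a" "cmod b"] by (simp add: power2_sum)
    finally show ?thesis .
  qed
  have int: "integrable lborel (\<lambda>t. 2 * (cmod (f t))\<^sup>2 + 2 * (cmod (g t))\<^sup>2)"
    using f g by (auto simp: square_integrable_def)
  have "integrable lborel (\<lambda>t. (cmod (f t + g t))\<^sup>2)"
  proof (rule Bochner_Integration.integrable_bound[OF int])
    show "(\<lambda>t. (cmod (f t + g t))\<^sup>2) \<in> borel_measurable lborel"
      by measurable
    show "AE t in lborel. norm ((cmod (f t + g t))\<^sup>2) \<le> norm (2 * (cmod (f t))\<^sup>2 + 2 * (cmod (g t))\<^sup>2)"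
      by (rule AE_I2) (use bound in simp)
  qed
  then show ?thesis
    by (simp add: square_integrable_def)
qed

lemma square_integrable_uminus:
  "square_integrable f \<Longrightarrow> square_integrable (\<lambda>t. - f t)"
  using square_integrable_cmult[of f "-1"] by simp

lemma square_integrable_diff:
  "square_integrable f \<Longrightarrow> square_integrable g \<Longrightarrow> square_integrable (\<lambda>t. f t - g t)"
  using square_integrable_add[of f "\<lambda>t. - g t"] square_integrable_uminus[of g] by simp

lemma square_integrable_mult_cnj:
  assumes f: "square_integrable f" and g: "square_integrable g"
  shows "integrable lborel (\<lambda>t. f t * cnj (g t))"
proof -
  have [measurable]: "f \<in> borel_measurable borel" "g \<in> borel_measurable borel"
    using f g by (auto simp: square_integrable_def)
  have bound: "cmod (a * cnj b) \<le> (cmod a)\<^sup>2 + (cmod b)\<^sup>2" for a b :: complex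
    using sum_squares_bound[of "cmod a" "cmod b"]
      mult_nonneg_nonneg[OF norm_ge_zero[of a] norm_ge_zero[of b]]
    unfolding norm_mult complex_mod_cnj by linarith
  have int: "integrable lborel (\<lambda>t. (cmod (f t))\<^sup>2 + (cmod (g t))\<^sup>2)"
    using f g by (auto simp: square_integrable_def)
  show ?thesis
  proof (rule Bochner_Integration.integrable_bound[OF int])
    show "(\<lambda>t. f t * cnj (g t)) \<in> borel_measurable lborel"
      using f g by (intro borel_measurable_mult_cnj) (auto simp: square_integrable_def)
    show "AE t in lborel. norm (f t * cnj (g t)) \<le> norm ((cmod (f t))\<^sup>2 + (cmod (g t))\<^sup>2)"
    proof (rule AE_I2)
      fix t show "norm (f t * cnj (g t)) \<le> norm ((cmod (f t))\<^sup>2 + (cmod (g t))\<^sup>2)"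
        using bound[of "f t" "g t"] by (simp only: real_norm_def abs_of_nonneg sum_power2_ge_zero)
    qed
  qed
qed

quotient_type (overloaded) 'a l2 = "'a::euclidean_space \<Rightarrow> complex" / partial: l2_eq
proof (rule part_equivpI)
  show "\<exists>f::'a \<Rightarrow> complex. l2_eq f f"
    using square_integrable_zero by (auto simp: l2_eq_def)
  show "symp (l2_eq :: ('a \<Rightarrow> complex) \<Rightarrow> _)"
    by (auto simp: symp_def l2_eq_def)
  show "transp (l2_eq :: ('a \<Rightarrow> complex) \<Rightarrow> _)"
    by (auto simp: transp_def l2_eq_def)
qed

instantiation l2 :: (euclidean_space) ab_group_add
begin

lift_definition zero_l2 :: "'a l2" is "\<lambda>_. 0"
  by (simp add: l2_eq_def square_integrable_zero)

lift_definition plus_l2 :: "'a l2 \<Rightarrow> 'a l2 \<Rightarrow> 'a l2" is "\<lambda>f g t. f t + g t"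
  by (auto simp: l2_eq_def square_integrable_add)

lift_definition uminus_l2 :: "'a l2 \<Rightarrow> 'a l2" is "\<lambda>f t. - f t"
  by (auto simp: l2_eq_def square_integrable_uminus)

lift_definition minus_l2 :: "'a l2 \<Rightarrow> 'a l2 \<Rightarrow> 'a l2" is "\<lambda>f g t. f t - g t"
  by (auto simp: l2_eq_def square_integrable_diff)

instance
proof
  fix a b c :: "'a l2"
  show "a + b + c = a + (b + c)"
    by transfer (auto simp: l2_eq_def add.assoc square_integrable_add)
  show "a + b = b + a"
    by transfer (auto simp: l2_eq_def add.commute square_integrable_add)
  show "0 + a = a"
    by transfer (auto simp: l2_eq_def)
  show "- a + a = 0"
    by transfer (auto simp: l2_eq_def square_integrable_zero)
  show "a - b = a + - b"
    by transfer (auto simp: l2_eq_def square_integrable_diff)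
qed

end

lift_definition scaleC :: "complex \<Rightarrow> 'a::euclidean_space l2 \<Rightarrow> 'a l2" (infixr "*\<^sub>C" 75)
  is "\<lambda>c f t. c * f t"
  by (auto simp: l2_eq_def square_integrable_cmult)

global_interpretation l2: vector_space "scaleC :: complex \<Rightarrow> 'a::euclidean_space l2 \<Rightarrow> 'a l2"
proof
  fix a b :: complex and x y :: "'a l2"
  show "a *\<^sub>C (x + y) = a *\<^sub>C x + a *\<^sub>C y"
    by transfer (auto simp: l2_eq_def ring_distribs square_integrable_add square_integrable_cmult)
  show "(a + b) *\<^sub>C x = a *\<^sub>C x + b *\<^sub>C x"
    by transfer (auto simp: l2_eq_def ring_distribs square_integrable_add square_integrable_cmult)
  show "a *\<^sub>C b *\<^sub>C x = (a * b) *\<^sub>C x"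
    by transfer (auto simp: l2_eq_def mult.assoc square_integrable_cmult)
  show "1 *\<^sub>C x = x"
    by transfer (auto simp: l2_eq_def)
qed

lift_definition cinner :: "'a::euclidean_space l2 \<Rightarrow> 'a l2 \<Rightarrow> complex"
  is "\<lambda>f g. LINT t|lborel. f t * cnj (g t)"
proof -
  fix f f' g g' :: "'a \<Rightarrow> complex"
  assume "l2_eq f f'" and "l2_eq g g'"
  then have m: "f \<in> borel_measurable borel" "f' \<in> borel_measurable borel"
      "g \<in> borel_measurable borel" "g' \<in> borel_measurable borel"
    and ae: "AE t in lborel. f t = f' t" "AE t in lborel. g t = g' t"
    by (auto simp: l2_eq_def square_integrable_def)
  show "(LINT t|lborel. f t * cnj (g t)) = (LINT t|lborel. f' t * cnj (g' t))"
    by (rule integral_cong_AE) (use m ae in \<open>auto intro: borel_measurable_mult_cnj[simplified]\<close>)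
qed

lemma cinner_add_left: "cinner (x + y) z = cinner x z + cinner y z"
  by transfer (simp add: l2_eq_def ring_distribs square_integrable_mult_cnj)

lemma cinner_scaleC_left: "cinner (c *\<^sub>C x) y = c * cinner x y"
  by transfer (simp add: mult.assoc)

lemma cinner_commute: "cinner x y = cnj (cinner y x)"
  by transfer (subst Bochner_Integration.integral_cnj[symmetric], simp add: mult.commute)

lemma integral_mult_cnj_self:
  "(LINT t|M. f t * cnj (f t)) = complex_of_real (LINT t|M. (cmod (f t))\<^sup>2)"
  unfolding complex_norm_square[symmetric] by (rule integral_complex_of_real)

lemma cinner_self_nonneg: "0 \<le> Re (cinner x x)"
  and cinner_self_real: "Im (cinner x x) = 0"
  by (transfer, simp add: integral_mult_cnj_self)+

lemma cinner_self_eq_0_iff: "Re (cinner x x) = 0 \<longleftrightarrow> x = 0"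
proof transfer
  fix f :: "'a \<Rightarrow> complex"
  assume "l2_eq f f"
  then have f: "square_integrable f" and i: "integrable lborel (\<lambda>t. (cmod (f t))\<^sup>2)"
    by (auto simp: l2_eq_def square_integrable_def)
  have "Re (LINT t|lborel. f t * cnj (f t)) = 0 \<longleftrightarrow> (LINT t|lborel. (cmod (f t))\<^sup>2) = 0"
    by (simp add: integral_mult_cnj_self)
  also have "\<dots> \<longleftrightarrow> (AE t in lborel. (cmod (f t))\<^sup>2 = 0)"
    by (rule integral_nonneg_eq_0_iff_AE[OF i]) simp
  also have "\<dots> \<longleftrightarrow> l2_eq f (\<lambda>_. 0)"
    using f by (simp add: l2_eq_def square_integrable_zero)
  finally show "Re (LINT t|lborel. f t * cnj (f t)) = 0 \<longleftrightarrow> l2_eq f (\<lambda>_. 0)" .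
qed

text \<open>
  The real Hilbert space structure underlying the complex one; it supplies the norm and the
  library notion of a bounded operator.
\<close>

instantiation l2 :: (euclidean_space) real_vector
begin

definition scaleR_l2 :: "real \<Rightarrow> 'a l2 \<Rightarrow> 'a l2" where
  "scaleR_l2 r x = complex_of_real r *\<^sub>C x"

instance
  by standard (simp_all add: scaleR_l2_def l2.scale_right_distrib l2.scale_left_distrib)

end

instantiation l2 :: (euclidean_space) real_inner
begin

definition inner_l2 :: "'a l2 \<Rightarrow> 'a l2 \<Rightarrow> real" where
  "inner_l2 x y = Re (cinner x y)"

definition norm_l2 :: "'a l2 \<Rightarrow> real" where
  "norm_l2 x = sqrt (Re (cinner x x))"

definition sgn_l2 :: "'a l2 \<Rightarrow> 'a l2" where
  "sgn_l2 x = x /\<^sub>R norm x"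

definition dist_l2 :: "'a l2 \<Rightarrow> 'a l2 \<Rightarrow> real" where
  "dist_l2 x y = norm (x - y)"

definition uniformity_l2 :: "('a l2 \<times> 'a l2) filter" where
  "uniformity_l2 = (INF e\<in>{0 <..}. principal {(x, y). dist x y < e})"

definition open_l2 :: "'a l2 set \<Rightarrow> bool" where
  "open_l2 U \<longleftrightarrow> (\<forall>x\<in>U. \<forall>\<^sub>F (x', y) in uniformity. x' = x \<longrightarrow> y \<in> U)"

instance
proof
  fix x y z :: "'a l2" and r :: real
  show "sgn x = x /\<^sub>R norm x"
    by (rule sgn_l2_def)
  show "dist x y = norm (x - y)"
    by (rule dist_l2_def)
  show "uniformity = (INF e\<in>{0 <..}. principal {(x::'a l2, y). dist x y < e})"
    by (rule uniformity_l2_def)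
  show "open U \<longleftrightarrow> (\<forall>x\<in>U. \<forall>\<^sub>F (x', y) in uniformity. x' = x \<longrightarrow> y \<in> U)" for U :: "'a l2 set"
    by (rule open_l2_def)
  show "inner x y = inner y x"
    unfolding inner_l2_def by (subst cinner_commute) simp
  show "inner (x + y) z = inner x z + inner y z"
    by (simp add: inner_l2_def cinner_add_left)
  show "inner (r *\<^sub>R x) y = r * inner x y"
    by (simp add: inner_l2_def scaleR_l2_def cinner_scaleC_left)
  show "0 \<le> inner x x"
    by (simp add: inner_l2_def cinner_self_nonneg)
  show "inner x x = 0 \<longleftrightarrow> x = 0"
    by (simp add: inner_l2_def cinner_self_eq_0_iff)
  show "norm x = sqrt (inner x x)"
    by (simp add: norm_l2_def inner_l2_def)
qed

end


section \<open>Operators\<close>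

definition bounded_op :: "('a::euclidean_space l2 \<Rightarrow> 'a l2) \<Rightarrow> bool" where
  "bounded_op A \<longleftrightarrow> bounded_linear A \<and> (\<forall>c \<phi>. A (c *\<^sub>C \<phi>) = c *\<^sub>C A \<phi>)"

definition op_adj :: "('a::euclidean_space l2 \<Rightarrow> 'a l2) \<Rightarrow> 'a l2 \<Rightarrow> 'a l2" where
  "op_adj A = (THE B. \<forall>\<phi> \<psi>. cinner (A \<phi>) \<psi> = cinner \<phi> (B \<psi>))"

definition positive_op :: "('a::euclidean_space l2 \<Rightarrow> 'a l2) \<Rightarrow> bool" where
  "positive_op A \<longleftrightarrow> bounded_op A \<and> (\<forall>\<phi>. cinner (A \<phi>) \<phi> \<in> \<real> \<and> 0 \<le> Re (cinner (A \<phi>) \<phi>))"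

definition onb :: "'a::euclidean_space l2 set \<Rightarrow> bool" where
  "onb E \<longleftrightarrow> (\<forall>e\<in>E. \<forall>e'\<in>E. cinner e e' = (if e = e' then 1 else 0)) \<and>
     closure (l2.span E) = UNIV"

text \<open>
  For trace class operators, and for arbitrary positive operators, the sum in \<open>op_trace\<close> does not
  depend on the orthonormal basis.
\<close>

definition op_trace :: "('a::euclidean_space l2 \<Rightarrow> 'a l2) \<Rightarrow> complex" where
  "op_trace A = (\<Sum>\<^sub>\<infinity>e\<in>(SOME E. onb E). cinner (A e) e)"

text \<open>
  \<open>A\<close> is trace class if \<open>|A| = (A\<^sup>* A)\<^bsup>1/2\<^esup>\<close> has finite trace; in the definition, \<open>P\<close> is this
  (unique) positive square root.
\<close>

definition trace_class :: "('a::euclidean_space l2 \<Rightarrow> 'a l2) \<Rightarrow> bool" where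
  "trace_class A \<longleftrightarrow> bounded_op A \<and>
     (\<exists>P. positive_op P \<and> P \<circ> P = op_adj A \<circ> A \<and>
        (\<lambda>e. cinner (P e) e) summable_on (SOME E. onb E))"

definition density_operator :: "('a::euclidean_space l2 \<Rightarrow> 'a l2) \<Rightarrow> bool" where
  "density_operator S \<longleftrightarrow> positive_op S \<and> trace_class S \<and> op_trace S = 1"


section \<open>Time-frequency shifts and convolutions\<close>

lift_definition tf_shift :: "'a::euclidean_space \<times> 'a \<Rightarrow> 'a l2 \<Rightarrow> 'a l2"
  is "\<lambda>(x, \<omega>) \<psi> t. exp (2 * complex_of_real pi * \<i> * complex_of_real (\<omega> \<bullet> t)) * \<psi> (t - x)"
proof -
  fix z :: "'a \<times> 'a" and f g :: "'a \<Rightarrow> complex"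
  assume eq: "l2_eq f g"
  obtain x \<omega> where z: "z = (x, \<omega>)"
    by (cases z)
  let ?e = "\<lambda>t. exp (2 * complex_of_real pi * \<i> * complex_of_real (\<omega> \<bullet> t))"
  have shift: "square_integrable (\<lambda>t. ?e t * h (t - x))" if "square_integrable h" for h
  proof -
    have [measurable]: "h \<in> borel_measurable borel"
      using that by (simp add: square_integrable_def)
    have "integrable lborel (\<lambda>t. (cmod (h t))\<^sup>2)"
      using that by (simp add: square_integrable_def)
    then have "integrable (distr lborel borel ((+) (- x))) (\<lambda>t. (cmod (h t))\<^sup>2)"
      by (simp add: lborel_distr_plus)
    then have "integrable lborel (\<lambda>t. (cmod (h (- x + t)))\<^sup>2)"
      by (subst (asm) integrable_distr_eq) auto
    then show ?thesis
      by (simp add: square_integrable_def norm_mult)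
  qed
  have [measurable]: "f \<in> borel_measurable borel" "g \<in> borel_measurable borel"
    using eq by (auto simp: l2_eq_def square_integrable_def)
  have "AE t in lborel. f t = g t"
    using eq by (simp add: l2_eq_def)
  then have "AE t in distr lborel borel ((+) (- x)). f t = g t"
    by (subst lborel_distr_plus)
  then have "AE t in lborel. f (- x + t) = g (- x + t)"
    by (subst (asm) AE_distr_iff) auto
  then show "l2_eq ((case z of (x, \<omega>) \<Rightarrow> \<lambda>\<psi> t.
      exp (2 * complex_of_real pi * \<i> * complex_of_real (\<omega> \<bullet> t)) * \<psi> (t - x)) f)
    ((case z of (x, \<omega>) \<Rightarrow> \<lambda>\<psi> t.
      exp (2 * complex_of_real pi * \<i> * complex_of_real (\<omega> \<bullet> t)) * \<psi> (t - x)) g)"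
    using eq shift by (auto simp: l2_eq_def z)
qed

definition op_shift ::
    "'a::euclidean_space \<times> 'a \<Rightarrow> ('a l2 \<Rightarrow> 'a l2) \<Rightarrow> 'a l2 \<Rightarrow> 'a l2" where
  "op_shift z A = tf_shift z \<circ> A \<circ> op_adj (tf_shift z)"

text \<open>
  The weak integral: \<open>op_conv f S \<phi>\<close> is the unique vector whose inner product with every \<open>\<psi>\<close> is the
  integral of the corresponding matrix coefficients.
\<close>

definition op_conv ::
    "('a::euclidean_space \<times> 'a \<Rightarrow> complex) \<Rightarrow> ('a l2 \<Rightarrow> 'a l2) \<Rightarrow> 'a l2 \<Rightarrow> 'a l2" where
  "op_conv f S \<phi> =
     (THE \<eta>. \<forall>\<psi>. cinner \<eta> \<psi> = (LINT z|lborel. f z * cinner (op_shift z S \<phi>) \<psi>))"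


section \<open>Eigenvalues counted with multiplicity\<close>

definition eigenspace :: "('a::euclidean_space l2 \<Rightarrow> 'a l2) \<Rightarrow> complex \<Rightarrow> 'a l2 set" where
  "eigenspace T \<mu> = {\<phi>. T \<phi> = \<mu> *\<^sub>C \<phi>}"

text \<open>
  Every nonzero \<open>\<mu>\<close> occurs in the sequence exactly as often as the dimension of its eigenspace
  (so not at all if it is not an eigenvalue). As usual for compact operators, the multiplicity of
  \<open>0\<close> is left free; in particular a finite list of eigenvalues is padded with zeros.
\<close>

definition eigenvalue_sequence ::
    "('a::euclidean_space l2 \<Rightarrow> 'a l2) \<Rightarrow> (nat \<Rightarrow> real) \<Rightarrow> bool" where
  "eigenvalue_sequence T l \<longleftrightarrow>
     (\<forall>\<mu>. \<mu> \<noteq> 0 \<longrightarrow>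
        (\<exists>B. l2.independent B \<and> l2.span B = eigenspace T \<mu> \<and>
             {k. complex_of_real (l k) = \<mu>} \<approx> B))"

end

(*
  Write the density operator as S = sum g_n (x) g_n with sum |g_n|^2 = 1, and let T be the
  convolution with the indicator function of R Omega, of measure V.  Moyal's identity
  (a consequence of Plancherel) gives T <= 1, and unitarity of the shifts gives tr T <= V.
  The Hilbert-Schmidt norm of T is the double integral of c(w - z) over R Omega x R Omega, where
  c(w) = sum_{m,n} |<g_m, pi(w) g_n>|^2 has integral 1, again by Moyal; dividing by V and rescaling,
  continuity of translation yields tr T^2 / V -> 1.  Hence the eigenvalues satisfy
  sum lambda (1 - lambda) = o(V): up to o(V) of them they are close to 0 or 1, and they sum
  to V + o(V).
*)
theory Submission
  imports Defs "HOL-Probability.Characteristic_Functions"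
begin

section \<open>Square-integrable functions form a Hilbert space\<close>

text \<open>All information on the spectrum of T is squeezed out of the chain tr T^2 \<le> tr T
  \<le> V: once tr T^2 / V tends to 1, the lower bound on the trace comes for free. Two obstacles
  shape the rest. The trace is defined through one arbitrarily chosen orthonormal basis, and the
  given eigenvalue sequence is known only through the dimensions of eigenspaces. Hence a spectral
  theorem for positive operators of finite trace is built up from the completeness of the space, and
  it is used twice: for S, where it produces the vectors g_n, and for T, where it produces
  eigenvalues to compare with the given ones. Its eigenvectors can be listed as a sequence because
  their positive eigenvalues are summable. The second obstacle is the number of exchanges of sums
  and integrals; the quadratic forms of the shifted operators are therefore kept as extended
  nonnegative reals, where Tonelli applies at once.\<close>

lemma cnj_borel_measurable [measurable]: "cnj \<in> borel_measurable borel"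
  by (intro borel_measurable_continuous_onI continuous_intros)

lemma l2_eq_rep_l2: "l2_eq (rep_l2 x) (rep_l2 x)"
  by (rule Quotient_rep_reflp[OF Quotient_l2])

lemma abs_rep_l2 [simp]: "abs_l2 (rep_l2 x) = x"
  by (rule Quotient_abs_rep[OF Quotient_l2])

lemma square_integrable_rep_l2: "square_integrable (rep_l2 x)"
  using l2_eq_rep_l2[of x] by (simp add: l2_eq_def)

lemma rep_l2_measurable [measurable]: "rep_l2 x \<in> borel_measurable borel"
  using square_integrable_rep_l2[of x] by (simp add: square_integrable_def)

lemma cinner_abs_l2:
  assumes "square_integrable f" "square_integrable g"
  shows "cinner (abs_l2 f) (abs_l2 g) = (LINT t|lborel. f t * cnj (g t))"
  by (rule cinner.abs_eq) (use assms in \<open>simp_all add: l2_eq_def\<close>)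

lemma cinner_rep_l2: "cinner x y = (LINT t|lborel. rep_l2 x t * cnj (rep_l2 y t))"
  using cinner_abs_l2[OF square_integrable_rep_l2[of x] square_integrable_rep_l2[of y]] by simp

lemma minus_abs_l2:
  assumes "square_integrable f" "square_integrable g"
  shows "abs_l2 f - abs_l2 g = abs_l2 (\<lambda>t. f t - g t)"
  by (rule minus_l2.abs_eq) (use assms in \<open>simp_all add: l2_eq_def\<close>)

lemma norm_abs_l2:
  assumes "square_integrable f"
  shows "(norm (abs_l2 f))\<^sup>2 = (LINT t|lborel. (cmod (f t))\<^sup>2)"
proof -
  have "(norm (abs_l2 f))\<^sup>2 = Re (cinner (abs_l2 f) (abs_l2 f))"
    by (simp add: norm_l2_def cinner_self_nonneg)
  also have "\<dots> = (LINT t|lborel. (cmod (f t))\<^sup>2)"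
    by (simp add: cinner_abs_l2[OF assms assms] integral_mult_cnj_self)
  finally show ?thesis .
qed

lemma nn_norm_abs_l2:
  assumes "square_integrable f"
  shows "ennreal ((norm (abs_l2 f))\<^sup>2) = (\<integral>\<^sup>+t. ennreal ((cmod (f t))\<^sup>2) \<partial>lborel)"
  unfolding norm_abs_l2[OF assms]
  by (rule nn_integral_eq_integral[symmetric]) (use assms in \<open>auto simp: square_integrable_def\<close>)

lemma nn_norm_rep_l2: "ennreal ((norm x)\<^sup>2) = (\<integral>\<^sup>+t. ennreal ((cmod (rep_l2 x t))\<^sup>2) \<partial>lborel)"
  using nn_norm_abs_l2[OF square_integrable_rep_l2[of x]] by simp

lemma square_integrableI_nn:
  assumes [measurable]: "f \<in> borel_measurable borel"
    and "(\<integral>\<^sup>+t. ennreal ((cmod (f t))\<^sup>2) \<partial>lborel) < \<infinity>"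
  shows "square_integrable f"
  unfolding square_integrable_def using assms by (auto intro!: integrableI_bounded)

section \<open>Completeness through fast Cauchy subsequences\<close>

lemma Cauchy_fast_subseq:
  fixes X :: "nat \<Rightarrow> 'a::metric_space"
  assumes "Cauchy X"
  obtains r where "strict_mono r" "\<And>n m. n \<le> m \<Longrightarrow> dist (X (r n)) (X (r m)) < (1/2)^n"
proof -
  have "\<forall>n. \<exists>N. \<forall>m\<ge>N. \<forall>k\<ge>N. dist (X m) (X k) < (1/2)^n"
    using assms unfolding Cauchy_def by (meson zero_less_power half_gt_zero zero_less_one)
  then obtain N where N: "\<And>n m k. m \<ge> N n \<Longrightarrow> k \<ge> N n \<Longrightarrow> dist (X m) (X k) < (1/2)^n"
    by metis
  \<comment> \<open>Cumulative sums of \<open>Suc (N i)\<close> give strict growth and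
    \<open>r n \<ge> N n\<close> at once.\<close>
  define r where "r n = (\<Sum>i\<le>n. Suc (N i))" for n
  have sm: "strict_mono r"
    by (rule strict_monoI_Suc) (simp add: r_def)
  have ge: "r n \<ge> N n" for n
    by (cases n) (simp_all add: r_def)
  show thesis
  proof (rule that[OF sm])
    fix n m :: nat assume "n \<le> m"
    then have "r n \<le> r m" using sm by (simp add: strict_mono_less_eq)
    with ge[of n] show "dist (X (r n)) (X (r m)) < (1/2)^n"
      by (intro N) auto
  qed
qed

text \<open>The bound \<open>d \<le> 2\<^sup>-\<^sup>n + 2\<^sup>n d\<^sup>2\<close> turns square-summability of the increments
  of a fast Cauchy subsequence into absolute summability almost everywhere.\<close>

lemma l2_Cauchy_convergent:
  fixes X :: "nat \<Rightarrow> 'a::euclidean_space l2"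
  assumes "Cauchy X"
  shows "convergent X"
proof -
  obtain r where r: "strict_mono r" and fast: "\<And>n m. n \<le> m \<Longrightarrow> dist (X (r n)) (X (r m)) < (1/2)^n"
    using Cauchy_fast_subseq[OF assms] by blast
  define f where "f n = rep_l2 (X (r n))" for n
  have sq: "square_integrable (f n)" for n
    by (simp add: f_def square_integrable_rep_l2)
  have [measurable]: "f n \<in> borel_measurable borel" for n
    by (simp add: f_def)
  have abs_f: "abs_l2 (f n) = X (r n)" for n by (simp add: f_def)
  have diff: "(\<integral>\<^sup>+t. ennreal ((cmod (f m t - f n t))\<^sup>2) \<partial>lborel) \<le> ennreal (((1/2)^n)\<^sup>2)"
    if "n \<le> m" for n m
  proof -
    have "(\<integral>\<^sup>+t. ennreal ((cmod (f m t - f n t))\<^sup>2) \<partial>lborel) = ennreal ((norm (X (r m) - X (r n)))\<^sup>2)"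
      unfolding abs_f[symmetric] minus_abs_l2[OF sq sq]
      by (rule nn_norm_abs_l2[symmetric]) (intro square_integrable_diff sq)
    also have "\<dots> \<le> ennreal (((1/2)^n)\<^sup>2)"
      using fast[OF that] by (intro ennreal_leI power_mono) (auto simp: dist_norm norm_minus_commute)
    finally show ?thesis .
  qed
  have "(\<integral>\<^sup>+t. (\<Sum>n. ennreal (2^n * (cmod (f (Suc n) t - f n t))\<^sup>2)) \<partial>lborel)
      = (\<Sum>n. \<integral>\<^sup>+t. ennreal (2^n * (cmod (f (Suc n) t - f n t))\<^sup>2) \<partial>lborel)"
    by (intro nn_integral_suminf) auto
  also have "\<dots> \<le> (\<Sum>n. ennreal ((1/2)^n))"
  proof (intro suminf_le summableI)
    fix n :: nat
    have "(\<integral>\<^sup>+t. ennreal (2^n * (cmod (f (Suc n) t - f n t))\<^sup>2) \<partial>lborel)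
       = ennreal (2^n) * (\<integral>\<^sup>+t. ennreal ((cmod (f (Suc n) t - f n t))\<^sup>2) \<partial>lborel)"
      by (subst nn_integral_cmult[symmetric]) (auto simp: ennreal_mult)
    also have "\<dots> \<le> ennreal (2^n) * ennreal (((1/2)^n)\<^sup>2)"
      by (intro mult_left_mono diff) auto
    also have "\<dots> = ennreal ((1/2)^n)"
      by (simp add: ennreal_mult[symmetric] power2_eq_square power_mult_distrib[symmetric])
    finally show "(\<integral>\<^sup>+t. ennreal (2^n * (cmod (f (Suc n) t - f n t))\<^sup>2) \<partial>lborel) \<le> ennreal ((1/2)^n)" .
  qed
  also have "\<dots> = ennreal 2"
    by (intro suminf_ennreal_eq) (use geometric_sums[of "1/2::real"] in auto)
  finally have fin: "(\<integral>\<^sup>+t. (\<Sum>n. ennreal (2^n * (cmod (f (Suc n) t - f n t))\<^sup>2)) \<partial>lborel) \<noteq> \<infinity>"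
    by (auto simp: top_unique)
  have "AE t in lborel. (\<Sum>n. ennreal (2^n * (cmod (f (Suc n) t - f n t))\<^sup>2)) \<noteq> \<infinity>"
    by (rule nn_integral_PInf_AE[OF _ fin]) measurable
  then have conv: "AE t in lborel. convergent (\<lambda>n. f n t)"
  proof eventually_elim
    case (elim t)
    have s: "summable (\<lambda>n. 2^n * (cmod (f (Suc n) t - f n t))\<^sup>2)"
      by (rule summable_suminf_not_top) (use elim in auto)
    have "summable (\<lambda>n. cmod (f (Suc n) t - f n t))"
    proof (rule summable_comparison_test')
      show "summable (\<lambda>n. (1/2)^n + 2^n * (cmod (f (Suc n) t - f n t))\<^sup>2)"
        by (intro summable_add s summable_geometric) auto
      fix n :: nat
      let ?d = "cmod (f (Suc n) t - f n t)"
      have "2 * (2^n * ?d) \<le> 1 + (2^n * ?d)\<^sup>2"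
        using sum_squares_bound[of 1 "2^n * ?d"] by simp
      then have "2^n * ?d \<le> 1 + (2^n * ?d)\<^sup>2"
        using mult_nonneg_nonneg[of "2^n" ?d] zero_le_power[of "2::real" n] norm_ge_zero[of "f (Suc n) t - f n t"]
        by linarith
      then have "(1/2)^n * (2^n * ?d) \<le> (1/2)^n * (1 + (2^n * ?d)\<^sup>2)"
        by (intro mult_left_mono) auto
      then show "norm ?d \<le> (1/2)^n + 2^n * ?d\<^sup>2"
        by (simp add: field_simps power2_eq_square)
    qed
    then have "summable (\<lambda>n. f (Suc n) t - f n t)"
      by (rule summable_norm_cancel)
    then have "convergent (\<lambda>n. \<Sum>i<n. f (Suc i) t - f i t)"
      by (simp add: summable_iff_convergent)
    then have "convergent (\<lambda>n. f n t - f 0 t)"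
      by (simp only: sum_lessThan_telescope[of "\<lambda>i. f i t"])
    then have "convergent (\<lambda>n. (f n t - f 0 t) + f 0 t)"
      by (intro convergent_add convergent_const)
    then show ?case by simp
  qed
  \<comment> \<open>On the null set of divergence \<open>lim\<close> takes some unspecified value;
    measurability holds regardless.\<close>
  define g where "g t = lim (\<lambda>n. f n t)" for t
  have [measurable]: "g \<in> borel_measurable borel"
    unfolding g_def by measurable
  have g_diff: "(\<integral>\<^sup>+t. ennreal ((cmod (g t - f n t))\<^sup>2) \<partial>lborel) \<le> ennreal (((1/2)^n)\<^sup>2)" for n
  proof -
    have "(\<integral>\<^sup>+t. ennreal ((cmod (g t - f n t))\<^sup>2) \<partial>lborel)
       = (\<integral>\<^sup>+t. liminf (\<lambda>m. ennreal ((cmod (f m t - f n t))\<^sup>2)) \<partial>lborel)"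
    proof (rule nn_integral_cong_AE)
      show "AE t in lborel. ennreal ((cmod (g t - f n t))\<^sup>2) = liminf (\<lambda>m. ennreal ((cmod (f m t - f n t))\<^sup>2))"
        using conv
      proof eventually_elim
        case (elim t)
        then have "(\<lambda>m. f m t) \<longlonglongrightarrow> g t"
          by (simp add: g_def convergent_LIMSEQ_iff)
        then have "(\<lambda>m. ennreal ((cmod (f m t - f n t))\<^sup>2)) \<longlonglongrightarrow> ennreal ((cmod (g t - f n t))\<^sup>2)"
          by (intro tendsto_intros)
        then show ?case
          by (intro lim_imp_Liminf[symmetric]) simp_all
      qed
    qed
    \<comment> \<open>Fatou's lemma in \<open>m\<close> with \<open>n\<close> fixed: the bound for
      pairs of terms passes to the limit.\<close>
    also have "\<dots> \<le> liminf (\<lambda>m. \<integral>\<^sup>+t. ennreal ((cmod (f m t - f n t))\<^sup>2) \<partial>lborel)"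
      by (intro nn_integral_liminf) auto
    also have "\<dots> \<le> ennreal (((1/2)^n)\<^sup>2)"
      by (rule Liminf_le) (use diff in \<open>auto simp: eventually_sequentially\<close>)
    finally show ?thesis .
  qed
  \<comment> \<open>The Fatou bound makes the differences square integrable; adding
    \<open>f 0\<close> back then gives it for \<open>g\<close>.\<close>
  have sqd: "square_integrable (\<lambda>t. g t - f n t)" for n
    by (rule square_integrableI_nn) (use g_diff[of n] in \<open>auto intro: le_less_trans\<close>)
  from square_integrable_add[OF sqd[of 0] sq[of 0]] have sqg: "square_integrable g"
    by simp
  have bound: "dist (X (r n)) (abs_l2 g) \<le> (1/2)^n" for n
  proof -
    have "ennreal ((norm (abs_l2 g - X (r n)))\<^sup>2) \<le> ennreal (((1/2)^n)\<^sup>2)"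
      unfolding abs_f[symmetric] minus_abs_l2[OF sqg sq] nn_norm_abs_l2[OF sqd] by (rule g_diff)
    then have "norm (abs_l2 g - X (r n)) \<le> (1/2)^n"
      by (subst (asm) ennreal_le_iff) (auto intro: power2_le_imp_le)
    then show ?thesis by (simp add: dist_norm norm_minus_commute)
  qed
  have "(\<lambda>n. dist ((X \<circ> r) n) (abs_l2 g)) \<longlonglongrightarrow> 0"
  proof (rule tendsto_sandwich[OF _ _ tendsto_const])
    show "(\<lambda>n. (1/2::real)^n) \<longlonglongrightarrow> 0" by (simp add: LIMSEQ_power_zero)
  qed (use bound in auto)
  then have "(X \<circ> r) \<longlonglongrightarrow> abs_l2 g"
    using tendsto_dist_iff by blast
  then have "X \<longlonglongrightarrow> abs_l2 g"
    using LIMSEQ_subseq_LIMSEQ Cauchy_converges_subseq assms r by blast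
  then show ?thesis by (rule convergentI)
qed

instance l2 :: (euclidean_space) complete_space
  by standard (rule l2_Cauchy_convergent)

instance l2 :: (euclidean_space) banach ..

section \<open>Projections, orthonormal sets\<close>

lemma cinner_add_right: "cinner x (y + z) = cinner x y + cinner x z"
  by (subst (1 2 3) cinner_commute) (simp add: cinner_add_left)

lemma cinner_scaleC_right: "cinner x (c *\<^sub>C y) = cnj c * cinner x y"
  by (subst (1 2) cinner_commute) (simp add: cinner_scaleC_left)

lemma cinner_zero_left [simp]: "cinner 0 x = 0"
  using cinner_scaleC_left[of 0 0 x] by simp

lemma cinner_zero_right [simp]: "cinner x 0 = 0"
  using cinner_scaleC_right[of x 0 0] by simp

lemma cinner_minus_left: "cinner (- x) y = - cinner x y"
  using cinner_scaleC_left[of "-1" x y] by simp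

lemma cinner_minus_right: "cinner x (- y) = - cinner x y"
  using cinner_scaleC_right[of x "-1" y] by simp

lemma cinner_diff_left: "cinner (x - y) z = cinner x z - cinner y z"
  using cinner_add_left[of x "- y" z] by (simp add: cinner_minus_left)

lemma cinner_diff_right: "cinner x (y - z) = cinner x y - cinner x z"
  using cinner_add_right[of x y "- z"] by (simp add: cinner_minus_right)

lemma cinner_sum_left: "cinner (sum f A) y = (\<Sum>a\<in>A. cinner (f a) y)"
  by (induction A rule: infinite_finite_induct) (simp_all add: cinner_add_left)

lemma cinner_sum_right: "cinner y (sum f A) = (\<Sum>a\<in>A. cinner y (f a))"
  by (induction A rule: infinite_finite_induct) (simp_all add: cinner_add_right)

lemmas cinner_algebra = cinner_add_left cinner_add_right cinner_diff_left cinner_diff_right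
  cinner_scaleC_left cinner_scaleC_right cinner_minus_left cinner_minus_right

lemma cinner_self: "cinner x x = complex_of_real ((norm x)\<^sup>2)"
  by (simp add: complex_eq_iff norm_l2_def cinner_self_nonneg cinner_self_real)

lemma cmod_cinner_commute: "cmod (cinner x y) = cmod (cinner y x)"
  by (subst cinner_commute) simp

lemma cinner_mult_commute: "cinner x y * cinner y x = complex_of_real ((cmod (cinner x y))\<^sup>2)"
proof -
  have "cinner y x = cnj (cinner x y)" by (rule cinner_commute)
  then show ?thesis by (simp only: complex_norm_square)
qed

lemma norm_scaleC [simp]: "norm (c *\<^sub>C x) = cmod c * norm (x :: 'a::euclidean_space l2)"
proof -
  have "complex_of_real ((norm (c *\<^sub>C x))\<^sup>2) = complex_of_real ((cmod c * norm x)\<^sup>2)"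
    unfolding cinner_self[symmetric] cinner_algebra
    by (simp add: cinner_self power_mult_distrib complex_norm_square mult_ac del: of_real_power)
  then have "(norm (c *\<^sub>C x))\<^sup>2 = (cmod c * norm x)\<^sup>2"
    by (simp only: of_real_eq_iff)
  then show ?thesis
    by (simp add: power2_eq_iff_nonneg)
qed

lemma scaleR_eq_scaleC: "r *\<^sub>R x = complex_of_real r *\<^sub>C (x :: 'a::euclidean_space l2)"
  by (rule scaleR_l2_def)

text \<open>The phase \<open>c\<close> is chosen such that \<open>\<langle>c x, y\<rangle> = |\<langle>x, y\<rangle>|\<close>; this reduces to the real
  Cauchy--Schwarz inequality.\<close>

lemma cinner_Cauchy_Schwarz: "cmod (cinner x y) \<le> norm x * norm y"
proof (cases "cinner x y = 0")
  case False
  define c where "c = cnj (cinner x y) / cmod (cinner x y)"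
  have "c * cinner x y = complex_of_real (cmod (cinner x y))"
    using False by (simp add: c_def complex_norm_square[symmetric] power2_eq_square mult.commute)
  then have "cmod (cinner x y) = inner (c *\<^sub>C x) y"
    by (simp add: inner_l2_def cinner_algebra)
  also have "\<dots> \<le> norm (c *\<^sub>C x) * norm y"
    by (rule norm_cauchy_schwarz)
  also have "\<dots> = norm x * norm y"
    using False by (simp add: c_def norm_divide)
  finally show ?thesis .
qed simp

lemma bounded_linear_cinner_left: "bounded_linear (\<lambda>x. cinner x y)"
  by (rule bounded_linear_intro[where K = "norm y"])
    (simp_all add: cinner_algebra scaleR_eq_scaleC cinner_Cauchy_Schwarz scaleR_conv_of_real)

lemmas continuous_on_cinner_left [continuous_intros] =
  bounded_linear.continuous_on[OF bounded_linear_cinner_left]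
lemmas tendsto_cinner_left = bounded_linear.tendsto[OF bounded_linear_cinner_left]
lemma cinner_ext: "(\<And>\<psi>. cinner x \<psi> = cinner y \<psi>) \<Longrightarrow> x = y"
proof -
  assume "\<And>\<psi>. cinner x \<psi> = cinner y \<psi>"
  then have "cinner (x - y) (x - y) = 0" by (simp add: cinner_algebra)
  then show ?thesis by (simp add: cinner_self)
qed

text \<open>A sequence minimising the distance to \<open>y\<close> is Cauchy by the parallelogram
  identity, because midpoints stay in \<open>V\<close>. Its limit is a nearest point, and a nearest
  point cannot be improved along any direction of \<open>V\<close>, which is orthogonality.\<close>

lemma closed_subspace_projection:
  fixes V :: "'b::{real_inner,complete_space} set"
  assumes V: "closed V" "subspace V"
  obtains p where "p \<in> V" "\<And>v. v \<in> V \<Longrightarrow> inner (y - p) v = 0"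
proof -
  have V0: "0 \<in> V" using V(2) by (rule subspace_0)
  define D where "D = (INF v\<in>V. (norm (y - v))\<^sup>2)"
  have bdd: "bdd_below ((\<lambda>v. (norm (y - v))\<^sup>2) ` V)"
    by (rule bdd_belowI2[of _ 0]) simp
  have D_le: "D \<le> (norm (y - v))\<^sup>2" if "v \<in> V" for v
    unfolding D_def by (rule cINF_lower[OF bdd that])
  have "\<exists>v\<in>V. (norm (y - v))\<^sup>2 < D + inverse (Suc n)" for n
    using cINF_less_iff[OF _ bdd, of "D + inverse (Suc n)"] V0 unfolding D_def[symmetric] by auto
  then obtain v where v: "\<And>n. v n \<in> V" "\<And>n. (norm (y - v n))\<^sup>2 < D + inverse (Suc n)"
    by metis
  have par: "(norm (v m - v n))\<^sup>2 \<le> 2 * inverse (Suc m) + 2 * inverse (Suc n)" for m n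
  proof -
    have mid: "(1/2) *\<^sub>R (v m + v n) \<in> V"
      using v(1) V(2) by (intro subspace_scale subspace_add)
    have "(norm (v m - v n))\<^sup>2 = 2 * (norm (y - v m))\<^sup>2 + 2 * (norm (y - v n))\<^sup>2
        - 4 * (norm (y - (1/2) *\<^sub>R (v m + v n)))\<^sup>2"
      by (simp add: power2_norm_eq_inner inner_diff_left inner_diff_right inner_add_left inner_add_right
          algebra_simps inner_commute)
    then show ?thesis
      using D_le[OF mid] v(2)[of m] v(2)[of n] by linarith
  qed
  have "Cauchy v"
  proof (rule metric_CauchyI)
    fix e :: real assume e: "e > 0"
    obtain N where N: "4 * inverse (real (Suc N)) < e\<^sup>2"
      using reals_Archimedean[of "e\<^sup>2 / 4"] e by (auto simp: field_simps)
    show "\<exists>M. \<forall>m\<ge>M. \<forall>n\<ge>M. dist (v m) (v n) < e"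
    proof (intro exI allI impI)
      fix m n assume "N \<le> m" "N \<le> n"
      then have "inverse (real (Suc m)) \<le> inverse (real (Suc N))" "inverse (real (Suc n)) \<le> inverse (real (Suc N))"
        by (auto intro: le_imp_inverse_le)
      with par[of m n] N have "(norm (v m - v n))\<^sup>2 < e\<^sup>2" by linarith
      then show "dist (v m) (v n) < e"
        using e by (simp add: dist_norm power_less_imp_less_base)
    qed
  qed
  then obtain p where p: "v \<longlonglongrightarrow> p"
    using Cauchy_convergent convergentD by blast
  have pV: "p \<in> V"
    using closed_sequentially[OF V(1) _ p] v(1) by auto
  have "(norm (y - p))\<^sup>2 \<le> D + 0"
  proof (rule LIMSEQ_le)
    show "(\<lambda>n. (norm (y - v n))\<^sup>2) \<longlonglongrightarrow> (norm (y - p))\<^sup>2"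
      by (intro tendsto_intros p)
    show "(\<lambda>n. D + inverse (real (Suc n))) \<longlonglongrightarrow> D + 0"
      by (intro tendsto_intros LIMSEQ_inverse_real_of_nat)
    show "\<exists>N. \<forall>n\<ge>N. (norm (y - v n))\<^sup>2 \<le> D + inverse (real (Suc n))"
      using v(2) less_imp_le by blast
  qed
  then have min: "(norm (y - p))\<^sup>2 \<le> (norm (y - u))\<^sup>2" if "u \<in> V" for u
    using D_le[OF that] by linarith
  have "inner (y - p) u = 0" if u: "u \<in> V" for u
  proof (rule ccontr)
    assume nz: "inner (y - p) u \<noteq> 0"
    \<comment> \<open>The minimiser of the distance from \<open>y\<close> to
      \<open>p + t *\<^sub>R u\<close>; for a nonzero inner product it would beat
      \<open>t = 0\<close>.\<close>
    define t where "t = inner (y - p) u / (norm u)\<^sup>2"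
    have u0: "(norm u)\<^sup>2 > 0" using nz by auto
    have "p + t *\<^sub>R u \<in> V" using pV u V(2) by (intro subspace_add subspace_scale)
    from min[OF this] have "0 \<le> (norm (y - (p + t *\<^sub>R u)))\<^sup>2 - (norm (y - p))\<^sup>2" by simp
    also have "\<dots> = t\<^sup>2 * (norm u)\<^sup>2 - 2 * t * inner (y - p) u"
      by (simp add: power2_norm_eq_inner inner_diff_left inner_diff_right inner_add_left inner_add_right
          algebra_simps inner_commute power2_eq_square[of t])
    also have "\<dots> = - (inner (y - p) u)\<^sup>2 / (norm u)\<^sup>2"
      using u0 by (simp add: t_def field_simps power2_eq_square)
    also have "\<dots> < 0" using u0 nz by (simp add: divide_neg_pos)
    finally show False by simp
  qed
  with pV show thesis by (rule that)
qed

text \<open>For nonzero \<open>L\<close>, the residual \<open>q\<close> of a vector outside the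
  kernel is orthogonal to the kernel, and every vector differs from a multiple of \<open>q\<close>
  by a kernel element. So \<open>L\<close> is a multiple of the inner product with
  \<open>q\<close>.\<close>

lemma Riesz_real:
  fixes L :: "'b::{real_inner,complete_space} \<Rightarrow> real"
  assumes L: "bounded_linear L"
  obtains \<eta> where "\<And>\<psi>. inner \<eta> \<psi> = L \<psi>"
proof (cases "\<forall>\<psi>. L \<psi> = 0")
  case True
  then show thesis by (intro that[of 0]) simp
next
  case False
  interpret L: bounded_linear L by fact
  from False obtain y where y: "L y \<noteq> 0" by blast
  have "closed {x. L x = 0}"
    by (intro closed_Collect_eq continuous_intros L.continuous_on)
  moreover have "subspace {x. L x = 0}"
    by (auto simp: subspace_def L.add L.scaleR)
  ultimately obtain p where p: "p \<in> {x. L x = 0}" "\<And>v. v \<in> {x. L x = 0} \<Longrightarrow> inner (y - p) v = 0"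
    using closed_subspace_projection[of "{x. L x = 0}" y] by blast
  define q where "q = y - p"
  have Lq: "L q = L y" using p(1) by (simp add: q_def L.diff)
  have q0: "inner q q \<noteq> 0" using Lq y L.zero by auto
  show thesis
  proof (rule that)
    fix \<psi>
    have "inner q (\<psi> - (L \<psi> / L q) *\<^sub>R q) = 0"
      using p(2) Lq y by (simp add: q_def[symmetric] L.diff L.scaleR)
    then have "inner q \<psi> = (L \<psi> / L q) * inner q q"
      by (simp add: inner_diff_right)
    then show "inner ((L q / inner q q) *\<^sub>R q) \<psi> = L \<psi>"
      using q0 Lq y by (simp add: field_simps)
  qed
qed

text \<open>\<open>L\<close> is conjugate linear because \<open>cinner\<close> is so in its second
  argument. The real theorem represents the real part of \<open>L\<close>; replacing
  \<open>\<psi>\<close> by \<open>\<i> *\<^sub>C \<psi>\<close> turns real into imaginary parts, so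
  the same vector represents \<open>L\<close> itself.\<close>

lemma Riesz_l2:
  fixes L :: "'a::euclidean_space l2 \<Rightarrow> complex"
  assumes add: "\<And>x y. L (x + y) = L x + L y" and scale: "\<And>c x. L (c *\<^sub>C x) = cnj c * L x"
    and bound: "\<And>x. cmod (L x) \<le> K * norm x"
  shows "\<exists>\<eta>. \<forall>\<psi>. cinner \<eta> \<psi> = L \<psi>"
proof -
  have "bounded_linear (\<lambda>x. Re (L x))"
  proof (rule bounded_linear_intro[where K = K])
    fix x
    show "norm (Re (L x)) \<le> norm x * K"
      using bound[of x] abs_Re_le_cmod[of "L x"] by (simp add: mult.commute)
  qed (simp_all add: add scale scaleR_eq_scaleC)
  then obtain \<eta> where \<eta>: "\<And>\<psi>. inner \<eta> \<psi> = Re (L \<psi>)"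
    using Riesz_real by blast
  have "cinner \<eta> \<psi> = L \<psi>" for \<psi>
    using \<eta>[of \<psi>] \<eta>[of "\<i> *\<^sub>C \<psi>"] by (simp add: complex_eq_iff inner_l2_def cinner_algebra scale)
  then show ?thesis by blast
qed

section \<open>Orthonormal families: Bessel, best approximation, Parseval\<close>

definition orthonormal :: "'a::euclidean_space l2 set \<Rightarrow> bool" where
  "orthonormal F \<longleftrightarrow> (\<forall>e\<in>F. \<forall>e'\<in>F. cinner e e' = (if e = e' then 1 else 0))"

lemma orthonormal_mono: "orthonormal F \<Longrightarrow> G \<subseteq> F \<Longrightarrow> orthonormal G"
  unfolding orthonormal_def by blast

lemma orthonormal_norm:
  assumes "orthonormal F" "e \<in> F"
  shows "norm e = 1"
proof -
  have "complex_of_real ((norm e)\<^sup>2) = complex_of_real 1"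
    using assms by (simp add: cinner_self[symmetric] orthonormal_def del: of_real_power)
  then have "(norm e)\<^sup>2 = 1" by (simp only: of_real_eq_iff)
  then show ?thesis using norm_ge_zero[of e] by (auto simp: power2_eq_1_iff)
qed

lemma onb_iff: "onb E \<longleftrightarrow> orthonormal E \<and> closure (l2.span E) = UNIV"
  by (simp add: onb_def orthonormal_def)

lemma cinner_orthonormal_sum:
  assumes "orthonormal F" "G \<subseteq> F" "finite G" "e \<in> F"
  shows "cinner (\<Sum>f\<in>G. c f *\<^sub>C f) e = (if e \<in> G then c e else 0)"
proof -
  have "cinner (\<Sum>f\<in>G. c f *\<^sub>C f) e = (\<Sum>f\<in>G. if f = e then c f else 0)"
    unfolding cinner_sum_left
    by (rule sum.cong) (use assms in \<open>auto simp: cinner_scaleC_left orthonormal_def\<close>)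
  then show ?thesis using assms by simp
qed

lemma norm_orthonormal_sum:
  assumes "orthonormal G" "finite G"
  shows "(norm (\<Sum>f\<in>G. c f *\<^sub>C f))\<^sup>2 = (\<Sum>f\<in>G. (cmod (c f))\<^sup>2)"
proof -
  let ?x = "\<Sum>f\<in>G. c f *\<^sub>C f"
  have "cinner ?x ?x = (\<Sum>f\<in>G. cnj (c f) * cinner ?x f)"
    by (subst cinner_sum_right) (simp add: cinner_scaleC_right)
  also have "\<dots> = (\<Sum>f\<in>G. complex_of_real ((cmod (c f))\<^sup>2))"
    using assms by (intro sum.cong) (auto simp: cinner_orthonormal_sum[OF assms(1)] complex_norm_square mult.commute simp del: of_real_power)
  finally have "complex_of_real ((norm ?x)\<^sup>2) = complex_of_real (\<Sum>f\<in>G. (cmod (c f))\<^sup>2)"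
    by (simp add: cinner_self)
  then show ?thesis by (simp only: of_real_eq_iff)
qed

lemma norm_diff_orthonormal_proj:
  assumes "orthonormal G" "finite G"
  shows "(norm (x - (\<Sum>f\<in>G. cinner x f *\<^sub>C f)))\<^sup>2 = (norm x)\<^sup>2 - (\<Sum>f\<in>G. (cmod (cinner x f))\<^sup>2)"
proof -
  let ?p = "\<Sum>f\<in>G. cinner x f *\<^sub>C f"
  have "cinner x ?p = (\<Sum>f\<in>G. complex_of_real ((cmod (cinner x f))\<^sup>2))"
    by (simp add: cinner_sum_right cinner_scaleC_right complex_norm_square mult.commute del: of_real_power)
  then have "inner x ?p = (\<Sum>f\<in>G. (cmod (cinner x f))\<^sup>2)"
    by (simp add: inner_l2_def)
  moreover have "(norm (x - ?p))\<^sup>2 = (norm x)\<^sup>2 - 2 * inner x ?p + (norm ?p)\<^sup>2"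
    by (simp add: power2_norm_eq_inner inner_diff_left inner_diff_right inner_commute)
  ultimately show ?thesis
    by (simp add: norm_orthonormal_sum[OF assms])
qed

lemma Bessel_finite:
  assumes "orthonormal G" "finite G"
  shows "(\<Sum>f\<in>G. (cmod (cinner x f))\<^sup>2) \<le> (norm x)\<^sup>2"
  using norm_diff_orthonormal_proj[OF assms, of x] zero_le_power2[of "norm (x - (\<Sum>f\<in>G. cinner x f *\<^sub>C f))"]
  by linarith

text \<open>The residual is orthogonal to the span of \<open>G\<close>, so Pythagoras splits the
  distance to any competitor \<open>v\<close>.\<close>

lemma orthonormal_proj_best:
  assumes G: "orthonormal G" "finite G" and v: "v \<in> l2.span G"
  shows "norm (x - (\<Sum>f\<in>G. cinner x f *\<^sub>C f)) \<le> norm (x - v)"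
proof -
  let ?p = "\<Sum>f\<in>G. cinner x f *\<^sub>C f"
  obtain c where c: "v = (\<Sum>f\<in>G. c f *\<^sub>C f)"
    using v l2.span_finite[OF G(2)] by blast
  have "?p - v = (\<Sum>f\<in>G. (cinner x f - c f) *\<^sub>C f)"
    by (simp add: c sum_subtractf l2.scale_left_diff_distrib)
  moreover have "cinner (x - ?p) f = 0" if "f \<in> G" for f
    using cinner_orthonormal_sum[OF G(1) subset_refl G(2) that] that by (simp add: cinner_diff_left)
  ultimately have "cinner (x - ?p) (?p - v) = 0"
    by (simp add: cinner_sum_right cinner_scaleC_right)
  then have o: "inner (x - ?p) (?p - v) = 0" by (simp add: inner_l2_def)
  have "(norm (x - v))\<^sup>2 = (norm ((x - ?p) + (?p - v)))\<^sup>2" by simp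
  also have "\<dots> = (norm (x - ?p))\<^sup>2 + (norm (?p - v))\<^sup>2"
    unfolding power2_norm_eq_inner using o
    by (simp only: inner_add_left inner_add_right inner_commute[of "?p - v" "x - ?p"])
  finally have "(norm (x - ?p))\<^sup>2 \<le> (norm (x - v))\<^sup>2" by simp
  then show ?thesis by (rule power2_le_imp_le) simp
qed

text \<open>A nearby element of the span uses only finitely many vectors \<open>G\<close>, and by
  best approximation every larger finite set does at least as well. Uniformity over all
  \<open>G'\<close> above \<open>G\<close> is what convergence along finite subsets demands.\<close>

lemma closure_span_approx:
  assumes F: "orthonormal F" and x: "x \<in> closure (l2.span F)" and "\<epsilon> > 0"
  obtains G where "finite G" "G \<subseteq> F"
    "\<And>G'. finite G' \<Longrightarrow> G \<subseteq> G' \<Longrightarrow> G' \<subseteq> F \<Longrightarrow> norm (x - (\<Sum>f\<in>G'. cinner x f *\<^sub>C f)) < \<epsilon>"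
proof -
  obtain v where v: "v \<in> l2.span F" "dist v x < \<epsilon>"
    using x \<open>\<epsilon> > 0\<close> closure_approachable by blast
  obtain G where G: "finite G" "G \<subseteq> F" "v \<in> l2.span G"
  proof -
    obtain G c where "finite G" "G \<subseteq> F" "v = (\<Sum>a\<in>G. c a *\<^sub>C a)"
      using v(1) unfolding l2.span_explicit by blast
    then show thesis
      by (intro that) (auto intro: l2.span_sum l2.span_scale l2.span_base)
  qed
  show thesis
  proof (rule that[OF G(1,2)])
    fix G' assume G': "finite G'" "G \<subseteq> G'" "G' \<subseteq> F"
    have "v \<in> l2.span G'" using G(3) l2.span_mono[OF G'(2)] by blast
    then have "norm (x - (\<Sum>f\<in>G'. cinner x f *\<^sub>C f)) \<le> norm (x - v)"
      by (rule orthonormal_proj_best[OF orthonormal_mono[OF F G'(3)] G'(1)])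
    then show "norm (x - (\<Sum>f\<in>G'. cinner x f *\<^sub>C f)) < \<epsilon>"
      using v(2) by (simp add: dist_norm norm_minus_commute)
  qed
qed

lemma has_sum_orthonormal_expansion:
  assumes F: "orthonormal F" and x: "x \<in> closure (l2.span F)"
  shows "((\<lambda>f. cinner x f *\<^sub>C f) has_sum x) F"
  unfolding has_sum_def tendsto_iff
proof (intro allI impI)
  fix \<epsilon> :: real assume "\<epsilon> > 0"
  obtain G where "finite G" "G \<subseteq> F" and
    *: "\<And>G'. finite G' \<Longrightarrow> G \<subseteq> G' \<Longrightarrow> G' \<subseteq> F \<Longrightarrow> norm (x - (\<Sum>f\<in>G'. cinner x f *\<^sub>C f)) < \<epsilon>"
    using closure_span_approx[OF F x \<open>\<epsilon> > 0\<close>] by blast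
  then show "\<forall>\<^sub>F Y in finite_subsets_at_top F. dist (\<Sum>f\<in>Y. cinner x f *\<^sub>C f) x < \<epsilon>"
    unfolding eventually_finite_subsets_at_top
    by (intro exI[of _ G]) (auto simp: dist_norm norm_minus_commute)
qed

lemma has_sum_Parseval_cinner:
  assumes "orthonormal F" "x \<in> closure (l2.span F)"
  shows "((\<lambda>f. cinner x f * cinner f y) has_sum cinner x y) F"
  using has_sum_bounded_linear[OF bounded_linear_cinner_left has_sum_orthonormal_expansion[OF assms], of y]
  by (simp add: o_def cinner_scaleC_left)

lemma has_sum_Parseval:
  assumes "orthonormal F" "x \<in> closure (l2.span F)"
  shows "((\<lambda>f. (cmod (cinner x f))\<^sup>2) has_sum (norm x)\<^sup>2) F"
  using has_sum_Parseval_cinner[OF assms, of x]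
  by (simp add: cinner_self cinner_mult_commute has_sum_of_real_iff del: of_real_power)


section \<open>Orthogonal projections and maximal orthonormal families\<close>

lemma subspace_closure:
  fixes V :: "'b::real_normed_vector set"
  assumes "subspace V"
  shows "subspace (closure V)"
  unfolding subspace_def
proof (intro conjI ballI allI)
  show "0 \<in> closure V"
    using subspace_0[OF assms] closure_subset by blast
  show "x + y \<in> closure V" if x: "x \<in> closure V" and y: "y \<in> closure V" for x y
  proof -
    obtain a where "\<And>n. a n \<in> V" "a \<longlonglongrightarrow> x"
      using x unfolding closure_sequential by blast
    moreover obtain b where "\<And>n. b n \<in> V" "b \<longlonglongrightarrow> y"
      using y unfolding closure_sequential by blast
    ultimately have "\<And>n. a n + b n \<in> V" "(\<lambda>n. a n + b n) \<longlonglongrightarrow> x + y"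
      using assms by (auto intro: subspace_add tendsto_add)
    then show ?thesis unfolding closure_sequential by (intro exI[of _ "\<lambda>n. a n + b n"]) auto
  qed
  show "c *\<^sub>R x \<in> closure V" if x: "x \<in> closure V" for c x
  proof -
    obtain a where "\<And>n. a n \<in> V" "a \<longlonglongrightarrow> x"
      using x unfolding closure_sequential by blast
    then have "\<And>n. c *\<^sub>R a n \<in> V" "(\<lambda>n. c *\<^sub>R a n) \<longlonglongrightarrow> c *\<^sub>R x"
      using assms by (auto intro: subspace_scale tendsto_scaleR)
    then show ?thesis unfolding closure_sequential by (intro exI[of _ "\<lambda>n. c *\<^sub>R a n"]) auto
  qed
qed

text \<open>The real projection already works: the complex span contains
  \<open>\<i> *\<^sub>C f\<close> along with \<open>f\<close>, and testing against both gives the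
  real and the imaginary part of the complex orthogonality.\<close>

lemma closure_span_projection:
  obtains p where "p \<in> closure (l2.span F)" "\<And>f. f \<in> F \<Longrightarrow> cinner (x - p) f = 0"
proof -
  have "subspace (l2.span F)"
    by (auto simp: subspace_def scaleR_eq_scaleC l2.span_zero l2.span_add l2.span_scale)
  then have "subspace (closure (l2.span F))"
    by (rule subspace_closure)
  then obtain p where p: "p \<in> closure (l2.span F)" "\<And>v. v \<in> closure (l2.span F) \<Longrightarrow> inner (x - p) v = 0"
    using closed_subspace_projection[OF closed_closure] by blast
  have "cinner (x - p) f = 0" if "f \<in> F" for f
  proof -
    have "f \<in> closure (l2.span F)" "\<i> *\<^sub>C f \<in> closure (l2.span F)"
      using that closure_subset[of "l2.span F"] by (auto intro: l2.span_base l2.span_scale)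
    from p(2)[OF this(1)] p(2)[OF this(2)] show ?thesis
      by (simp add: complex_eq_iff inner_l2_def cinner_scaleC_right)
  qed
  with p(1) show thesis by (rule that)
qed

text \<open>Zorn's lemma relative to an arbitrary \<open>X\<close>. With \<open>X = UNIV\<close> it
  yields orthonormal bases, with \<open>X\<close> the unit eigenvectors of positive eigenvalue it
  yields the spectral decomposition.\<close>

lemma maximal_orthonormal_subset:
  obtains F where "F \<subseteq> X" "orthonormal F"
    "\<And>x. x \<in> X \<Longrightarrow> norm x = 1 \<Longrightarrow> (\<And>f. f \<in> F \<Longrightarrow> cinner x f = 0) \<Longrightarrow> False"
proof -
  have "\<exists>M\<in>{F. F \<subseteq> X \<and> orthonormal F}. \<forall>N\<in>{F. F \<subseteq> X \<and> orthonormal F}. M \<subseteq> N \<longrightarrow> N = M"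
  proof (rule subset_Zorn')
    fix C assume C: "subset.chain {F. F \<subseteq> X \<and> orthonormal F} C"
    have "orthonormal (\<Union>C)"
      unfolding orthonormal_def
    proof (intro ballI)
      fix e e' assume "e \<in> \<Union>C" "e' \<in> \<Union>C"
      then obtain A B where "A \<in> C" "B \<in> C" "e \<in> A" "e' \<in> B" by blast
      moreover from this C have "A \<subseteq> B \<or> B \<subseteq> A" by (auto simp: subset_chain_def)
      ultimately obtain D where "D \<in> C" "e \<in> D" "e' \<in> D" by blast
      moreover have "orthonormal D" using C \<open>D \<in> C\<close> by (auto simp: subset_chain_def)
      ultimately show "cinner e e' = (if e = e' then 1 else 0)" by (simp add: orthonormal_def)
    qed
    then show "\<Union>C \<in> {F. F \<subseteq> X \<and> orthonormal F}"
      using C by (auto simp: subset_chain_def)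
  qed
  then obtain F where F: "F \<subseteq> X" "orthonormal F"
    and max: "\<And>N. N \<subseteq> X \<Longrightarrow> orthonormal N \<Longrightarrow> F \<subseteq> N \<Longrightarrow> N = F"
    by auto
  show thesis
  proof (rule that[OF F])
    fix x assume x: "x \<in> X" "norm x = 1" "\<And>f. f \<in> F \<Longrightarrow> cinner x f = 0"
    have notin: "x \<notin> F"
      using x(2) x(3)[of x] by (auto simp: cinner_self)
    have "cinner f x = 0" if "f \<in> F" for f
      using x(3)[OF that] by (subst cinner_commute) simp
    with notin have "orthonormal (insert x F)"
      using F(2) x(2,3) by (auto simp: orthonormal_def cinner_self)
    with max[of "insert x F"] x(1) F(1) notin show False by auto
  qed
qed

text \<open>A maximal orthonormal family is total, since otherwise the normalised residual of a
  projection could be adjoined. This makes the choice inside \<open>op_trace\<close> an actual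
  basis.\<close>

lemma onb_SOME: "onb (SOME E :: 'a::euclidean_space l2 set. onb E)"
proof -
  obtain F :: "'a l2 set" where F: "orthonormal F"
    "\<And>x. norm x = 1 \<Longrightarrow> (\<And>f. f \<in> F \<Longrightarrow> cinner x f = 0) \<Longrightarrow> False"
    using maximal_orthonormal_subset[of UNIV] by (metis UNIV_I)
  have "x \<in> closure (l2.span F)" for x
  proof -
    obtain p where p: "p \<in> closure (l2.span F)" "\<And>f. f \<in> F \<Longrightarrow> cinner (x - p) f = 0"
      using closure_span_projection by blast
    have "x = p"
    proof (rule ccontr)
      assume "x \<noteq> p"
      then show False
        using F(2)[of "complex_of_real (inverse (norm (x - p))) *\<^sub>C (x - p)"] p(2)
        by (simp add: cinner_scaleC_left norm_inverse)
    qed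
    with p(1) show ?thesis by simp
  qed
  with F(1) have "onb F" by (auto simp: onb_iff)
  then show ?thesis by (rule someI)
qed

section \<open>Positive operators of finite trace\<close>

lemma bounded_op_add: "bounded_op A \<Longrightarrow> A (x + y) = A x + A y"
  by (simp add: bounded_op_def linear_add bounded_linear.linear)

lemma bounded_op_diff: "bounded_op A \<Longrightarrow> A (x - y) = A x - A y"
  by (simp add: bounded_op_def linear_diff bounded_linear.linear)

lemma bounded_op_scaleC: "bounded_op A \<Longrightarrow> A (c *\<^sub>C x) = c *\<^sub>C A x"
  by (simp add: bounded_op_def)

lemma bounded_op_scaleR: "bounded_op A \<Longrightarrow> A (c *\<^sub>R x) = c *\<^sub>R A x"
  by (simp add: bounded_op_scaleC scaleR_eq_scaleC)

lemma bounded_op_zero: "bounded_op A \<Longrightarrow> A 0 = 0"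
  using bounded_op_scaleC[of A 0 0] by simp

lemma bounded_op_sum: "bounded_op A \<Longrightarrow> A (sum f X) = (\<Sum>x\<in>X. A (f x))"
  by (induction X rule: infinite_finite_induct) (simp_all add: bounded_op_add bounded_op_zero)

lemma positive_op_bounded: "positive_op A \<Longrightarrow> bounded_op A"
  by (simp add: positive_op_def)

lemma positive_op_inner: "positive_op A \<Longrightarrow> 0 \<le> inner (A x) x"
  by (simp add: positive_op_def inner_l2_def)

text \<open>Polarisation: reality of the quadratic form at \<open>x + y\<close> settles the
  imaginary parts, and at \<open>\<i> *\<^sub>C x + y\<close> the real parts.\<close>

lemma positive_op_selfadjoint:
  assumes A: "positive_op A"
  shows "cinner (A x) y = cinner x (A y)"
proof -
  note b = positive_op_bounded[OF A]
  have im: "Im (cinner (A z) z) = 0" for z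
    using A by (simp add: positive_op_def complex_is_Real_iff)
  have "Im (cinner (A x) y) + Im (cinner (A y) x) = 0"
    using im[of "x + y"] im[of x] im[of y] by (simp add: bounded_op_add[OF b] cinner_algebra)
  moreover have "Re (cinner (A x) y) = Re (cinner (A y) x)"
    using im[of "\<i> *\<^sub>C x + y"] im[of x] im[of y]
    by (simp add: bounded_op_add[OF b] bounded_op_scaleC[OF b] cinner_algebra)
  ultimately have "cinner (A x) y = cnj (cinner (A y) x)"
    by (simp add: complex_eq_iff)
  then show ?thesis by (simp add: cinner_commute[of x "A y"])
qed

text \<open>The form \<open>\<langle>A v, v\<rangle>\<close> is nonnegative at \<open>v = x - A x / K\<close>.\<close>

lemma positive_op_norm_le:
  assumes A: "positive_op A" and "K > 0" and K: "inner (A (A x)) (A x) \<le> K * (norm (A x))\<^sup>2"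
  shows "(norm (A x))\<^sup>2 \<le> K * inner (A x) x"
proof -
  note b = positive_op_bounded[OF A]
  have sym: "inner (A (A x)) x = (norm (A x))\<^sup>2"
    using positive_op_selfadjoint[OF A, of "A x" x] by (simp add: inner_l2_def cinner_self)
  have "0 \<le> inner (A (x - (1/K) *\<^sub>R A x)) (x - (1/K) *\<^sub>R A x)"
    by (rule positive_op_inner[OF A])
  also have "\<dots> = inner (A x) x - 2 / K * (norm (A x))\<^sup>2 + (1/K)\<^sup>2 * inner (A (A x)) (A x)"
    by (simp add: bounded_op_diff[OF b] bounded_op_scaleR[OF b] inner_diff_left inner_diff_right sym
        power2_norm_eq_inner[symmetric] power2_eq_square[of "1/K"] algebra_simps)
  also have "\<dots> \<le> inner (A x) x - 2 / K * (norm (A x))\<^sup>2 + (1/K)\<^sup>2 * (K * (norm (A x))\<^sup>2)"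
    by (intro add_left_mono mult_left_mono K) auto
  also have "\<dots> = inner (A x) x - (norm (A x))\<^sup>2 / K"
    using \<open>K > 0\<close> by (simp add: field_simps power2_eq_square)
  finally show ?thesis
    using \<open>K > 0\<close> by (simp add: field_simps)
qed

lemma bounded_op_norm_bound:
  assumes "bounded_op A"
  obtains K where "K > 0" "\<And>x. norm (A x) \<le> K * norm x"
  using assms bounded_linear.pos_bounded[of A] by (auto simp: bounded_op_def mult.commute)

lemma positive_op_norm_bound:
  assumes A: "positive_op A"
  obtains K where "K > 0" "\<And>x. norm (A x) \<le> K * norm x" "\<And>x. (norm (A x))\<^sup>2 \<le> K * inner (A x) x"
proof -
  obtain K where K: "K > 0" "\<And>x. norm (A x) \<le> K * norm x"
    using bounded_op_norm_bound[OF positive_op_bounded[OF A]] by blast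
  have "inner (A x) x \<le> K * (norm x)\<^sup>2" for x
  proof -
    have "inner (A x) x \<le> norm (A x) * norm x" by (rule norm_cauchy_schwarz)
    also have "\<dots> \<le> K * norm x * norm x" by (intro mult_right_mono K) auto
    finally show ?thesis by (simp add: power2_eq_square mult.assoc)
  qed
  with K show thesis by (intro that positive_op_norm_le[OF A]) auto
qed

section \<open>Compactness of positive operators with finite trace\<close>

lemma norm_sum_scaleC_le:
  "norm (\<Sum>e\<in>D. c e *\<^sub>C v e) \<le> sqrt (\<Sum>e\<in>D. (cmod (c e))\<^sup>2) * sqrt (\<Sum>e\<in>D. (norm (v e))\<^sup>2)"
proof -
  have "norm (\<Sum>e\<in>D. c e *\<^sub>C v e) \<le> (\<Sum>e\<in>D. cmod (c e) * norm (v e))"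
    by (rule sum_norm_le) simp
  also have "\<dots> \<le> sqrt ((\<Sum>e\<in>D. (cmod (c e))\<^sup>2) * (\<Sum>e\<in>D. (norm (v e))\<^sup>2))"
    by (rule real_le_rsqrt[OF Cauchy_Schwarz_ineq_sum])
  finally show ?thesis by (simp add: real_sqrt_mult)
qed

text \<open>Finite-dimensional compactness, by induction: one more vector makes the set a continuous
  image of the product of the closed unit disc with the previous set. The bound 1 suits coefficients
  of unit vectors against an orthonormal family.\<close>

lemma compact_unit_combinations:
  fixes v :: "'b \<Rightarrow> 'a::euclidean_space l2"
  assumes "finite F"
  shows "compact {\<Sum>e\<in>F. c e *\<^sub>C v e | c. \<forall>e\<in>F. cmod (c e) \<le> 1}"
  using assms
proof (induction F)
  case empty
  show ?case by simp
next
  case (insert a F)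
  let ?C = "{\<Sum>e\<in>F. c e *\<^sub>C v e | c. \<forall>e\<in>F. cmod (c e) \<le> 1}"
  have "bounded_linear (\<lambda>c. c *\<^sub>C v a)"
    by (rule bounded_linear_intro[where K = "norm (v a)"])
      (simp_all add: l2.scale_left_distrib scaleR_eq_scaleC scaleR_conv_of_real)
  then have "continuous_on UNIV (\<lambda>c. c *\<^sub>C v a)"
    by (rule linear_continuous_on)
  then have "continuous_on (cball 0 1 \<times> ?C) (\<lambda>(c, x). c *\<^sub>C v a + x)"
    by (auto simp: case_prod_unfold intro!: continuous_intros continuous_on_compose2[of UNIV "\<lambda>c. c *\<^sub>C v a"])
  then have "compact ((\<lambda>(c, x). c *\<^sub>C v a + x) ` (cball 0 1 \<times> ?C))"
    by (intro compact_continuous_image compact_Times insert.IH compact_cball)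
  also have "(\<lambda>(c, x). c *\<^sub>C v a + x) ` (cball 0 1 \<times> ?C) = {\<Sum>e\<in>insert a F. c e *\<^sub>C v e | c. \<forall>e\<in>insert a F. cmod (c e) \<le> 1}"
  proof safe
    fix c d assume "\<forall>e\<in>F. cmod (d e) \<le> 1" "c \<in> cball (0::complex) 1"
    moreover have "(\<Sum>e\<in>F. (d(a := c)) e *\<^sub>C v e) = (\<Sum>e\<in>F. d e *\<^sub>C v e)"
      using insert.hyps by (intro sum.cong) auto
    ultimately show "\<exists>c'. c *\<^sub>C v a + (\<Sum>e\<in>F. d e *\<^sub>C v e) = (\<Sum>e\<in>insert a F. c' e *\<^sub>C v e) \<and> (\<forall>e\<in>insert a F. cmod (c' e) \<le> 1)"
      using insert.hyps by (intro exI[of _ "d(a := c)"]) auto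
  next
    fix c assume "\<forall>e\<in>insert a F. cmod (c e) \<le> 1"
    then show "(\<Sum>e\<in>insert a F. c e *\<^sub>C v e) \<in> (\<lambda>(c, x). c *\<^sub>C v a + x) ` (cball 0 1 \<times> ?C)"
      using insert.hyps by (intro image_eqI[of _ _ "(c a, \<Sum>e\<in>F. c e *\<^sub>C v e)"]) auto
  qed
  finally show ?case .
qed

lemma summable_on_small_tails:
  fixes f :: "'b \<Rightarrow> real"
  assumes "f summable_on E" "\<And>e. e \<in> E \<Longrightarrow> f e \<ge> 0" "\<epsilon> > 0"
  obtains F where "finite F" "F \<subseteq> E" "\<And>D. finite D \<Longrightarrow> D \<subseteq> E - F \<Longrightarrow> sum f D < \<epsilon>"
proof -
  have "(f has_sum infsum f E) E" using assms(1) by simp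
  then have "\<forall>\<^sub>F Y in finite_subsets_at_top E. dist (sum f Y) (infsum f E) < \<epsilon>"
    using \<open>\<epsilon> > 0\<close> by (simp add: has_sum_def tendsto_iff)
  then have "\<exists>F. finite F \<and> F \<subseteq> E \<and>
      (\<forall>Y. finite Y \<and> F \<subseteq> Y \<and> Y \<subseteq> E \<longrightarrow> dist (sum f Y) (infsum f E) < \<epsilon>)"
    by (simp only: eventually_finite_subsets_at_top)
  then obtain F where F: "finite F" "F \<subseteq> E"
    and *: "\<forall>Y. finite Y \<and> F \<subseteq> Y \<and> Y \<subseteq> E \<longrightarrow> dist (sum f Y) (infsum f E) < \<epsilon>"
    by (elim exE conjE)
  show thesis
  proof (rule that[OF F])
    fix D assume D: "finite D" "D \<subseteq> E - F"
    have "sum f D = sum f (F \<union> D) - sum f F"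
      using D F by (subst sum.union_disjoint) auto
    also have "sum f (F \<union> D) \<le> infsum f E"
      using D F assms by (intro finite_sum_le_infsum) auto
    also have "infsum f E - sum f F < \<epsilon>"
      using spec[OF *, of F] F by (simp add: dist_real_def)
    finally show "sum f D < \<epsilon>" by simp
  qed
qed

text \<open>Since \<open>(norm (A e))\<^sup>2 \<le> K * inner (A e) e\<close>, finiteness of the
  trace makes the vectors \<open>A e\<close> square summable. Up to a small error, the image of the
  unit ball therefore consists of combinations of finitely many \<open>A e\<close> with coefficients
  of modulus at most 1, a compact set; hence it is totally bounded.\<close>

lemma finite_trace_compact:
  assumes A: "positive_op A" and E: "onb E" and sm: "(\<lambda>e. inner (A e) e) summable_on E"
  shows "compact (closure (A ` cball 0 1))"
  unfolding compact_eq_totally_bounded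
proof (intro conjI allI impI)
  show "complete (closure (A ` cball 0 1))"
    by (simp add: complete_eq_closed)
next
  fix \<epsilon> :: real assume \<epsilon>: "\<epsilon> > 0"
  note b = positive_op_bounded[OF A]
  have on: "orthonormal E" and cl: "closure (l2.span E) = UNIV"
    using E by (auto simp: onb_iff)
  obtain K where K: "K > 0" "\<And>x. norm (A x) \<le> K * norm x" "\<And>x. (norm (A x))\<^sup>2 \<le> K * inner (A x) x"
    using positive_op_norm_bound[OF A] by blast
  \<comment> \<open>The threshold is chosen so that, after multiplication by \<open>K\<close>, the
    vectors \<open>A e\<close> outside \<open>F\<close> have square sums at most
    \<open>(\<epsilon>/8)\<^sup>2\<close>.\<close>
  obtain F where F: "finite F" "F \<subseteq> E"
    and tail: "\<And>D. finite D \<Longrightarrow> D \<subseteq> E - F \<Longrightarrow> (\<Sum>e\<in>D. inner (A e) e) < (\<epsilon>/8)\<^sup>2 / K"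
    using summable_on_small_tails[OF sm, of "(\<epsilon>/8)\<^sup>2 / K"] positive_op_inner[OF A] \<epsilon> K(1) by auto
  define C where "C = {\<Sum>e\<in>F. c e *\<^sub>C A e | c. \<forall>e\<in>F. cmod (c e) \<le> 1}"
  have near: "\<exists>c\<in>C. dist (A x) c < \<epsilon>/4" if x: "norm x \<le> 1" for x
  proof -
    obtain G where G: "finite G" "G \<subseteq> E"
      and G': "\<And>G'. finite G' \<Longrightarrow> G \<subseteq> G' \<Longrightarrow> G' \<subseteq> E \<Longrightarrow>
        norm (x - (\<Sum>f\<in>G'. cinner x f *\<^sub>C f)) < \<epsilon>/8/K"
      using closure_span_approx[OF on, of x "\<epsilon>/8/K"] cl \<epsilon> K(1) by auto
    define D where "D = G - F"
    have D: "finite D" "D \<subseteq> E - F" using G by (auto simp: D_def)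
    define y where "y = (\<Sum>e\<in>F. cinner x e *\<^sub>C A e)"
    define r where "r = (\<Sum>e\<in>D. cinner x e *\<^sub>C A e)"
    have "norm (x - (\<Sum>f\<in>F \<union> D. cinner x f *\<^sub>C f)) < \<epsilon>/8/K"
      using G F D by (intro G') (auto simp: D_def)
    moreover have "A (\<Sum>f\<in>F \<union> D. cinner x f *\<^sub>C f) = y + r"
      using F D unfolding y_def r_def
      by (subst sum.union_disjoint) (auto simp: bounded_op_add[OF b] bounded_op_sum[OF b] bounded_op_scaleC[OF b])
    ultimately have 1: "norm (A x - (y + r)) < \<epsilon>/8"
      using K(2)[of "x - (\<Sum>f\<in>F \<union> D. cinner x f *\<^sub>C f)"] K(1)
      by (simp add: bounded_op_diff[OF b] field_simps)
    have "norm r \<le> sqrt (\<Sum>e\<in>D. (cmod (cinner x e))\<^sup>2) * sqrt (\<Sum>e\<in>D. (norm (A e))\<^sup>2)"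
      unfolding r_def by (rule norm_sum_scaleC_le)
    also have "\<dots> \<le> 1 * (\<epsilon>/8)"
    proof (intro mult_mono)
      have "(\<Sum>e\<in>D. (cmod (cinner x e))\<^sup>2) \<le> (norm x)\<^sup>2"
        using D by (intro Bessel_finite orthonormal_mono[OF on]) auto
      also have "\<dots> \<le> 1" using x by (simp add: power_le_one)
      finally show "sqrt (\<Sum>e\<in>D. (cmod (cinner x e))\<^sup>2) \<le> 1" by simp
      have "(\<Sum>e\<in>D. (norm (A e))\<^sup>2) \<le> (\<Sum>e\<in>D. K * inner (A e) e)"
        by (intro sum_mono K)
      also have "\<dots> \<le> (\<epsilon>/8)\<^sup>2"
        using tail[OF D] K(1) by (simp add: sum_distrib_left[symmetric] field_simps)
      finally show "sqrt (\<Sum>e\<in>D. (norm (A e))\<^sup>2) \<le> \<epsilon>/8"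
        using \<epsilon> by (intro real_le_lsqrt) auto
    qed (auto intro: sum_nonneg)
    finally have 2: "norm r \<le> \<epsilon>/8" by simp
    have "norm (A x - y) \<le> norm (A x - (y + r)) + norm r"
      using norm_triangle_ineq[of "A x - (y + r)" r] by simp
    with 1 2 have "dist (A x) y < \<epsilon>/4" by (simp add: dist_norm)
    moreover have "y \<in> C"
      unfolding C_def y_def
    proof (intro CollectI exI[of _ "cinner x"] conjI ballI refl)
      fix e assume "e \<in> F"
      then have "norm e = 1" using F on orthonormal_norm by blast
      then show "cmod (cinner x e) \<le> 1"
        using cinner_Cauchy_Schwarz[of x e] x by simp
    qed
    ultimately show ?thesis by blast
  qed
  have "compact C" unfolding C_def by (rule compact_unit_combinations[OF F(1)])
  then obtain k where k: "finite k" "C \<subseteq> (\<Union>x\<in>k. ball x (\<epsilon>/2))"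
    unfolding compact_eq_totally_bounded using half_gt_zero[OF \<epsilon>] by blast
  \<comment> \<open>Error budget: \<open>\<epsilon>/4\<close> for the closure,
    \<open>\<epsilon>/4\<close> from \<open>near\<close>, \<open>\<epsilon>/2\<close> from the
    finite net of \<open>C\<close>.\<close>
  show "\<exists>k. finite k \<and> closure (A ` cball 0 1) \<subseteq> (\<Union>x\<in>k. ball x \<epsilon>)"
  proof (intro exI[of _ k] conjI k(1) subsetI)
    fix x assume "x \<in> closure (A ` cball 0 1)"
    moreover have "\<epsilon>/4 > 0" using \<epsilon> by simp
    ultimately have "\<exists>w\<in>A ` cball 0 1. dist w x < \<epsilon>/4"
      unfolding closure_approachable by blast
    then obtain u where u: "norm u \<le> 1" "dist (A u) x < \<epsilon>/4"
      by auto
    obtain c where c: "c \<in> C" "dist (A u) c < \<epsilon>/4" using near[OF u(1)] by blast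
    obtain z where z: "z \<in> k" "dist z c < \<epsilon>/2" using k(2) c(1) by auto
    have "dist z x \<le> dist z c + (dist c (A u) + dist (A u) x)"
      using dist_triangle[of z x c] dist_triangle[of c x "A u"] by linarith
    also have "\<dots> < \<epsilon>" using u c z by (simp add: dist_commute)
    finally show "x \<in> (\<Union>x\<in>k. ball x \<epsilon>)" using z(1) by auto
  qed
qed

text \<open>The supremum \<open>M\<close> of the quadratic form over the unit sphere of
  \<open>V\<close> is attained at an eigenvector. For a maximising sequence the residuals
  \<open>A (u n) - M *\<^sub>R u n\<close> tend to 0; compactness makes \<open>A (u n)\<close>
  converge along a subsequence, and then \<open>u n\<close> converges too because
  \<open>M > 0\<close>. Restricting to an invariant \<open>V\<close> allows eigenvectors to be found
  orthogonal to given ones.\<close>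

lemma eigenvector_exists:
  assumes A: "positive_op A" and comp: "compact (closure (A ` cball 0 1))"
    and V: "closed V" "subspace V" "\<And>x. x \<in> V \<Longrightarrow> A x \<in> V"
    and x: "x \<in> V" "A x \<noteq> 0"
  obtains h \<mu> where "h \<in> V" "norm h = 1" "\<mu> > 0" "A h = \<mu> *\<^sub>R h"
proof -
  note b = positive_op_bounded[OF A]
  obtain K where K: "K > 0" "\<And>x. norm (A x) \<le> K * norm x" "\<And>x. (norm (A x))\<^sup>2 \<le> K * inner (A x) x"
    using positive_op_norm_bound[OF A] by blast
  define U where "U = {u\<in>V. norm u = 1}"
  define M where "M = (SUP u\<in>U. inner (A u) u)"
  have bdd: "bdd_above ((\<lambda>u. inner (A u) u) ` U)"
  proof (rule bdd_aboveI2)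
    fix u assume "u \<in> U"
    then show "inner (A u) u \<le> K"
      using norm_cauchy_schwarz[of "A u" u] K(2)[of u] by (simp add: U_def)
  qed
  have le_M: "inner (A y) y \<le> M * (norm y)\<^sup>2" if "y \<in> V" for y
  proof (cases "y = 0")
    case False
    define u where "u = (1 / norm y) *\<^sub>R y"
    have "u \<in> U" using that False V(2) by (simp add: U_def u_def subspace_scale)
    then have "inner (A u) u \<le> M" unfolding M_def by (rule cSUP_upper[OF _ bdd])
    then show ?thesis
      using False by (simp add: u_def bounded_op_scaleR[OF b] field_simps power2_eq_square)
  qed simp
  have "0 < (norm (A x))\<^sup>2" using x by simp
  also have "\<dots> \<le> K * inner (A x) x" by (rule K)
  also have "\<dots> \<le> K * (M * (norm x)\<^sup>2)" using K(1) le_M[OF x(1)] by simp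
  finally have "0 < M" using K(1) by (simp add: zero_less_mult_iff)
  have U_ne: "U \<noteq> {}"
  proof -
    have "x \<noteq> 0" using x bounded_op_zero[OF b] by auto
    then have "(1 / norm x) *\<^sub>R x \<in> U" using x V(2) by (simp add: U_def subspace_scale)
    then show ?thesis by blast
  qed
  have "\<exists>u\<in>U. M - inverse (real (Suc n)) < inner (A u) u" for n
    using less_cSUP_iff[OF U_ne bdd, of "M - inverse (real (Suc n))"] by (simp add: M_def[symmetric])
  then obtain u where u: "\<And>n. u n \<in> U" "\<And>n. M - inverse (real (Suc n)) < inner (A (u n)) (u n)"
    by metis
  have res: "(norm (A (u n) - M *\<^sub>R u n))\<^sup>2 \<le> M * inverse (real (Suc n))" for n
  proof -
    have uV: "u n \<in> V" "norm (u n) = 1" using u(1) by (auto simp: U_def)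
    \<comment> \<open>Invariance of \<open>V\<close> lets \<open>le_M\<close> be applied to
      \<open>A (u n)\<close>, so the constant here is \<open>M\<close> itself; a larger one would
      not force the residual to vanish.\<close>
    have "(norm (A (u n)))\<^sup>2 \<le> M * inner (A (u n)) (u n)"
      by (rule positive_op_norm_le[OF A \<open>0 < M\<close> le_M]) (intro V uV)
    moreover have "(norm (A (u n) - M *\<^sub>R u n))\<^sup>2 = (norm (A (u n)))\<^sup>2 - 2 * M * inner (A (u n)) (u n) + M\<^sup>2 * (norm (u n))\<^sup>2"
      by (simp add: power2_norm_eq_inner inner_diff_left inner_diff_right inner_commute power2_eq_square[of M] algebra_simps)
    ultimately have "(norm (A (u n) - M *\<^sub>R u n))\<^sup>2 \<le> M * (M - inner (A (u n)) (u n))"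
      using uV(2) by (simp add: power2_eq_square algebra_simps)
    also have "\<dots> \<le> M * inverse (real (Suc n))"
      using u(2)[of n] \<open>0 < M\<close> by (intro mult_left_mono) auto
    finally show ?thesis .
  qed
  have lim0: "(\<lambda>n. M * inverse (real (Suc n))) \<longlonglongrightarrow> 0"
    by (rule tendsto_mult_right_zero[OF LIMSEQ_inverse_real_of_nat])
  have "(\<lambda>n. (norm (A (u n) - M *\<^sub>R u n))\<^sup>2) \<longlonglongrightarrow> 0"
  proof (rule Lim_null_comparison[OF _ lim0], rule always_eventually, rule allI)
    show "norm ((norm (A (u n) - M *\<^sub>R u n))\<^sup>2) \<le> M * inverse (real (Suc n))" for n
      using res[of n] by (simp only: real_norm_def abs_of_nonneg zero_le_power2)
  qed
  then have "(\<lambda>n. sqrt ((norm (A (u n) - M *\<^sub>R u n))\<^sup>2)) \<longlonglongrightarrow> sqrt 0"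
    by (rule tendsto_real_sqrt)
  then have diff0: "(\<lambda>n. A (u n) - M *\<^sub>R u n) \<longlonglongrightarrow> 0"
    by (simp add: tendsto_norm_zero_iff)
  have "\<forall>n. A (u n) \<in> closure (A ` cball 0 1)"
    using u(1) closure_subset[of "A ` cball 0 1"] by (auto simp: U_def)
  then obtain y r where r: "strict_mono r" "((\<lambda>n. A (u n)) \<circ> r) \<longlonglongrightarrow> y"
    by (rule seq_compactE[OF compact_imp_seq_compact[OF comp]])
  have "(\<lambda>n. (1/M) *\<^sub>R (((\<lambda>n. A (u n)) \<circ> r) n - ((\<lambda>n. A (u n) - M *\<^sub>R u n) \<circ> r) n)) \<longlonglongrightarrow> (1/M) *\<^sub>R (y - 0)"
    by (intro tendsto_intros r(2) LIMSEQ_subseq_LIMSEQ[OF diff0 r(1)])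
  then have lim: "(\<lambda>n. u (r n)) \<longlonglongrightarrow> (1/M) *\<^sub>R y"
    using \<open>0 < M\<close> by simp
  define h where "h = (1/M) *\<^sub>R y"
  have "h \<in> V"
    using closed_sequentially[OF V(1) _ lim] u(1) by (auto simp: U_def h_def)
  moreover have "norm h = 1"
  proof -
    have "(\<lambda>n. norm (u (r n))) \<longlonglongrightarrow> norm h" unfolding h_def by (intro tendsto_norm lim)
    then show ?thesis using u(1) by (simp add: U_def LIMSEQ_const_iff)
  qed
  moreover have "A h = M *\<^sub>R h"
  proof -
    have "bounded_linear A" using b by (simp add: bounded_op_def)
    then have "(\<lambda>n. A (u (r n))) \<longlonglongrightarrow> A h"
      unfolding h_def by (rule bounded_linear.tendsto[OF _ lim])
    then have "A h = y" using r(2) LIMSEQ_unique by (auto simp: o_def)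
    then show ?thesis using \<open>0 < M\<close> by (simp add: h_def)
  qed
  ultimately show thesis using \<open>0 < M\<close> that by blast
qed

text \<open>Take a maximal orthonormal family \<open>H\<close> of eigenvectors with positive
  eigenvalues. Its orthogonal complement is closed and invariant, so by maximality it contains no
  further such eigenvector and \<open>A\<close> vanishes on it. Thus \<open>A x\<close> depends only
  on the projection of \<open>x\<close> to the closed span of \<open>H\<close>, where Parseval gives
  the expansion.\<close>

lemma spectral_decomposition:
  assumes A: "positive_op A" and comp: "compact (closure (A ` cball 0 1))"
  obtains H lam where "orthonormal H" "\<And>h. h \<in> H \<Longrightarrow> lam h > 0"
    "\<And>h. h \<in> H \<Longrightarrow> A h = lam h *\<^sub>R h"
    "\<And>x y. ((\<lambda>h. lam h * (cinner x h * cinner h y)) has_sum cinner (A x) y) H"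
proof -
  note b = positive_op_bounded[OF A]
  define X where "X = {x. norm x = 1 \<and> (\<exists>\<mu>>0. A x = \<mu> *\<^sub>R x)}"
  obtain H where H: "H \<subseteq> X" "orthonormal H"
    and max: "\<And>x. x \<in> X \<Longrightarrow> norm x = 1 \<Longrightarrow> (\<And>f. f \<in> H \<Longrightarrow> cinner x f = 0) \<Longrightarrow> False"
    using maximal_orthonormal_subset[of X] by blast
  have "\<forall>h\<in>H. \<exists>\<mu>>0. A h = \<mu> *\<^sub>R h" using H(1) by (auto simp: X_def)
  then obtain lam where lam: "\<And>h. h \<in> H \<Longrightarrow> lam h > 0" "\<And>h. h \<in> H \<Longrightarrow> A h = lam h *\<^sub>R h"
    by metis
  define V where "V = {x. \<forall>f\<in>H. cinner x f = 0}"
  have "closed V"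
    unfolding V_def Collect_ball_eq
    by (intro closed_INT ballI closed_Collect_eq continuous_intros)
  moreover have "subspace V"
    by (auto simp: subspace_def V_def cinner_algebra scaleR_eq_scaleC)
  moreover have inv: "A x \<in> V" if "x \<in> V" for x
    using that by (auto simp: V_def positive_op_selfadjoint[OF A] lam scaleR_eq_scaleC cinner_scaleC_right)
  ultimately have kernel: "A x = 0" if x: "x \<in> V" for x
  proof (rule_tac ccontr)
    assume "A x \<noteq> 0"
    then obtain h \<mu> where "h \<in> V" "norm h = 1" "\<mu> > 0" "A h = \<mu> *\<^sub>R h"
      using eigenvector_exists[OF A comp \<open>closed V\<close> \<open>subspace V\<close> inv x] by blast
    then show False using max[of h] by (auto simp: X_def V_def)
  qed
  have "((\<lambda>h. lam h * (cinner x h * cinner h y)) has_sum cinner (A x) y) H" for x y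
  proof -
    obtain p where p: "p \<in> closure (l2.span H)" "\<And>f. f \<in> H \<Longrightarrow> cinner (x - p) f = 0"
      using closure_span_projection by blast
    have "A (x - p) = 0" by (rule kernel) (use p in \<open>simp add: V_def\<close>)
    then have Ax: "A x = A p" by (simp add: bounded_op_diff[OF b])
    have "((\<lambda>h. cinner p h * cinner h (A y)) has_sum cinner p (A y)) H"
      by (rule has_sum_Parseval_cinner[OF H(2) p(1)])
    moreover have "cinner p h * cinner h (A y) = lam h * (cinner x h * cinner h y)" if "h \<in> H" for h
    proof -
      have "cinner p h = cinner x h" using p(2)[OF that] by (simp add: cinner_diff_left)
      moreover have "cinner h (A y) = lam h * cinner h y"
        using that by (simp add: positive_op_selfadjoint[OF A, symmetric] lam scaleR_eq_scaleC cinner_scaleC_left)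
      ultimately show ?thesis by simp
    qed
    ultimately have "((\<lambda>h. lam h * (cinner x h * cinner h y)) has_sum cinner p (A y)) H"
      by (simp cong: has_sum_cong)
    then show ?thesis by (simp add: Ax positive_op_selfadjoint[OF A])
  qed
  with H(2) lam show thesis by (rule that)
qed

text \<open>The nonnegative family \<open>lam h * (cmod (cinner e h))\<^sup>2\<close> is summed in
  both orders: over \<open>h\<close> first it gives the diagonal entries, over \<open>e\<close>
  first Parseval for the unit vector \<open>h\<close> leaves \<open>lam h\<close>. This frees the
  trace from the basis that defines it.\<close>

lemma trace_eq_sum_eigenvalues:
  assumes E: "onb E" and tr: "((\<lambda>e. inner (A e) e) has_sum t) E"
    and H: "orthonormal H" "\<And>h. h \<in> H \<Longrightarrow> lam h > (0::real)"
    and dec: "\<And>x y. ((\<lambda>h. lam h * (cinner x h * cinner h y)) has_sum cinner (A x) y) H"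
  shows "(lam has_sum t) H"
proof -
  have quad: "((\<lambda>h. lam h * (cmod (cinner x h))\<^sup>2) has_sum inner (A x) x) H" for x
    using has_sum_Re[OF dec[of x x]] by (simp add: cinner_mult_commute inner_l2_def)
  have 1: "(\<lambda>(e, h). lam h * (cmod (cinner e h))\<^sup>2) summable_on E \<times> H"
    by (rule summable_on_SigmaI[where g = "\<lambda>e. inner (A e) e"])
      (use quad tr H(2) in \<open>auto simp: summable_on_def less_imp_le\<close>)
  then have "((\<lambda>(e, h). lam h * (cmod (cinner e h))\<^sup>2) has_sum t) (E \<times> H)"
    by (rule has_sum_SigmaI[rotated 2, where g = "\<lambda>e. inner (A e) e"]) (use quad tr in auto)
  then have "((\<lambda>(h, e). lam h * (cmod (cinner e h))\<^sup>2) has_sum t) (H \<times> E)"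
    by (subst (asm) has_sum_swap) (simp add: case_prod_unfold)
  moreover have "((\<lambda>e. lam h * (cmod (cinner e h))\<^sup>2) has_sum lam h * 1) E" if "h \<in> H" for h
  proof (intro has_sum_cmult_right)
    have "((\<lambda>e. (cmod (cinner h e))\<^sup>2) has_sum (norm h)\<^sup>2) E"
      by (rule has_sum_Parseval) (use E in \<open>auto simp: onb_iff\<close>)
    then show "((\<lambda>e. (cmod (cinner e h))\<^sup>2) has_sum 1) E"
      using orthonormal_norm[OF H(1) that] by (simp add: cmod_cinner_commute)
  qed
  ultimately show ?thesis
    by (auto intro: has_sum_SigmaD[where g = "lam"])
qed

section \<open>Translations of Lebesgue measure\<close>

lemma lborel_affine_density:
  fixes t :: "'a::euclidean_space"
  assumes "c \<noteq> 0"
  shows "lborel = density (distr lborel borel (\<lambda>x. t + c *\<^sub>R x)) (\<lambda>_. ennreal (\<bar>c\<bar> ^ DIM('a)))"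
  using lborel_affine[OF assms, of t] by simp

lemma nn_integral_lborel_affine:
  fixes f :: "'a::euclidean_space \<Rightarrow> ennreal"
  assumes [measurable]: "f \<in> borel_measurable borel" and c: "c \<noteq> 0"
  shows "(\<integral>\<^sup>+x. f x \<partial>lborel) = ennreal (\<bar>c\<bar> ^ DIM('a)) * (\<integral>\<^sup>+x. f (t + c *\<^sub>R x) \<partial>lborel)"
  by (subst lborel_affine_density[OF c, of t])
    (simp add: nn_integral_density nn_integral_distr nn_integral_cmult)

lemma integrable_lborel_affine:
  fixes f :: "'a::euclidean_space \<Rightarrow> 'b::{banach, second_countable_topology}"
  assumes f: "integrable lborel f" and c: "c \<noteq> 0"
  shows "integrable lborel (\<lambda>x. f (t + c *\<^sub>R x))"
proof -
  have [measurable]: "f \<in> borel_measurable borel" using f by auto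
  show ?thesis
    using f c unfolding integrable_iff_bounded
    by (subst (asm) nn_integral_lborel_affine[where c=c and t=t]) (auto simp: ennreal_mult_less_top)
qed

lemma integral_lborel_affine:
  fixes f :: "'a::euclidean_space \<Rightarrow> 'b::{banach, second_countable_topology}"
  assumes [measurable]: "f \<in> borel_measurable borel" and c: "c \<noteq> 0"
  shows "(LINT x|lborel. f x) = (\<bar>c\<bar> ^ DIM('a)) *\<^sub>R (LINT x|lborel. f (t + c *\<^sub>R x))"
  by (subst lborel_affine_density[OF c, of t])
    (simp add: integral_density integral_distr)

lemma nn_integral_lborel_shift:
  fixes f :: "'a::euclidean_space \<Rightarrow> ennreal"
  assumes "f \<in> borel_measurable borel"
  shows "(\<integral>\<^sup>+x. f (x + t) \<partial>lborel) = (\<integral>\<^sup>+x. f x \<partial>lborel)"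
  using nn_integral_lborel_affine[OF assms, of 1 t] by (simp add: add.commute)

lemma nn_integral_lborel_reflect:
  fixes f :: "'a::euclidean_space \<Rightarrow> ennreal"
  assumes "f \<in> borel_measurable borel"
  shows "(\<integral>\<^sup>+x. f (t - x) \<partial>lborel) = (\<integral>\<^sup>+x. f x \<partial>lborel)"
  using nn_integral_lborel_affine[OF assms, of "-1" t] by simp

lemma integral_lborel_shift:
  fixes f :: "'a::euclidean_space \<Rightarrow> 'b::{banach, second_countable_topology}"
  assumes "f \<in> borel_measurable borel"
  shows "(LINT x|lborel. f (x + t)) = (LINT x|lborel. f x)"
  using integral_lborel_affine[OF assms, of 1 t] by (simp add: add.commute)

lemma integrable_lborel_shift:
  fixes f :: "'a::euclidean_space \<Rightarrow> 'b::{banach, second_countable_topology}"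
  assumes "integrable lborel f"
  shows "integrable lborel (\<lambda>x. f (x + t))"
  using integrable_lborel_affine[OF assms, of 1 t] by (simp add: add.commute)

text \<open>For open \<open>U\<close> dominated convergence controls the negative part of the difference; the positive
  part has the same integral.\<close>

lemma translation_continuity_open:
  fixes U :: "'a::euclidean_space set"
  assumes U: "open U" "emeasure lborel U < \<infinity>" and u: "u \<longlonglongrightarrow> 0"
  shows "(\<lambda>n. LINT t|lborel. \<bar>indicator U (t + u n) - indicator U t :: real\<bar>) \<longlonglongrightarrow> 0"
proof -
  let ?i = "indicator U :: 'a \<Rightarrow> real"
  have [measurable]: "U \<in> sets borel" using U by simp
  have int: "integrable lborel ?i" using U by (simp add: integrable_indicator_iff)
  note int' = integrable_lborel_shift[OF int]
  have split: "\<bar>a - b\<bar> = 2 * max 0 (b - a) + (a - b)" for a b :: real by (simp add: abs_if max_def)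
  have eq: "(LINT t|lborel. \<bar>?i (t + x) - ?i t\<bar>) = 2 * (LINT t|lborel. max 0 (?i t - ?i (t + x)))" for x
  proof -
    have "(LINT t|lborel. \<bar>?i (t + x) - ?i t\<bar>)
        = 2 * (LINT t|lborel. max 0 (?i t - ?i (t + x))) + ((LINT t|lborel. ?i (t + x)) - (LINT t|lborel. ?i t))"
      unfolding split using int int'[of x] by simp
    then show ?thesis by (simp only: integral_lborel_shift[of ?i x] borel_measurable_indicator
        \<open>U \<in> sets borel\<close> diff_self add_0_right)
  qed
  have "(\<lambda>n. LINT t|lborel. max 0 (?i t - ?i (t + u n))) \<longlonglongrightarrow> (LINT t|(lborel::'a measure). (0::real))"
  proof (rule integral_dominated_convergence[where w = ?i])
    show "AE t in lborel. (\<lambda>n. max 0 (?i t - ?i (t + u n))) \<longlonglongrightarrow> 0"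
    proof (rule AE_I2)
      fix t :: 'a
      show "(\<lambda>n. max 0 (?i t - ?i (t + u n))) \<longlonglongrightarrow> 0"
      proof (cases "t \<in> U")
        case True
        have "(\<lambda>n. t + u n) \<longlonglongrightarrow> t + 0" by (intro tendsto_intros u)
        then have "\<forall>\<^sub>F n in sequentially. t + u n \<in> U"
          using U(1) True by (auto dest: topological_tendstoD)
        then have "\<forall>\<^sub>F n in sequentially. max 0 (?i t - ?i (t + u n)) = 0"
          by eventually_elim (simp add: True)
        then show ?thesis by (rule tendsto_eventually)
      qed simp
    qed
    show "AE t in lborel. norm (max 0 (?i t - ?i (t + u n))) \<le> ?i t" for n
      by (rule AE_I2) (simp split: split_indicator)
  qed (use int in auto)
  then have "(\<lambda>n. 2 * (LINT t|lborel. max 0 (?i t - ?i (t + u n)))) \<longlonglongrightarrow> 2 * 0"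
    by (intro tendsto_mult tendsto_const) simp
  then show ?thesis by (simp add: eq)
qed

lemma translation_L1_approx:
  fixes f g :: "'a::euclidean_space \<Rightarrow> real"
  assumes f: "integrable lborel f" and g: "integrable lborel g"
  shows "(LINT t|lborel. \<bar>f (t + x) - f t\<bar>)
    \<le> 2 * (LINT t|lborel. \<bar>f t - g t\<bar>) + (LINT t|lborel. \<bar>g (t + x) - g t\<bar>)"
proof -
  note s = integrable_lborel_shift[OF f, of x] integrable_lborel_shift[OF g, of x]
  have d: "integrable lborel (\<lambda>t. \<bar>f t - g t\<bar>)" using f g by auto
  have d': "integrable lborel (\<lambda>t. \<bar>f (t + x) - g (t + x)\<bar>)"
    by (rule integrable_lborel_shift[OF d])
  have "(LINT t|lborel. \<bar>f (t + x) - f t\<bar>)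
    \<le> (LINT t|lborel. \<bar>f (t + x) - g (t + x)\<bar> + \<bar>f t - g t\<bar> + \<bar>g (t + x) - g t\<bar>)"
    by (intro integral_mono) (use f g s d d' in auto)
  also have "\<dots> = (LINT t|lborel. \<bar>f (t + x) - g (t + x)\<bar>) + (LINT t|lborel. \<bar>f t - g t\<bar>)
      + (LINT t|lborel. \<bar>g (t + x) - g t\<bar>)"
    using f g s d d' by simp
  also have "(LINT t|lborel. \<bar>f (t + x) - g (t + x)\<bar>) = (LINT t|lborel. \<bar>f t - g t\<bar>)"
    by (rule integral_lborel_shift) (use d in auto)
  finally show ?thesis by simp
qed

text \<open>Translations are isometries of the integrable functions, so continuity of translation is
  inherited by limits in mean.\<close>

lemma translation_continuity_approx:
  fixes f :: "'a::euclidean_space \<Rightarrow> real"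
  assumes f: "integrable lborel f"
    and approx: "\<And>\<epsilon>. \<epsilon> > 0 \<Longrightarrow> \<exists>g. integrable lborel g \<and> (LINT t|lborel. \<bar>f t - g t\<bar>) \<le> \<epsilon> \<and>
      (\<lambda>n. LINT t|lborel. \<bar>g (t + u n) - g t\<bar>) \<longlonglongrightarrow> 0"
  shows "(\<lambda>n. LINT t|lborel. \<bar>f (t + u n) - f t\<bar>) \<longlonglongrightarrow> 0"
  unfolding tendsto_iff
proof (intro allI impI)
  fix \<epsilon> :: real assume \<epsilon>: "\<epsilon> > 0"
  obtain g where g: "integrable lborel g" "(LINT t|lborel. \<bar>f t - g t\<bar>) \<le> \<epsilon>/4"
    and lim: "(\<lambda>n. LINT t|lborel. \<bar>g (t + u n) - g t\<bar>) \<longlonglongrightarrow> 0"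
    using approx[of "\<epsilon>/4"] \<epsilon> by auto
  have "\<forall>\<^sub>F n in sequentially. dist (LINT t|lborel. \<bar>g (t + u n) - g t\<bar>) 0 < \<epsilon>/2"
    using \<epsilon> by (intro tendstoD[OF lim]) simp
  then show "\<forall>\<^sub>F n in sequentially. dist (LINT t|lborel. \<bar>f (t + u n) - f t\<bar>) 0 < \<epsilon>"
  proof eventually_elim
    case (elim n)
    then show ?case
      using translation_L1_approx[OF f g(1), of "u n"] g(2) by (simp add: dist_real_def)
  qed
qed

text \<open>Outer regularity replaces \<open>E\<close> by an open superset of nearly the same
  measure, for which the claim is known.\<close>

lemma translation_continuity_indicator:
  fixes E :: "'a::euclidean_space set"
  assumes E: "E \<in> sets borel" "emeasure lborel E < \<infinity>" and u: "u \<longlonglongrightarrow> 0"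
  shows "(\<lambda>n. LINT t|lborel. \<bar>indicator E (t + u n) - indicator E t :: real\<bar>) \<longlonglongrightarrow> 0"
proof (rule translation_continuity_approx)
  show "integrable lborel (indicator E :: 'a \<Rightarrow> real)"
    using E by (simp add: integrable_indicator_iff)
  fix \<epsilon> :: real assume \<epsilon>: "\<epsilon> > 0"
  obtain U where U: "open U" "E \<subseteq> U" "emeasure lborel (U - E) < \<epsilon>"
    using outer_regular_lborel[OF E(1) \<epsilon>] .
  have "emeasure lborel U = emeasure lborel E + emeasure lborel (U - E)"
    using U E by (subst plus_emeasure) (auto simp: Un_absorb1)
  also have "\<dots> < \<infinity>" using U E by (auto simp: ennreal_add_less_top less_top[symmetric] dest: less_trans)
  finally have fin: "emeasure lborel U < \<infinity>" .
  have "(LINT t|lborel. \<bar>indicator E t - indicator U t :: real\<bar>) = (LINT t|lborel. indicator (U - E) t)"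
    using U by (intro Bochner_Integration.integral_cong) (auto split: split_indicator)
  also have "\<dots> = measure lborel (U - E)" by simp
  also have "\<dots> \<le> \<epsilon>"
    using U(3) \<epsilon> unfolding measure_def by (intro enn2real_leI) auto
  finally show "\<exists>g. integrable lborel g \<and> (LINT t|lborel. \<bar>indicator E t - g t\<bar>) \<le> \<epsilon> \<and>
      (\<lambda>n. LINT t|lborel. \<bar>g (t + u n) - g t :: real\<bar>) \<longlonglongrightarrow> 0"
    using U fin translation_continuity_open[OF U(1) fin u]
    by (intro exI[of _ "indicator U"]) (simp add: integrable_indicator_iff)
qed

lemma translation_continuity_L1:
  fixes f :: "'a::euclidean_space \<Rightarrow> real"
  assumes "integrable lborel f" and u: "u \<longlonglongrightarrow> 0"
  shows "(\<lambda>n. LINT t|lborel. \<bar>f (t + u n) - f t\<bar>) \<longlonglongrightarrow> 0"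
  using assms(1)
proof (induct rule: integrable_induct)
  case (base A c)
  then have "(\<lambda>n. (LINT t|lborel. \<bar>indicator A (t + u n) - indicator A t :: real\<bar>) * \<bar>c\<bar>) \<longlonglongrightarrow> 0 * \<bar>c\<bar>"
    by (intro tendsto_mult tendsto_const translation_continuity_indicator u) auto
  then show ?case
    by (simp add: left_diff_distrib[symmetric] abs_mult)
next
  case (add f g)
  show ?case
  proof (rule Lim_null_comparison)
    show "(\<lambda>n. (LINT t|lborel. \<bar>f (t + u n) - f t\<bar>) + (LINT t|lborel. \<bar>g (t + u n) - g t\<bar>)) \<longlonglongrightarrow> 0"
      using tendsto_add[OF add(2,4)] by simp
    show "\<forall>\<^sub>F n in sequentially. norm (LINT t|lborel. \<bar>f (t + u n) + g (t + u n) - (f t + g t)\<bar>)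
      \<le> (LINT t|lborel. \<bar>f (t + u n) - f t\<bar>) + (LINT t|lborel. \<bar>g (t + u n) - g t\<bar>)"
    proof (rule always_eventually, rule allI)
      fix n
      note s = integrable_lborel_shift[OF add(1), of "u n"] integrable_lborel_shift[OF add(3), of "u n"]
      have "(LINT t|lborel. \<bar>f (t + u n) + g (t + u n) - (f t + g t)\<bar>)
        \<le> (LINT t|lborel. \<bar>f (t + u n) - f t\<bar> + \<bar>g (t + u n) - g t\<bar>)"
        using add(1,3) s by (intro integral_mono) auto
      then show "norm (LINT t|lborel. \<bar>f (t + u n) + g (t + u n) - (f t + g t)\<bar>)
        \<le> (LINT t|lborel. \<bar>f (t + u n) - f t\<bar>) + (LINT t|lborel. \<bar>g (t + u n) - g t\<bar>)"
        using add(1,3) s by simp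
    qed
  qed
next
  case (lim f s)
  show ?case
  proof (rule translation_continuity_approx[OF lim(5)])
    fix \<epsilon> :: real assume \<epsilon>: "\<epsilon> > 0"
    have "(\<lambda>i. LINT t|lborel. \<bar>f t - s i t\<bar>) \<longlonglongrightarrow> (LINT t|(lborel::'a measure). (0::real))"
    \<comment> \<open>The approximants in the induction are bounded by twice the modulus of
      \<open>f\<close>; the triangle inequality adds one more copy.\<close>
    proof (rule integral_dominated_convergence[where w = "\<lambda>t. 3 * \<bar>f t\<bar>"])
      show "AE t in lborel. (\<lambda>i. \<bar>f t - s i t\<bar>) \<longlonglongrightarrow> 0"
      proof (rule AE_I2)
        fix t :: 'a
        have "(\<lambda>i. \<bar>f t - s i t\<bar>) \<longlonglongrightarrow> \<bar>f t - f t\<bar>"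
          by (intro tendsto_intros lim(3)) simp
        then show "(\<lambda>i. \<bar>f t - s i t\<bar>) \<longlonglongrightarrow> 0" by simp
      qed
      show "AE t in lborel. norm \<bar>f t - s i t\<bar> \<le> 3 * \<bar>f t\<bar>" for i
      proof (rule AE_I2)
        fix t :: 'a
        show "norm \<bar>f t - s i t\<bar> \<le> 3 * \<bar>f t\<bar>"
          using lim(4)[of t i] by simp
      qed
    qed (use lim(1,5) in auto)
    then have "\<forall>\<^sub>F i in sequentially. dist (LINT t|lborel. \<bar>f t - s i t\<bar>) 0 < \<epsilon>"
      using \<epsilon> by (intro tendstoD) auto
    then obtain i where "(LINT t|lborel. \<bar>f t - s i t\<bar>) < \<epsilon>"
      by (auto simp: eventually_sequentially dist_real_def)
    then show "\<exists>g. integrable lborel g \<and> (LINT t|lborel. \<bar>f t - g t\<bar>) \<le> \<epsilon> \<and>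
      (\<lambda>n. LINT t|lborel. \<bar>g (t + u n) - g t\<bar>) \<longlonglongrightarrow> 0"
      using lim(1,2) by (intro exI[of _ "s i"]) auto
  qed
qed

text \<open>For \<open>a, b \<ge> 0\<close> one has \<open>(a - b)\<^sup>2 \<le> |a\<^sup>2 - b\<^sup>2|\<close>; applied to the positive and negative
  parts of the real and imaginary parts, this reduces the \<open>L\<^sup>2\<close> case to the \<open>L\<^sup>1\<close> case.\<close>

lemma translation_continuity_L2:
  fixes f :: "'a::euclidean_space \<Rightarrow> complex"
  assumes f: "square_integrable f" and u: "u \<longlonglongrightarrow> 0"
  shows "(\<lambda>n. LINT t|lborel. (cmod (f (t + u n) - f t))\<^sup>2) \<longlonglongrightarrow> 0"
proof -
  have [measurable]: "f \<in> borel_measurable borel" and int: "integrable lborel (\<lambda>t. (cmod (f t))\<^sup>2)"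
    using f by (auto simp: square_integrable_def)
  define p where "p = [\<lambda>t. (max 0 (Re (f t)))\<^sup>2, \<lambda>t. (max 0 (- Re (f t)))\<^sup>2,
    \<lambda>t. (max 0 (Im (f t)))\<^sup>2, \<lambda>t. (max 0 (- Im (f t)))\<^sup>2]"
  have p_le: "(max 0 (Re z))\<^sup>2 \<le> (cmod z)\<^sup>2" "(max 0 (- Re z))\<^sup>2 \<le> (cmod z)\<^sup>2"
    "(max 0 (Im z))\<^sup>2 \<le> (cmod z)\<^sup>2" "(max 0 (- Im z))\<^sup>2 \<le> (cmod z)\<^sup>2" for z
    by (intro power_mono; use abs_Re_le_cmod[of z] abs_Im_le_cmod[of z] in auto)+
  have pint: "integrable lborel q" if "q \<in> set p" for q
    using that unfolding p_def
    by (auto intro!: Bochner_Integration.integrable_bound[OF int] AE_I2 simp: p_le)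
  have sq: "(a - b)\<^sup>2 \<le> \<bar>a\<^sup>2 - b\<^sup>2\<bar>" if "a \<ge> 0" "b \<ge> 0" for a b :: real
  proof -
    have "(a - b)\<^sup>2 = \<bar>a - b\<bar> * \<bar>a - b\<bar>" by (simp add: power2_eq_square)
    also have "\<dots> \<le> \<bar>a - b\<bar> * \<bar>a + b\<bar>" using that by (intro mult_left_mono) auto
    also have "\<dots> = \<bar>a\<^sup>2 - b\<^sup>2\<bar>" by (simp add: abs_mult[symmetric] power2_eq_square algebra_simps)
    finally show ?thesis .
  qed
  have diff_sq: "(a - b)\<^sup>2 \<le> 2 * a\<^sup>2 + 2 * b\<^sup>2" for a b :: real
    using zero_le_power2[of "a + b"] by (simp add: power2_sum power2_diff)
  have sq_r: "(a - b)\<^sup>2 \<le> 2 * \<bar>(max 0 a)\<^sup>2 - (max 0 b)\<^sup>2\<bar> + 2 * \<bar>(max 0 (- a))\<^sup>2 - (max 0 (- b))\<^sup>2\<bar>" for a b :: real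
  proof -
    have "(a - b)\<^sup>2 = ((max 0 a - max 0 b) - (max 0 (- a) - max 0 (- b)))\<^sup>2"
      by (rule arg_cong[where f = "\<lambda>x. x\<^sup>2"]) simp
    also have "\<dots> \<le> 2 * (max 0 a - max 0 b)\<^sup>2 + 2 * (max 0 (- a) - max 0 (- b))\<^sup>2"
      by (rule diff_sq)
    also have "\<dots> \<le> 2 * \<bar>(max 0 a)\<^sup>2 - (max 0 b)\<^sup>2\<bar> + 2 * \<bar>(max 0 (- a))\<^sup>2 - (max 0 (- b))\<^sup>2\<bar>"
      using sq[of "max 0 a" "max 0 b"] sq[of "max 0 (- a)" "max 0 (- b)"] by simp
    finally show ?thesis .
  qed
  have bound: "(cmod (f (t + x) - f t))\<^sup>2 \<le> 2 * (\<Sum>q\<leftarrow>p. \<bar>q (t + x) - q t\<bar>)" for t x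
    using sq_r[of "Re (f (t + x))" "Re (f t)"] sq_r[of "Im (f (t + x))" "Im (f t)"]
    by (simp add: p_def cmod_power2)
  show ?thesis
  proof (rule Lim_null_comparison)
    have "(\<lambda>n. 2 * (\<Sum>q\<leftarrow>p. LINT t|lborel. \<bar>q (t + u n) - q t\<bar>)) \<longlonglongrightarrow> 2 * (\<Sum>q\<leftarrow>p. 0)"
      unfolding p_def list.map sum_list.Cons sum_list.Nil
      by (intro tendsto_intros translation_continuity_L1 u pint) (simp_all add: p_def)
    then show "(\<lambda>n. 2 * (\<Sum>q\<leftarrow>p. LINT t|lborel. \<bar>q (t + u n) - q t\<bar>)) \<longlonglongrightarrow> 0"
      by (simp add: p_def)
    show "\<forall>\<^sub>F n in sequentially. norm (LINT t|lborel. (cmod (f (t + u n) - f t))\<^sup>2)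
        \<le> 2 * (\<Sum>q\<leftarrow>p. LINT t|lborel. \<bar>q (t + u n) - q t\<bar>)"
    proof (rule always_eventually, rule allI)
      fix n
      have i: "integrable lborel (\<lambda>t. \<bar>q (t + u n) - q t\<bar>)" if "q \<in> set p" for q
        using pint[OF that] integrable_lborel_shift[OF pint[OF that], of "u n"] by auto
      have isum: "integrable lborel (\<lambda>t. \<Sum>q\<leftarrow>qs. \<bar>q (t + u n) - q t\<bar>) \<and>
          (LINT t|lborel. (\<Sum>q\<leftarrow>qs. \<bar>q (t + u n) - q t\<bar>)) = (\<Sum>q\<leftarrow>qs. LINT t|lborel. \<bar>q (t + u n) - q t\<bar>)"
        if "set qs \<subseteq> set p" for qs
        using that by (induction qs) (auto simp: i)
      have "norm (LINT t|lborel. (cmod (f (t + u n) - f t))\<^sup>2) = (LINT t|lborel. (cmod (f (t + u n) - f t))\<^sup>2)"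
        by simp
      also have "\<dots> \<le> (LINT t|lborel. 2 * (\<Sum>q\<leftarrow>p. \<bar>q (t + u n) - q t\<bar>))"
      proof (rule integral_mono'[OF _ bound])
        show "integrable lborel (\<lambda>t. 2 * (\<Sum>q\<leftarrow>p. \<bar>q (t + u n) - q t\<bar>))"
          using isum[of p] by simp
      qed (simp add: sum_list_nonneg p_def)
      also have "\<dots> = 2 * (\<Sum>q\<leftarrow>p. LINT t|lborel. \<bar>q (t + u n) - q t\<bar>)"
        using isum[of p] by simp
      finally show "norm (LINT t|lborel. (cmod (f (t + u n) - f t))\<^sup>2)
        \<le> 2 * (\<Sum>q\<leftarrow>p. LINT t|lborel. \<bar>q (t + u n) - q t\<bar>)" .
    qed
  qed
qed

section \<open>The Plancherel identity\<close>

text \<open>As a product of one-dimensional normal densities, its mass and Fourier transform reduce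
  to the known characteristic function of the standard normal law.\<close>

definition gaussian :: "'a::euclidean_space \<Rightarrow> real" where
  "gaussian x = (\<Prod>b\<in>Basis. std_normal_density (x \<bullet> b))"

lemma gaussian_eq: "gaussian (x :: 'a::euclidean_space) = (1 / sqrt (2 * pi)) ^ DIM('a) * exp (- (norm x)\<^sup>2 / 2)"
proof -
  have "(norm x)\<^sup>2 = (\<Sum>b\<in>Basis. (x \<bullet> b)\<^sup>2)"
    unfolding power2_norm_eq_inner by (subst euclidean_inner) (simp add: power2_eq_square)
  then have "exp (- (norm x)\<^sup>2 / 2) = (\<Prod>b\<in>Basis. exp (- (x \<bullet> b)\<^sup>2 / 2))"
    by (simp add: exp_sum[symmetric] sum_negf sum_divide_distrib)
  then show ?thesis
    unfolding gaussian_def std_normal_density_def prod.distrib prod_constant by simp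
qed

lemma gaussian_nonneg: "gaussian x \<ge> 0"
  by (simp add: gaussian_def prod_nonneg)

lemma gaussian_measurable [measurable]: "gaussian \<in> borel_measurable borel"
  unfolding gaussian_def by measurable

text \<open>Lebesgue measure is the image of the product measure over the coordinates, where
  integrals of products factor.\<close>

lemma integral_lborel_prod_Basis:
  fixes f :: "'a::euclidean_space \<Rightarrow> real \<Rightarrow> complex"
  assumes f: "\<And>b. b \<in> Basis \<Longrightarrow> integrable lborel (f b)"
  shows "integrable lborel (\<lambda>x. \<Prod>b\<in>Basis. f b (x \<bullet> b))"
    and "(LINT x|lborel. (\<Prod>b\<in>Basis. f b (x \<bullet> b))) = (\<Prod>b\<in>Basis. LINT t|lborel. f b t)"
proof -
  interpret product_sigma_finite "\<lambda>_::'a. lborel :: real measure" ..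
  have [measurable]: "f b \<in> borel_measurable borel" if "b \<in> Basis" for b
    using f[OF that] by auto
  have m: "(\<lambda>x::'a. \<Prod>b\<in>Basis. f b (x \<bullet> b)) \<in> borel_measurable borel"
    by measurable
  have T: "(\<lambda>x. \<Sum>b\<in>Basis. x b *\<^sub>R b) \<in> (\<Pi>\<^sub>M b\<in>Basis. lborel) \<rightarrow>\<^sub>M (borel :: 'a measure)"
    by measurable
  have eq: "(\<Prod>b\<in>Basis. f b ((\<Sum>b\<in>Basis. x b *\<^sub>R b) \<bullet> b)) = (\<Prod>b\<in>Basis. f b (x b))" for x :: "'a \<Rightarrow> real"
    by simp
  have i: "integrable (\<Pi>\<^sub>M b\<in>Basis. lborel) (\<lambda>x. \<Prod>b\<in>Basis. f b (x b))"
    by (rule product_integrable_prod) (auto intro: f)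
  show "integrable lborel (\<lambda>x. \<Prod>b\<in>Basis. f b (x \<bullet> b))"
    unfolding lborel_eq[where 'a = 'a] integrable_distr_eq[OF T m] eq by (rule i)
  show "(LINT x|lborel. (\<Prod>b\<in>Basis. f b (x \<bullet> b))) = (\<Prod>b\<in>Basis. LINT t|lborel. f b t)"
    unfolding lborel_eq[where 'a = 'a] integral_distr[OF T m] eq
    by (rule product_integral_prod) (auto intro: f)
qed

lemma gaussian_fourier:
  fixes t :: "'a::euclidean_space"
  shows "integrable lborel (\<lambda>x. complex_of_real (gaussian x) * exp (\<i> * complex_of_real (x \<bullet> t)))" (is ?I)
    and "(LINT x|lborel. complex_of_real (gaussian x) * exp (\<i> * complex_of_real (x \<bullet> t)))
      = complex_of_real (exp (- (norm t)\<^sup>2 / 2))" (is ?E)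
proof -
  define f where "f b s = complex_of_real (std_normal_density s) * iexp ((t \<bullet> b) * s)" for b s
  have one: "integrable lborel (f b)" "(LINT s|lborel. f b s) = complex_of_real (exp (- (t \<bullet> b)\<^sup>2 / 2))" for b
  proof -
    have "integrable std_normal_distribution (\<lambda>s. iexp ((t \<bullet> b) * s))"
      by (rule prob_space.integrable_iexp[OF prob_space_normal_density]) auto
    then show "integrable lborel (f b)"
      unfolding f_def by (subst (asm) integrable_density) (auto simp: scaleR_conv_of_real)
    have "char std_normal_distribution (t \<bullet> b) = (LINT s|lborel. f b s)"
      unfolding char_def f_def by (subst integral_density) (auto simp: scaleR_conv_of_real)
    then show "(LINT s|lborel. f b s) = complex_of_real (exp (- (t \<bullet> b)\<^sup>2 / 2))"
      by (simp add: char_std_normal_distribution)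
  qed
  have eq: "(\<Prod>b\<in>Basis. f b (x \<bullet> b)) = complex_of_real (gaussian x) * exp (\<i> * complex_of_real (x \<bullet> t))" for x
  proof -
    have "exp (\<i> * complex_of_real (x \<bullet> t)) = (\<Prod>b\<in>Basis. iexp ((t \<bullet> b) * (x \<bullet> b)))"
      by (simp add: euclidean_inner[of x t] exp_sum[symmetric] sum_distrib_left mult_ac)
    then show ?thesis by (simp add: f_def gaussian_def prod.distrib)
  qed
  show ?I using integral_lborel_prod_Basis(1)[of f] one by (simp add: eq)
  have "(LINT x|lborel. complex_of_real (gaussian x) * exp (\<i> * complex_of_real (x \<bullet> t)))
    = (\<Prod>b\<in>Basis. complex_of_real (exp (- (t \<bullet> b)\<^sup>2 / 2)))"
    using integral_lborel_prod_Basis(2)[of f] one by (simp add: eq)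
  also have "\<dots> = complex_of_real (exp (\<Sum>b\<in>Basis. - (t \<bullet> b)\<^sup>2 / 2))"
    by (simp add: exp_sum)
  also have "(\<Sum>b\<in>Basis. - (t \<bullet> b)\<^sup>2 / 2) = - (norm t)\<^sup>2 / 2"
    unfolding power2_norm_eq_inner by (subst euclidean_inner) (simp add: power2_eq_square sum_negf sum_divide_distrib)
  finally show ?E .
qed

lemma gaussian_integral:
  "integrable lborel (gaussian :: 'a::euclidean_space \<Rightarrow> real)"
  "(LINT x::'a|lborel. gaussian x) = 1"
proof -
  have 1: "integrable lborel (\<lambda>x::'a. complex_of_real (gaussian x))"
    using gaussian_fourier(1)[of "0::'a"] by simp
  then show "integrable lborel (gaussian :: 'a \<Rightarrow> real)"
    by (simp add: complex_of_real_integrable_eq)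
  have "complex_of_real (LINT x::'a|lborel. gaussian x) = 1"
    using gaussian_fourier(2)[of "0::'a"] by simp
  then show "(LINT x::'a|lborel. gaussian x) = 1" by simp
qed

section \<open>Fourier transform and autocorrelation\<close>

lemma integrable_prod_lborel:
  fixes f :: "'a::euclidean_space \<Rightarrow> complex" and g :: "'a \<Rightarrow> complex"
  assumes f: "integrable lborel f" and g: "integrable lborel g"
  shows "integrable (lborel \<Otimes>\<^sub>M lborel) (\<lambda>(x, y). f x * g y)"
proof -
  have [measurable]: "f \<in> borel_measurable borel" "g \<in> borel_measurable borel" using f g by auto
  have m: "(\<lambda>(x, y). f x * g y) \<in> borel_measurable (lborel \<Otimes>\<^sub>M lborel)" by measurable
  show ?thesis
    using f g by (intro lborel_pair.Fubini_integrable[OF m]) (simp_all add: norm_mult)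
qed

text \<open>With the factor \<open>2 * pi\<close> in the exponent, Plancherel holds with constant 1
  and the transform matches the modulation in \<open>tf_shift\<close>.\<close>

definition fourier :: "('a::euclidean_space \<Rightarrow> complex) \<Rightarrow> 'a \<Rightarrow> complex" where
  "fourier h \<omega> = (LINT t|lborel. h t * exp (- (\<i> * complex_of_real (2 * pi * (\<omega> \<bullet> t)))))"

lemma fourier_measurable [measurable]:
  assumes [measurable]: "h \<in> borel_measurable borel"
  shows "fourier h \<in> borel_measurable borel"
proof -
  have "(\<lambda>\<omega>. LINT t|lborel. h t * exp (- (\<i> * complex_of_real (2 * pi * (\<omega> \<bullet> t))))) \<in> borel_measurable lborel"
    by measurable
  then show ?thesis by (simp add: fourier_def[abs_def])
qed

text \<open>The convolution of \<open>h\<close> with its conjugate reflection. Its value at 0 is the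
  squared norm of \<open>h\<close> and its Fourier transform is the squared modulus of that of
  \<open>h\<close>; Plancherel compares these two facts.\<close>

definition autocorr :: "('a::euclidean_space \<Rightarrow> complex) \<Rightarrow> 'a \<Rightarrow> complex" where
  "autocorr h u = (LINT t|lborel. h (t + u) * cnj (h t))"

lemma integrable_autocorr_pair:
  assumes h: "integrable lborel h"
  shows "integrable (lborel \<Otimes>\<^sub>M lborel) (\<lambda>(u, t). h (t + u) * cnj (h t))"
proof -
  have [measurable]: "h \<in> borel_measurable borel" using h by auto
  have "integrable (lborel \<Otimes>\<^sub>M lborel) (\<lambda>(t, u). h (t + u) * cnj (h t))"
  proof (rule lborel_pair.Fubini_integrable)
    show "(\<lambda>(t, u). h (t + u) * cnj (h t)) \<in> borel_measurable (lborel \<Otimes>\<^sub>M lborel)"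
      by measurable
    have "(LINT u|lborel. norm (case (t, u) of (t, u) \<Rightarrow> h (t + u) * cnj (h t)))
      = (LINT u|lborel. norm (h u)) * norm (h t)" for t
      using integral_lborel_shift[of "\<lambda>u. norm (h u)" t] by (simp add: norm_mult add.commute)
    then show "integrable lborel (\<lambda>t. LINT u|lborel. norm (case (t, u) of (t, u) \<Rightarrow> h (t + u) * cnj (h t)))"
      using h by simp
    show "AE t in lborel. integrable lborel (\<lambda>u. case (t, u) of (t, u) \<Rightarrow> h (t + u) * cnj (h t))"
      using integrable_lborel_shift[OF h] by (simp add: add.commute)
  qed
  from lborel_pair.integrable_product_swap[OF this] show ?thesis by simp
qed

lemma integrable_autocorr:
  assumes "integrable lborel h"
  shows "integrable lborel (autocorr h)"
  unfolding autocorr_def[abs_def]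
  by (rule lborel_pair.integrable_fst[OF integrable_autocorr_pair[OF assms]])

text \<open>After Fubini, the character at \<open>u\<close> is written as the character at
  \<open>u + t\<close> times the conjugate of the one at \<open>t\<close>. The substitution by
  translation then separates the two factors.\<close>

lemma fourier_autocorr:
  fixes h :: "'a::euclidean_space \<Rightarrow> complex"
  assumes h: "integrable lborel h"
  shows "fourier (autocorr h) \<omega> = complex_of_real ((cmod (fourier h \<omega>))\<^sup>2)"
proof -
  let ?e = "\<lambda>t. exp (- (\<i> * complex_of_real (2 * pi * (\<omega> \<bullet> t))))"
  have [measurable]: "h \<in> borel_measurable borel" using h by auto
  have e_add: "?e (t + u) = ?e t * ?e u" for t u
    by (simp add: inner_add_right exp_add[symmetric] algebra_simps)
  have e_inv: "?e t * cnj (?e t) = 1" for t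
    by (simp only: complex_norm_square[symmetric]) simp
  let ?F = "\<lambda>u t. h (t + u) * cnj (h t) * ?e u"
  have i: "integrable (lborel \<Otimes>\<^sub>M lborel) (\<lambda>(u, t). ?F u t)"
  proof (rule Bochner_Integration.integrable_bound[OF integrable_autocorr_pair[OF h]])
    show "(\<lambda>(u, t). ?F u t) \<in> borel_measurable (lborel \<Otimes>\<^sub>M lborel)" by measurable
  qed (simp add: norm_mult case_prod_unfold)
  have "fourier (autocorr h) \<omega> = (LINT u|lborel. LINT t|lborel. ?F u t)"
    unfolding fourier_def autocorr_def by simp
  also have "\<dots> = (LINT t|lborel. LINT u|lborel. ?F u t)"
    unfolding lborel_pair.integral_fst[OF i] lborel_pair.integral_snd[OF i] ..
  also have "\<dots> = (LINT t|lborel. cnj (h t * ?e t) * fourier h \<omega>)"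
  proof (rule Bochner_Integration.integral_cong)
    fix t
    have "?F u t = cnj (h t * ?e t) * (h (u + t) * ?e (u + t))" for u
      using e_inv[of t] e_add[of u t] by (simp add: add.commute mult_ac)
    then have "(LINT u|lborel. ?F u t) = (LINT u|lborel. cnj (h t * ?e t) * (h (u + t) * ?e (u + t)))"
      by (simp only:)
    also have "\<dots> = cnj (h t * ?e t) * (LINT u|lborel. h (u + t) * ?e (u + t))"
      by (rule integral_mult_right_zero)
    also have "(LINT u|lborel. h (u + t) * ?e (u + t)) = fourier h \<omega>"
      unfolding fourier_def by (rule integral_lborel_shift) measurable
    finally show "(LINT u|lborel. ?F u t) = cnj (h t * ?e t) * fourier h \<omega>" .
  qed simp
  also have "\<dots> = (LINT t|lborel. cnj (h t * ?e t)) * fourier h \<omega>"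
    by simp
  also have "(LINT t|lborel. cnj (h t * ?e t)) = cnj (fourier h \<omega>)"
    unfolding fourier_def by (rule Bochner_Integration.integral_cnj)
  also have "cnj (fourier h \<omega>) * fourier h \<omega> = complex_of_real ((cmod (fourier h \<omega>))\<^sup>2)"
    unfolding complex_norm_square by (rule mult.commute)
  finally show ?thesis .
qed

text \<open>This is \<open>\<integral> w \<cdot> fourier k = \<integral> fourier w \<cdot> k\<close> for a Gaussian \<open>w\<close>, rescaled.\<close>

lemma fourier_gaussian_multiplier:
  fixes k :: "'a::euclidean_space \<Rightarrow> complex"
  assumes k: "integrable lborel k" and b: "b > 0"
  shows "(LINT \<omega>|lborel. complex_of_real (exp (- (norm ((2 * pi * b) *\<^sub>R \<omega>))\<^sup>2 / 2)) * fourier k \<omega>)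
    = (LINT v|lborel. complex_of_real (gaussian v) * k (b *\<^sub>R v))" (is "?L = ?R")
proof -
  let ?c = "(1 / sqrt (2 * pi)) ^ DIM('a)"
  have c: "?c > 0" by simp
  have [measurable]: "k \<in> borel_measurable borel" using k by auto
  define G where "G \<omega> = complex_of_real (gaussian ((2 * pi * b) *\<^sub>R \<omega>))" for \<omega> :: 'a
  have G: "integrable lborel G" "G \<in> borel_measurable borel"
    using integrable_lborel_affine[OF gaussian_integral(1), of "2 * pi * b" 0] b
    by (auto simp: G_def[abs_def] complex_of_real_integrable_eq)
  note [measurable] = G(2)
  have w: "complex_of_real (exp (- (norm ((2 * pi * b) *\<^sub>R \<omega>))\<^sup>2 / 2)) = G \<omega> / ?c" for \<omega> :: 'a
    unfolding G_def gaussian_eq using c by simp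
  let ?e = "\<lambda>\<omega> t. exp (- (\<i> * complex_of_real (2 * pi * (\<omega> \<bullet> t))))"
  have i: "integrable (lborel \<Otimes>\<^sub>M lborel) (\<lambda>(\<omega>, t). G \<omega> * (k t * ?e \<omega> t))"
  proof (rule Bochner_Integration.integrable_bound[OF integrable_prod_lborel[OF G(1) k]])
    show "(\<lambda>(\<omega>, t). G \<omega> * (k t * ?e \<omega> t)) \<in> borel_measurable (lborel \<Otimes>\<^sub>M lborel)" by measurable
  qed (simp add: norm_mult case_prod_unfold)
  have inner: "(LINT \<omega>|lborel. G \<omega> * ?e \<omega> t) = complex_of_real (exp (- (norm ((1/b) *\<^sub>R t))\<^sup>2 / 2)) / (2 * pi * b) ^ DIM('a)"
    for t :: 'a
  proof -
    let ?f = "\<lambda>y. complex_of_real (gaussian y) * exp (\<i> * complex_of_real (y \<bullet> (- (1/b) *\<^sub>R t)))"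
    have "(LINT y|lborel. ?f y) = \<bar>2 * pi * b\<bar> ^ DIM('a) *\<^sub>R (LINT \<omega>|lborel. ?f (0 + (2 * pi * b) *\<^sub>R \<omega>))"
      by (rule integral_lborel_affine) (use b in auto)
    also have "(LINT \<omega>|lborel. ?f (0 + (2 * pi * b) *\<^sub>R \<omega>)) = (LINT \<omega>|lborel. G \<omega> * ?e \<omega> t)"
      using b by (intro Bochner_Integration.integral_cong) (auto simp: G_def mult_ac)
    finally have "complex_of_real (exp (- (norm (- (1/b) *\<^sub>R t))\<^sup>2 / 2))
      = (2 * pi * b) ^ DIM('a) * (LINT \<omega>|lborel. G \<omega> * ?e \<omega> t)"
      unfolding gaussian_fourier(2) using b by (simp add: scaleR_conv_of_real)
    then show ?thesis using b by (simp add: field_simps)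
  qed
  \<comment> \<open>One factor \<open>?c\<close> comes from expressing the weight through
    \<open>gaussian\<close>, the other from expressing its transform through
    \<open>gaussian\<close>; the power of \<open>2 * pi\<close> is the Jacobian of the
    rescaling.\<close>
  have c2: "?c * ?c * (2 * pi) ^ DIM('a) = 1"
  proof -
    have "1 / sqrt (2 * pi) * (1 / sqrt (2 * pi)) * (2 * pi) = 1"
      by (simp add: field_simps)
    then show ?thesis by (simp only: power_mult_distrib[symmetric] power_one)
  qed
  have "?L = (LINT \<omega>|lborel. LINT t|lborel. G \<omega> * (k t * ?e \<omega> t)) / ?c"
    unfolding w fourier_def by simp
  also have "\<dots> = (LINT t|lborel. LINT \<omega>|lborel. G \<omega> * (k t * ?e \<omega> t)) / ?c"
    unfolding lborel_pair.integral_fst[OF i] lborel_pair.integral_snd[OF i] ..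
  also have "(\<lambda>t. LINT \<omega>|lborel. G \<omega> * (k t * ?e \<omega> t))
      = (\<lambda>t. k t * complex_of_real (gaussian ((1/b) *\<^sub>R t)) / (?c * (2 * pi * b) ^ DIM('a)))"
  proof
    fix t
    have "(LINT \<omega>|lborel. G \<omega> * (k t * ?e \<omega> t)) = (LINT \<omega>|lborel. k t * (G \<omega> * ?e \<omega> t))"
      by (simp add: mult_ac)
    also have "\<dots> = k t * (LINT \<omega>|lborel. G \<omega> * ?e \<omega> t)" by simp
    also have "\<dots> = k t * complex_of_real (gaussian ((1/b) *\<^sub>R t)) / (?c * (2 * pi * b) ^ DIM('a))"
      unfolding inner gaussian_eq using c by simp
    finally show "(LINT \<omega>|lborel. G \<omega> * (k t * ?e \<omega> t)) = k t * complex_of_real (gaussian ((1/b) *\<^sub>R t)) / (?c * (2 * pi * b) ^ DIM('a))" .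
  qed
  also have "(LINT t|lborel. k t * complex_of_real (gaussian ((1/b) *\<^sub>R t)) / (?c * (2 * pi * b) ^ DIM('a))) / ?c
      = (LINT t|lborel. k t * complex_of_real (gaussian ((1/b) *\<^sub>R t))) / (?c * ?c * (2 * pi) ^ DIM('a) * b ^ DIM('a))"
    by (simp add: power_mult_distrib mult_ac)
  also have "\<dots> = (LINT t|lborel. k t * complex_of_real (gaussian ((1/b) *\<^sub>R t))) / b ^ DIM('a)"
    by (simp only: c2 mult_1)
  also have "(LINT t|lborel. k t * complex_of_real (gaussian ((1/b) *\<^sub>R t)))
      = \<bar>b\<bar> ^ DIM('a) *\<^sub>R (LINT v|lborel. k (0 + b *\<^sub>R v) * complex_of_real (gaussian ((1/b) *\<^sub>R (0 + b *\<^sub>R v))))"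
    by (rule integral_lborel_affine) (use b in auto)
  also have "\<dots> / b ^ DIM('a) = ?R"
    using b by (simp add: scaleR_conv_of_real mult.commute)
  finally show ?thesis .
qed

text \<open>The autocorrelation is the inner product of a translate of \<open>h\<close> with
  \<open>h\<close>: Cauchy-Schwarz bounds it, and continuity of translation in mean square gives
  continuity at 0.\<close>

lemma autocorr_props:
  fixes h :: "'a::euclidean_space \<Rightarrow> complex"
  assumes h: "square_integrable h"
  shows "cmod (autocorr h u) \<le> (LINT t|lborel. (cmod (h t))\<^sup>2)"
    and "x \<longlonglongrightarrow> 0 \<Longrightarrow> (\<lambda>n. autocorr h (x n)) \<longlonglongrightarrow> complex_of_real (LINT t|lborel. (cmod (h t))\<^sup>2)"
proof -
  have [measurable]: "h \<in> borel_measurable borel" and int: "integrable lborel (\<lambda>t. (cmod (h t))\<^sup>2)"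
    using h by (auto simp: square_integrable_def)
  have sh: "square_integrable (\<lambda>t. h (t + u))" for u
    unfolding square_integrable_def using integrable_lborel_shift[OF int, of u] by simp
  have norm_sh: "norm (abs_l2 (\<lambda>t. h (t + u))) = norm (abs_l2 h)" for u
  proof -
    have "(norm (abs_l2 (\<lambda>t. h (t + u))))\<^sup>2 = (norm (abs_l2 h))\<^sup>2"
      unfolding norm_abs_l2[OF sh] norm_abs_l2[OF h]
      by (rule integral_lborel_shift[of "\<lambda>t. (cmod (h t))\<^sup>2"]) measurable
    then show ?thesis by (simp add: power2_eq_iff_nonneg)
  qed
  have ac: "autocorr h u = cinner (abs_l2 (\<lambda>t. h (t + u))) (abs_l2 h)" for u
    unfolding autocorr_def by (rule cinner_abs_l2[OF sh h, symmetric])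
  show "cmod (autocorr h u) \<le> (LINT t|lborel. (cmod (h t))\<^sup>2)"
    unfolding ac norm_abs_l2[OF h, symmetric]
    using cinner_Cauchy_Schwarz[of "abs_l2 (\<lambda>t. h (t + u))" "abs_l2 h"] by (simp only: norm_sh power2_eq_square)
  assume x: "x \<longlonglongrightarrow> 0"
  have "(\<lambda>n. sqrt (LINT t|lborel. (cmod (h (t + x n) - h t))\<^sup>2)) \<longlonglongrightarrow> sqrt 0"
    by (intro tendsto_real_sqrt translation_continuity_L2 h x)
  also have "(\<lambda>n. sqrt (LINT t|lborel. (cmod (h (t + x n) - h t))\<^sup>2))
      = (\<lambda>n. norm (abs_l2 (\<lambda>t. h (t + x n)) - abs_l2 h))"
    unfolding minus_abs_l2[OF sh h] norm_abs_l2[OF square_integrable_diff[OF sh h], symmetric] by simp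
  finally have "(\<lambda>n. abs_l2 (\<lambda>t. h (t + x n))) \<longlonglongrightarrow> abs_l2 h"
    by (simp add: tendsto_norm_zero_iff LIM_zero_iff)
  from tendsto_cinner_left[OF this, of "abs_l2 h"]
  show "(\<lambda>n. autocorr h (x n)) \<longlonglongrightarrow> complex_of_real (LINT t|lborel. (cmod (h t))\<^sup>2)"
    unfolding ac[symmetric] by (simp add: cinner_self norm_abs_l2[OF h])
qed

text \<open>Damping the squared transform by the Gaussian weights \<open>w n\<close> turns its
  integral into a Gaussian average of the autocorrelation at scale \<open>b n\<close>, which tends
  to the value at 0. As the weights lie below 1 and tend to 1, Fatou gives one inequality and
  monotonicity the other.\<close>

lemma Plancherel:
  fixes h :: "'a::euclidean_space \<Rightarrow> complex"
  assumes h: "integrable lborel h" and h2: "square_integrable h"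
  shows "(\<integral>\<^sup>+\<omega>. ennreal ((cmod (fourier h \<omega>))\<^sup>2) \<partial>lborel) = (\<integral>\<^sup>+t. ennreal ((cmod (h t))\<^sup>2) \<partial>lborel)"
proof -
  have [measurable]: "h \<in> borel_measurable borel" using h by auto
  define N where "N = (LINT t|lborel. (cmod (h t))\<^sup>2)"
  have N: "(\<integral>\<^sup>+t. ennreal ((cmod (h t))\<^sup>2) \<partial>lborel) = ennreal N"
    unfolding N_def by (rule nn_integral_eq_integral) (use h2 in \<open>auto simp: square_integrable_def\<close>)
  define b where "b n = inverse (real (Suc n))" for n
  have b: "b n > 0" "b \<longlonglongrightarrow> 0" for n
    unfolding b_def using LIMSEQ_inverse_real_of_nat by auto
  define w where "w n \<omega> = exp (- (norm ((2 * pi * b n) *\<^sub>R \<omega>))\<^sup>2 / 2)" for n and \<omega> :: 'a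
  have [measurable]: "w n \<in> borel_measurable borel" for n unfolding w_def by measurable
  have kb: "cmod (fourier h \<omega>) \<le> (LINT t|lborel. cmod (h t))" for \<omega>
    unfolding fourier_def
    by (rule order_trans[OF integral_norm_bound]) (simp add: norm_mult)
  have w_int: "integrable lborel (w n)" for n
  proof -
    have "w n = (\<lambda>\<omega>. gaussian (0 + (2 * pi * b n) *\<^sub>R \<omega>) / (1 / sqrt (2 * pi)) ^ DIM('a))"
      by (auto simp: w_def gaussian_eq)
    then show ?thesis
      using integrable_lborel_affine[OF gaussian_integral(1), of "2 * pi * b n" "0::'a"] b(1)[of n] by simp
  qed
  have "integrable lborel (\<lambda>\<omega>. w n \<omega> * (cmod (fourier h \<omega>))\<^sup>2)" for n
  proof (rule Bochner_Integration.integrable_bound)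
    show "integrable lborel (\<lambda>\<omega>. w n \<omega> * (LINT t|lborel. cmod (h t))\<^sup>2)"
      using w_int by simp
    show "AE \<omega> in lborel. norm (w n \<omega> * (cmod (fourier h \<omega>))\<^sup>2) \<le> norm (w n \<omega> * (LINT t|lborel. cmod (h t))\<^sup>2)"
    proof (rule AE_I2)
      fix \<omega>
      have "w n \<omega> \<ge> 0" by (simp add: w_def)
      moreover have "(cmod (fourier h \<omega>))\<^sup>2 \<le> (LINT t|lborel. cmod (h t))\<^sup>2"
        by (intro power_mono kb) simp
      ultimately show "norm (w n \<omega> * (cmod (fourier h \<omega>))\<^sup>2) \<le> norm (w n \<omega> * (LINT t|lborel. cmod (h t))\<^sup>2)"
        by (simp add: abs_mult mult_left_mono)
    qed
  qed measurable
  then have I_eq: "(\<integral>\<^sup>+\<omega>. ennreal (w n \<omega> * (cmod (fourier h \<omega>))\<^sup>2) \<partial>lborel)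
      = ennreal (LINT \<omega>|lborel. w n \<omega> * (cmod (fourier h \<omega>))\<^sup>2)" for n
    by (intro nn_integral_eq_integral) (auto simp: w_def)
  have "complex_of_real (LINT \<omega>|lborel. w n \<omega> * (cmod (fourier h \<omega>))\<^sup>2)
      = (LINT v|lborel. complex_of_real (gaussian v) * autocorr h (b n *\<^sub>R v))" for n
    unfolding fourier_gaussian_multiplier[OF integrable_autocorr[OF h] b(1), symmetric] fourier_autocorr[OF h]
      integral_complex_of_real[symmetric] by (simp add: w_def)
  moreover have "(\<lambda>n. LINT v|lborel. complex_of_real (gaussian v) * autocorr h (b n *\<^sub>R v))
      \<longlonglongrightarrow> (LINT v|lborel. complex_of_real (gaussian (v::'a)) * complex_of_real N)"
  proof (rule integral_dominated_convergence[where w = "\<lambda>v. gaussian v * N"])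
    have [measurable]: "autocorr h \<in> borel_measurable borel"
      using integrable_autocorr[OF h] by auto
    show "(\<lambda>v. complex_of_real (gaussian v) * autocorr h (b n *\<^sub>R v)) \<in> borel_measurable lborel" for n
      by measurable
    show "AE v in lborel. (\<lambda>n. complex_of_real (gaussian v) * autocorr h (b n *\<^sub>R v))
        \<longlonglongrightarrow> complex_of_real (gaussian v) * complex_of_real N"
    proof (rule AE_I2)
      fix v :: 'a
      have "(\<lambda>n. b n *\<^sub>R v) \<longlonglongrightarrow> 0 *\<^sub>R v" by (intro tendsto_intros b)
      then show "(\<lambda>n. complex_of_real (gaussian v) * autocorr h (b n *\<^sub>R v))
        \<longlonglongrightarrow> complex_of_real (gaussian v) * complex_of_real N"
        unfolding N_def by (intro tendsto_mult tendsto_const autocorr_props h2) simp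
    qed
    show "AE v in lborel. norm (complex_of_real (gaussian v) * autocorr h (b n *\<^sub>R v)) \<le> gaussian v * N" for n
      unfolding N_def
      by (rule AE_I2) (auto simp: norm_mult gaussian_nonneg intro!: mult_left_mono autocorr_props h2)
  qed (use gaussian_integral in auto)
  ultimately have "(\<lambda>n. complex_of_real (LINT \<omega>|lborel. w n \<omega> * (cmod (fourier h \<omega>))\<^sup>2)) \<longlonglongrightarrow> complex_of_real N"
    using gaussian_integral(2)[where 'a = 'a]
    by (simp add: complex_of_real_integrable_eq integral_complex_of_real)
  then have "(\<lambda>n. LINT \<omega>|lborel. w n \<omega> * (cmod (fourier h \<omega>))\<^sup>2) \<longlonglongrightarrow> N"
    by (simp only: tendsto_of_real_iff)
  then have lim: "(\<lambda>n. \<integral>\<^sup>+\<omega>. ennreal (w n \<omega> * (cmod (fourier h \<omega>))\<^sup>2) \<partial>lborel) \<longlonglongrightarrow> ennreal N"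
    unfolding I_eq by (rule tendsto_ennrealI)
  show ?thesis
    unfolding N
  proof (rule antisym)
    have "(\<integral>\<^sup>+\<omega>. ennreal ((cmod (fourier h \<omega>))\<^sup>2) \<partial>lborel)
      = (\<integral>\<^sup>+\<omega>. liminf (\<lambda>n. ennreal (w n \<omega> * (cmod (fourier h \<omega>))\<^sup>2)) \<partial>lborel)"
    proof (rule nn_integral_cong)
      fix \<omega> :: 'a
      have "(\<lambda>n. w n \<omega> * (cmod (fourier h \<omega>))\<^sup>2) \<longlonglongrightarrow> exp (- (norm ((2 * pi * 0) *\<^sub>R \<omega>))\<^sup>2 / 2) * (cmod (fourier h \<omega>))\<^sup>2"
        unfolding w_def by (intro tendsto_intros b) simp
      then have "(\<lambda>n. ennreal (w n \<omega> * (cmod (fourier h \<omega>))\<^sup>2)) \<longlonglongrightarrow> ennreal ((cmod (fourier h \<omega>))\<^sup>2)"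
        by (intro tendsto_ennrealI) simp
      then show "ennreal ((cmod (fourier h \<omega>))\<^sup>2) = liminf (\<lambda>n. ennreal (w n \<omega> * (cmod (fourier h \<omega>))\<^sup>2))"
        by (intro lim_imp_Liminf[symmetric]) simp_all
    qed
    also have "\<dots> \<le> liminf (\<lambda>n. \<integral>\<^sup>+\<omega>. ennreal (w n \<omega> * (cmod (fourier h \<omega>))\<^sup>2) \<partial>lborel)"
      by (intro nn_integral_liminf) measurable
    also have "\<dots> = ennreal N"
      by (rule lim_imp_Liminf[OF _ lim]) simp
    finally show "(\<integral>\<^sup>+\<omega>. ennreal ((cmod (fourier h \<omega>))\<^sup>2) \<partial>lborel) \<le> ennreal N" .
    show "ennreal N \<le> (\<integral>\<^sup>+\<omega>. ennreal ((cmod (fourier h \<omega>))\<^sup>2) \<partial>lborel)"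
    proof (rule LIMSEQ_le_const2[OF lim], intro exI[of _ 0] allI impI nn_integral_mono ennreal_leI)
      fix n \<omega>
      have "w n \<omega> \<le> 1" by (simp add: w_def)
      then show "w n \<omega> * (cmod (fourier h \<omega>))\<^sup>2 \<le> (cmod (fourier h \<omega>))\<^sup>2"
        using mult_right_mono[of "w n \<omega>" 1 "(cmod (fourier h \<omega>))\<^sup>2"] by simp
    qed
  qed
qed

section \<open>Time-frequency shifts\<close>

lemma fst_snd_borel_measurable [measurable]:
  "fst \<in> borel_measurable (borel :: ('a::euclidean_space \<times> 'b::euclidean_space) measure)"
  "snd \<in> borel_measurable (borel :: ('a::euclidean_space \<times> 'b::euclidean_space) measure)"
  by (intro borel_measurable_continuous_onI continuous_intros)+

text \<open>The shift on representatives instead of classes, where the identities can be checked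
  pointwise.\<close>

definition tf_fun :: "'a::euclidean_space \<times> 'a \<Rightarrow> ('a \<Rightarrow> complex) \<Rightarrow> 'a \<Rightarrow> complex" where
  "tf_fun z f t = exp (2 * complex_of_real pi * \<i> * complex_of_real (snd z \<bullet> t)) * f (t - fst z)"

lemma square_integrable_tf_fun:
  assumes f: "square_integrable f"
  shows "square_integrable (tf_fun z f)"
proof -
  have [measurable]: "f \<in> borel_measurable borel" and int: "integrable lborel (\<lambda>t. (cmod (f t))\<^sup>2)"
    using f by (auto simp: square_integrable_def)
  have "(cmod (tf_fun z f t))\<^sup>2 = (cmod (f (t + - fst z)))\<^sup>2" for t
    by (simp add: tf_fun_def norm_mult)
  then show ?thesis
    using integrable_lborel_shift[OF int, of "- fst z"]
    unfolding square_integrable_def by (simp add: tf_fun_def[abs_def])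
qed

lemma tf_shift_abs:
  assumes "square_integrable f"
  shows "tf_shift z (abs_l2 f) = abs_l2 (tf_fun z f)"
  by (subst tf_shift.abs_eq) (use assms in \<open>simp_all add: l2_eq_def tf_fun_def[abs_def] case_prod_unfold\<close>)

lemma tf_shift_rep: "tf_shift z f = abs_l2 (tf_fun z (rep_l2 f))"
  using tf_shift_abs[OF square_integrable_rep_l2[of f], of z] by simp

lemma scaleC_abs:
  assumes "square_integrable f"
  shows "c *\<^sub>C abs_l2 f = abs_l2 (\<lambda>t. c * f t)"
  by (subst scaleC.abs_eq) (use assms in \<open>simp_all add: l2_eq_def\<close>)

lemma tf_shift_scaleC: "tf_shift z (c *\<^sub>C f) = c *\<^sub>C tf_shift z f"
proof -
  note r = square_integrable_rep_l2[of f]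
  have "tf_shift z (c *\<^sub>C f) = tf_shift z (abs_l2 (\<lambda>t. c * rep_l2 f t))"
    using scaleC_abs[OF r, of c] by simp
  also have "\<dots> = abs_l2 (tf_fun z (\<lambda>t. c * rep_l2 f t))"
    by (rule tf_shift_abs[OF square_integrable_cmult[OF r]])
  also have "tf_fun z (\<lambda>t. c * rep_l2 f t) = (\<lambda>t. c * tf_fun z (rep_l2 f) t)"
    by (rule ext) (simp only: tf_fun_def mult.left_commute)
  also have "abs_l2 \<dots> = c *\<^sub>C tf_shift z f"
    by (simp only: scaleC_abs[OF square_integrable_tf_fun[OF r]] tf_shift_rep)
  finally show ?thesis .
qed

lemma tf_shift_isometry: "cinner (tf_shift z f) (tf_shift z g) = cinner f g"
proof -
  define e where "e t = exp (2 * complex_of_real pi * \<i> * complex_of_real (snd z \<bullet> t))" for t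
  have "e t * cnj (e t) = 1" for t
    unfolding e_def by (simp only: complex_norm_square[symmetric]) simp
  then have "tf_fun z (rep_l2 f) t * cnj (tf_fun z (rep_l2 g) t)
      = rep_l2 f (t + - fst z) * cnj (rep_l2 g (t + - fst z))" for t
    unfolding tf_fun_def e_def[symmetric] complex_cnj_mult
    by (metis (no_types) add_uminus_conv_diff mult.assoc mult.left_commute mult_1)
  then show ?thesis
    unfolding tf_shift_rep cinner_abs_l2[OF square_integrable_tf_fun square_integrable_tf_fun, OF square_integrable_rep_l2 square_integrable_rep_l2]
      cinner_rep_l2[of f g]
    by (simp only:) (rule integral_lborel_shift[of "\<lambda>t. rep_l2 f t * cnj (rep_l2 g t)"]; measurable)
qed

lemma norm_tf_shift [simp]: "norm (tf_shift z f) = norm f"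
proof -
  have "complex_of_real ((norm (tf_shift z f))\<^sup>2) = complex_of_real ((norm f)\<^sup>2)"
    unfolding cinner_self[symmetric] by (rule tf_shift_isometry)
  then have "(norm (tf_shift z f))\<^sup>2 = (norm f)\<^sup>2" by (simp only: of_real_eq_iff)
  then show ?thesis by (simp add: power2_eq_iff_nonneg)
qed

text \<open>The shifts form a projective representation; the cocycle has modulus 1 and disappears
  from every absolute value.\<close>

lemma tf_shift_compose:
  "tf_shift z (tf_shift w f) = exp (- (2 * complex_of_real pi * \<i> * complex_of_real (snd w \<bullet> fst z))) *\<^sub>C tf_shift (z + w) f"
proof -
  note r = square_integrable_rep_l2[of f]
  let ?c = "exp (- (2 * complex_of_real pi * \<i> * complex_of_real (snd w \<bullet> fst z)))"
  have "tf_fun z (tf_fun w (rep_l2 f)) t = ?c * tf_fun (z + w) (rep_l2 f) t" for t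
  proof -
    have "exp (2 * complex_of_real pi * \<i> * complex_of_real (snd z \<bullet> t)) * exp (2 * complex_of_real pi * \<i> * complex_of_real (snd w \<bullet> (t - fst z)))
      = ?c * exp (2 * complex_of_real pi * \<i> * complex_of_real (snd (z + w) \<bullet> t))"
      unfolding exp_add[symmetric] by (simp add: inner_diff_right inner_add_left algebra_simps)
    moreover have "t - fst z - fst w = t - fst (z + w)" by simp
    ultimately show ?thesis
      unfolding tf_fun_def by (simp only: mult.assoc[symmetric])
  qed
  then have "tf_fun z (tf_fun w (rep_l2 f)) = (\<lambda>t. ?c * tf_fun (z + w) (rep_l2 f) t)" by blast
  then show ?thesis
    by (simp only: tf_shift_rep[of w f] tf_shift_rep[of "z + w" f] tf_shift_abs[OF square_integrable_tf_fun[OF r]]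
        scaleC_abs[OF square_integrable_tf_fun[OF r]])
qed

lemma tf_shift_zero: "tf_shift 0 f = f"
  by (simp add: tf_shift_rep tf_fun_def[abs_def])

text \<open>Dependence on \<open>w - z\<close> alone is what makes the Hilbert-Schmidt norm of the
  convolution a correlation integral.\<close>

lemma cmod_cinner_tf_shift_diff:
  "cmod (cinner (tf_shift z f) (tf_shift w g)) = cmod (cinner f (tf_shift (w - z) g))"
proof -
  let ?c = "exp (- (2 * complex_of_real pi * \<i> * complex_of_real (snd (w - z) \<bullet> fst z)))"
  have "tf_shift z (tf_shift (w - z) g) = ?c *\<^sub>C tf_shift w g"
    using tf_shift_compose[of z "w - z" g] by simp
  then have "cinner f (tf_shift (w - z) g) = cnj ?c * cinner (tf_shift z f) (tf_shift w g)"
    using tf_shift_isometry[of z f "tf_shift (w - z) g"] by (simp only: cinner_scaleC_right)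
  moreover have "cmod (cnj ?c) = 1" by (simp only: complex_mod_cnj) simp
  ultimately show ?thesis by (simp only: norm_mult mult_1)
qed

text \<open>The adjoint is the inverse shift \<open>tf_shift (- z)\<close> times the phase
  \<open>?c\<close>, which cancels the cocycle of composing it with \<open>tf_shift z\<close>. As
  \<open>op_adj\<close> is a definite description, uniqueness of the adjoint has to be shown as
  well.\<close>

lemma op_adj_tf_shift:
  "cinner (tf_shift z \<phi>) \<psi> = cinner \<phi> (op_adj (tf_shift z) \<psi>)"
  and tf_shift_op_adj: "tf_shift z (op_adj (tf_shift z) \<psi>) = \<psi>"
proof -
  let ?c = "exp (2 * complex_of_real pi * \<i> * complex_of_real (- snd z \<bullet> fst z))"
  define B where "B \<psi> = ?c *\<^sub>C tf_shift (- z) \<psi>" for \<psi>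
  have B: "tf_shift z (B \<psi>) = \<psi>" for \<psi>
  proof -
    have "?c * exp (- (2 * complex_of_real pi * \<i> * complex_of_real (snd (- z) \<bullet> fst z))) = 1"
      unfolding exp_add[symmetric] by simp
    then show ?thesis
      unfolding B_def tf_shift_scaleC tf_shift_compose by (simp add: tf_shift_zero)
  qed
  have adj: "cinner (tf_shift z \<phi>) \<psi> = cinner \<phi> (B \<psi>)" for \<phi> \<psi>
    using tf_shift_isometry[of z \<phi> "B \<psi>"] by (simp add: B)
  have "op_adj (tf_shift z) = B"
    unfolding op_adj_def
  proof (rule the_equality)
    fix C assume C: "\<forall>\<phi> \<psi>. cinner (tf_shift z \<phi>) \<psi> = cinner \<phi> (C \<psi>)"
    show "C = B"
    proof
      fix \<psi>
      have "cinner (C \<psi>) \<phi> = cinner (B \<psi>) \<phi>" for \<phi>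
        using C adj by (subst (1 2) cinner_commute) simp
      then show "C \<psi> = B \<psi>" by (rule cinner_ext)
    qed
  qed (use adj in blast)
  then show "cinner (tf_shift z \<phi>) \<psi> = cinner \<phi> (op_adj (tf_shift z) \<psi>)"
    and "tf_shift z (op_adj (tf_shift z) \<psi>) = \<psi>"
    by (simp_all only: adj B)
qed

text \<open>This is the short-time Fourier transform of \<open>f\<close> with window
  \<open>g\<close>: at a fixed position, an ordinary Fourier transform in the frequency.
  Measurability in \<open>z\<close> and the Plancherel step for Moyal's identity both come from this
  form.\<close>

lemma cinner_tf_shift_fourier:
  "cinner f (tf_shift z g) = fourier (\<lambda>t. rep_l2 f t * cnj (rep_l2 g (t - fst z))) (snd z)"
proof -
  note r = square_integrable_rep_l2
  have "cinner f (tf_shift z g) = cinner (abs_l2 (rep_l2 f)) (abs_l2 (tf_fun z (rep_l2 g)))"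
    by (simp add: tf_shift_rep)
  also have "\<dots> = (LINT t|lborel. rep_l2 f t * cnj (tf_fun z (rep_l2 g) t))"
    by (rule cinner_abs_l2[OF r square_integrable_tf_fun[OF r]])
  finally show ?thesis
    by (simp add: fourier_def tf_fun_def exp_cnj mult_ac)
qed

lemma cinner_tf_shift_measurable [measurable]:
  "(\<lambda>z. cinner f (tf_shift z g)) \<in> borel_measurable borel"
  "(\<lambda>z. cinner (tf_shift z g) f) \<in> borel_measurable borel"
proof -
  have "(\<lambda>z. LINT t|lborel. (rep_l2 f t * cnj (rep_l2 g (t - fst z))) * exp (- (\<i> * complex_of_real (2 * pi * (snd z \<bullet> t))))) \<in> borel_measurable borel"
    by measurable
  then show 1: "(\<lambda>z. cinner f (tf_shift z g)) \<in> borel_measurable borel"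
    by (simp add: cinner_tf_shift_fourier[abs_def] fourier_def)
  have "(\<lambda>z. cinner (tf_shift z g) f) = (\<lambda>z. cnj (cinner f (tf_shift z g)))"
    by (rule ext) (rule cinner_commute)
  then show "(\<lambda>z. cinner (tf_shift z g) f) \<in> borel_measurable borel"
    using measurable_compose[OF 1 cnj_borel_measurable] by simp
qed

text \<open>Plancherel in the frequency variable, then Tonelli.\<close>

lemma Moyal:
  fixes f g :: "'a::euclidean_space l2"
  shows "(\<integral>\<^sup>+z. ennreal ((cmod (cinner f (tf_shift z g)))\<^sup>2) \<partial>lborel) = ennreal ((norm f)\<^sup>2) * ennreal ((norm g)\<^sup>2)"
proof -
  let ?f = "rep_l2 f" and ?g = "rep_l2 g"
  define h where "h x t = ?f t * cnj (?g (t - x))" for x t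
  have [measurable]: "h x \<in> borel_measurable borel" for x unfolding h_def by measurable
  have int: "integrable lborel (h x)" for x
  proof -
    have "square_integrable (tf_fun (x, 0) ?g)"
      by (rule square_integrable_tf_fun[OF square_integrable_rep_l2])
    from square_integrable_mult_cnj[OF square_integrable_rep_l2[of f] this]
    show ?thesis by (simp add: h_def[abs_def] tf_fun_def)
  qed
  have Tonelli: "(\<integral>\<^sup>+x. \<integral>\<^sup>+t. ennreal ((cmod (h x t))\<^sup>2) \<partial>lborel \<partial>lborel) = ennreal ((norm f)\<^sup>2) * ennreal ((norm g)\<^sup>2)"
  proof -
    have m: "(\<lambda>(x, t). ennreal ((cmod (h x t))\<^sup>2)) \<in> borel_measurable (lborel \<Otimes>\<^sub>M lborel)"
      unfolding h_def by measurable
    have "(\<integral>\<^sup>+x. \<integral>\<^sup>+t. ennreal ((cmod (h x t))\<^sup>2) \<partial>lborel \<partial>lborel)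
      = (\<integral>\<^sup>+t. \<integral>\<^sup>+x. ennreal ((cmod (h x t))\<^sup>2) \<partial>lborel \<partial>lborel)"
      by (rule lborel_pair.Fubini'[OF m, symmetric])
    also have "\<dots> = (\<integral>\<^sup>+t. ennreal ((cmod (?f t))\<^sup>2) * ennreal ((norm g)\<^sup>2) \<partial>lborel)"
    proof (rule nn_integral_cong)
      fix t
      have "(\<integral>\<^sup>+x. ennreal ((cmod (h x t))\<^sup>2) \<partial>lborel)
        = (\<integral>\<^sup>+x. ennreal ((cmod (?f t))\<^sup>2) * ennreal ((cmod (?g (t - x)))\<^sup>2) \<partial>lborel)"
        by (simp add: h_def norm_mult power_mult_distrib ennreal_mult)
      also have "\<dots> = ennreal ((cmod (?f t))\<^sup>2) * (\<integral>\<^sup>+x. ennreal ((cmod (?g (t - x)))\<^sup>2) \<partial>lborel)"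
        by (rule nn_integral_cmult) measurable
      also have "(\<integral>\<^sup>+x. ennreal ((cmod (?g (t - x)))\<^sup>2) \<partial>lborel) = ennreal ((norm g)\<^sup>2)"
        unfolding nn_norm_rep_l2
        by (rule nn_integral_lborel_reflect[of "\<lambda>x. ennreal ((cmod (?g x))\<^sup>2)"]) measurable
      finally show "(\<integral>\<^sup>+x. ennreal ((cmod (h x t))\<^sup>2) \<partial>lborel) = ennreal ((cmod (?f t))\<^sup>2) * ennreal ((norm g)\<^sup>2)" .
    qed
    also have "\<dots> = ennreal ((norm f)\<^sup>2) * ennreal ((norm g)\<^sup>2)"
      unfolding nn_norm_rep_l2[of f] by (rule nn_integral_multc) measurable
    finally show ?thesis .
  qed
  \<comment> \<open>Finiteness of the double integral makes \<open>h x\<close> square integrable for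
    almost every \<open>x\<close>, as Plancherel requires.\<close>
  have "AE x in lborel. (\<integral>\<^sup>+t. ennreal ((cmod (h x t))\<^sup>2) \<partial>lborel) \<noteq> \<infinity>"
  proof (rule nn_integral_PInf_AE)
    show "(\<lambda>x. \<integral>\<^sup>+t. ennreal ((cmod (h x t))\<^sup>2) \<partial>lborel) \<in> borel_measurable lborel"
      unfolding h_def by measurable
    show "(\<integral>\<^sup>+x. \<integral>\<^sup>+t. ennreal ((cmod (h x t))\<^sup>2) \<partial>lborel \<partial>lborel) \<noteq> \<infinity>"
      unfolding Tonelli by (simp add: ennreal_mult[symmetric])
  qed
  then have ae: "AE x in lborel. (\<integral>\<^sup>+\<omega>. ennreal ((cmod (fourier (h x) \<omega>))\<^sup>2) \<partial>lborel) = (\<integral>\<^sup>+t. ennreal ((cmod (h x t))\<^sup>2) \<partial>lborel)"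
  proof eventually_elim
    case (elim x)
    then have "square_integrable (h x)"
      by (intro square_integrableI_nn) (auto simp: less_top)
    then show ?case by (rule Plancherel[OF int])
  qed
  have "(\<integral>\<^sup>+z. ennreal ((cmod (cinner f (tf_shift z g)))\<^sup>2) \<partial>lborel)
    = (\<integral>\<^sup>+z. ennreal ((cmod (cinner f (tf_shift z g)))\<^sup>2) \<partial>(lborel \<Otimes>\<^sub>M lborel))"
    by (simp only: lborel_prod)
  also have "\<dots> = (\<integral>\<^sup>+x. \<integral>\<^sup>+\<omega>. ennreal ((cmod (cinner f (tf_shift (x, \<omega>) g)))\<^sup>2) \<partial>lborel \<partial>lborel)"
    by (rule lborel.nn_integral_fst[symmetric]) (simp add: lborel_prod)
  also have "\<dots> = (\<integral>\<^sup>+x. \<integral>\<^sup>+\<omega>. ennreal ((cmod (fourier (h x) \<omega>))\<^sup>2) \<partial>lborel \<partial>lborel)"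
    by (simp add: cinner_tf_shift_fourier h_def[abs_def])
  also have "\<dots> = (\<integral>\<^sup>+x. \<integral>\<^sup>+t. ennreal ((cmod (h x t))\<^sup>2) \<partial>lborel \<partial>lborel)"
    by (rule nn_integral_cong_AE[OF ae])
  finally show ?thesis unfolding Tonelli .
qed

section \<open>Density operators and their convolutions with indicator functions\<close>

text \<open>An unordered sum over a countable set becomes a series over the naturals, padded by
  zeros outside the range of the enumeration; finite and infinite sets are thus treated
  alike.\<close>

lemma sums_of_has_sum_countable:
  fixes f :: "'b \<Rightarrow> 'c::banach"
  assumes H: "countable H" and f: "(f has_sum s) H"
  shows "(\<lambda>n. if n \<in> to_nat_on H ` H then f (from_nat_into H n) else 0) sums s"
proof -
  have "((\<lambda>n. f (from_nat_into H n)) \<circ> to_nat_on H has_sum s) H"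
    using f by (rule has_sum_cong[THEN iffD1, rotated]) (simp add: H)
  then have "((\<lambda>n. f (from_nat_into H n)) has_sum s) (to_nat_on H ` H)"
    by (subst has_sum_reindex) (auto simp: H)
  then have "((\<lambda>n. if n \<in> to_nat_on H ` H then f (from_nat_into H n) else 0) has_sum s) UNIV"
    by (rule has_sum_cong_neutral[THEN iffD1, rotated -1]) auto
  then show ?thesis by (rule has_sum_imp_sums)
qed

text \<open>The entries with \<open>l n = 0\<close> are padding.\<close>

definition diagonalises :: "('a::euclidean_space l2 \<Rightarrow> 'a l2) \<Rightarrow> (nat \<Rightarrow> 'a l2) \<Rightarrow> (nat \<Rightarrow> real) \<Rightarrow> bool" where
  "diagonalises A h l \<longleftrightarrow>
     (\<forall>n. l n \<ge> 0) \<and> (\<forall>n. l n = 0 \<longrightarrow> h n = 0) \<and>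
     (\<forall>m n. l m \<noteq> 0 \<longrightarrow> l n \<noteq> 0 \<longrightarrow> cinner (h m) (h n) = (if m = n then 1 else 0)) \<and>
     (\<forall>n. A (h n) = l n *\<^sub>R h n) \<and>
     (\<forall>x y. (\<lambda>n. l n * (cinner x (h n) * cinner (h n) y)) sums cinner (A x) y)"

text \<open>The eigenvalues of the spectral decomposition are positive and sum to the trace, so
  there are only countably many eigenvectors and they can be enumerated.\<close>

lemma diagonalisation_exists:
  assumes A: "positive_op A" and E: "onb E" and tr: "((\<lambda>e. inner (A e) e) has_sum t) E"
  obtains h l where "diagonalises A h l" "l sums t"
proof -
  obtain H lam where H: "orthonormal H" and lam: "\<And>h. h \<in> H \<Longrightarrow> lam h > 0"
    "\<And>h. h \<in> H \<Longrightarrow> A h = lam h *\<^sub>R h"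
    and dec: "\<And>x y. ((\<lambda>h. lam h * (cinner x h * cinner h y)) has_sum cinner (A x) y) H"
    using spectral_decomposition[OF A finite_trace_compact[OF A E has_sum_imp_summable[OF tr]]] by blast
  have sum: "(lam has_sum t) H"
    by (rule trace_eq_sum_eigenvalues[OF E tr H lam(1) dec])
  have "{h\<in>H. lam h \<noteq> 0} = H" using lam(1) by force
  then have cnt: "countable H"
    using summable_countable_real[OF has_sum_imp_summable[OF sum]] by simp
  define I where "I = to_nat_on H ` H"
  define h where "h n = (if n \<in> I then from_nat_into H n else 0)" for n
  define l where "l n = (if n \<in> I then lam (from_nat_into H n) else 0)" for n
  have hH: "h n \<in> H" "l n = lam (h n)" if "n \<in> I" for n
    using that cnt by (auto simp: I_def h_def l_def)
  have inj: "h m = h n \<Longrightarrow> m = n" if "m \<in> I" "n \<in> I" for m n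
    using that cnt by (auto simp: I_def h_def)
  have nz: "l n \<noteq> 0 \<longleftrightarrow> n \<in> I" for n
    using hH lam(1) by (force simp: l_def)
  have "diagonalises A h l"
    unfolding diagonalises_def
  proof (intro conjI allI impI)
    fix n show "l n \<ge> 0" using hH[of n] lam(1)[of "h n"] by (cases "n \<in> I") (auto simp: l_def)
  next
    fix n assume "l n = 0" then show "h n = 0" using nz[of n] by (auto simp: h_def)
  next
    fix m n assume "l m \<noteq> 0" "l n \<noteq> 0"
    then show "cinner (h m) (h n) = (if m = n then 1 else 0)"
      using H hH inj[of m n] by (auto simp: nz orthonormal_def)
  next
    fix n show "A (h n) = l n *\<^sub>R h n"
      using hH[of n] lam(2)[of "h n"] bounded_op_zero[OF positive_op_bounded[OF A]]
      by (cases "n \<in> I") (auto simp: h_def l_def)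
  next
    fix x y
    have "(\<lambda>n. if n \<in> I then lam (from_nat_into H n) * (cinner x (from_nat_into H n) * cinner (from_nat_into H n) y) else 0)
      sums cinner (A x) y"
      unfolding I_def by (rule sums_of_has_sum_countable[OF cnt dec])
    moreover have "(if n \<in> I then complex_of_real (lam (from_nat_into H n)) * (cinner x (from_nat_into H n) * cinner (from_nat_into H n) y) else 0)
      = l n * (cinner x (h n) * cinner (h n) y)" for n
      by (simp add: l_def h_def)
    ultimately show "(\<lambda>n. l n * (cinner x (h n) * cinner (h n) y)) sums cinner (A x) y"
      by (simp only:)
  qed
  moreover have "l sums t"
    using sums_of_has_sum_countable[OF cnt sum] by (simp add: l_def[abs_def] I_def)
  ultimately show thesis by (rule that)
qed

text \<open>A divergent \<open>infsum\<close> would have the default value 0, so the value 1 of the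
  trace certifies that the sum exists.\<close>

lemma density_operator_trace:
  assumes "density_operator S"
  shows "((\<lambda>e. inner (S e) e) has_sum 1) (SOME E. onb E)"
proof -
  have "infsum (\<lambda>e. cinner (S e) e) (SOME E. onb E) = 1"
    using assms by (simp add: density_operator_def op_trace_def)
  then have "((\<lambda>e. cinner (S e) e) has_sum 1) (SOME E. onb E)"
    by (metis has_sum_infsum infsum_not_exists zero_neq_one)
  from has_sum_Re[OF this] show ?thesis by (simp add: inner_l2_def)
qed

text \<open>The square roots of the eigenvalues are absorbed into \<open>g\<close>, so that later
  formulas are plain sums of squares. The expansion is stated weakly, matching the weak integral in
  \<open>op_conv\<close>.\<close>

locale rank_one_mixture =
  fixes S :: "'a::euclidean_space l2 \<Rightarrow> 'a l2" and g :: "nat \<Rightarrow> 'a l2"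
  assumes S_positive: "positive_op S"
    and S_sums: "\<And>x y. (\<lambda>n. cinner x (g n) * cinner (g n) y) sums cinner (S x) y"
    and g_sums: "(\<lambda>n. (norm (g n))\<^sup>2) sums 1"

lemma density_operator_mixture:
  assumes S: "density_operator S"
  obtains g where "rank_one_mixture S g"
proof -
  have pos: "positive_op S" using S by (simp add: density_operator_def)
  obtain h l where d: "diagonalises S h l" and l: "l sums 1"
    by (rule diagonalisation_exists[OF pos onb_SOME density_operator_trace[OF S]])
  define g where "g n = complex_of_real (sqrt (l n)) *\<^sub>C h n" for n
  have l0: "l n \<ge> 0" for n using d by (simp add: diagonalises_def)
  have sq: "complex_of_real (sqrt (l n)) * complex_of_real (sqrt (l n)) = l n" for n
    using l0[of n] by (simp add: of_real_mult[symmetric] del: of_real_mult)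
  have "cinner x (g n) * cinner (g n) y = l n * (cinner x (h n) * cinner (h n) y)" for x y n
    unfolding sq[of n, symmetric] by (simp add: g_def cinner_algebra mult_ac)
  then have "(\<lambda>n. cinner x (g n) * cinner (g n) y) sums cinner (S x) y" for x y
    using d by (simp add: diagonalises_def)
  moreover have "(norm (g n))\<^sup>2 = l n" for n
  proof (cases "l n = 0")
    case False
    then have "cinner (h n) (h n) = 1" using d by (simp add: diagonalises_def)
    then have "(norm (h n))\<^sup>2 = 1" by (simp add: cinner_self flip: of_real_power)
    then show ?thesis using l0[of n] by (simp add: g_def power_mult_distrib)
  qed (simp add: g_def)
  ultimately have "rank_one_mixture S g"
    using pos l by unfold_locales simp_all
  then show thesis by (rule that)
qed

text \<open>Tonelli, with one of the series read as an integral over counting measure.\<close>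

lemma suminf_swap_ennreal: "(\<Sum>i. \<Sum>j. f i j) = (\<Sum>j. \<Sum>i. (f i j :: ennreal))"
proof -
  have "(\<Sum>i. \<Sum>j. f i j) = (\<integral>\<^sup>+i. (\<Sum>j. f i j) \<partial>count_space UNIV)"
    by (rule nn_integral_count_space_nat[symmetric])
  also have "\<dots> = (\<Sum>j. \<integral>\<^sup>+i. f i j \<partial>count_space UNIV)"
    by (rule nn_integral_suminf) simp
  finally show ?thesis by (simp add: nn_integral_count_space_nat)
qed

context rank_one_mixture
begin

section \<open>Shifted copies of the mixture and their quadratic forms\<close>

lemma g_suminf: "(\<Sum>n. ennreal ((norm (g n))\<^sup>2)) = 1"
  by (subst suminf_ennreal_eq[OF _ g_sums]) simp_all

text \<open>The shifted operator is again a mixture, with vectors \<open>tf_shift z (g n)\<close>,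
  because the adjoint moves the shift onto them.\<close>

lemma shift_sums:
  "(\<lambda>n. cinner \<phi> (tf_shift z (g n)) * cinner (tf_shift z (g n)) \<psi>) sums cinner (op_shift z S \<phi>) \<psi>"
proof -
  let ?a = "op_adj (tf_shift z)"
  have eq: "cinner (op_shift z S \<phi>) \<psi> = cinner (S (?a \<phi>)) (?a \<psi>)"
    by (simp add: op_shift_def op_adj_tf_shift)
  have "cinner (?a \<phi>) (g n) = cinner \<phi> (tf_shift z (g n))" for n
    by (simp only: cinner_commute[of "?a \<phi>" "g n"] cinner_commute[of \<phi> "tf_shift z (g n)"] op_adj_tf_shift)
  then show ?thesis
    unfolding eq using S_sums[of "?a \<phi>" "?a \<psi>"] by (simp add: op_adj_tf_shift)
qed

lemma shift_measurable [measurable]: "(\<lambda>z. cinner (op_shift z S \<phi>) \<psi>) \<in> borel_measurable borel"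
  unfolding sums_unique[OF shift_sums] by measurable

text \<open>The quadratic form of \<open>op_shift z S\<close> at \<open>\<phi>\<close>, as an
  extended nonnegative real.\<close>

definition weight :: "'a \<times> 'a \<Rightarrow> 'a l2 \<Rightarrow> ennreal" where
  "weight z \<phi> = (\<Sum>n. ennreal ((cmod (cinner \<phi> (tf_shift z (g n))))\<^sup>2))"

lemma weight_measurable [measurable]: "(\<lambda>z. weight z \<phi>) \<in> borel_measurable borel"
  unfolding weight_def by measurable

lemma shift_weight:
  "cinner (op_shift z S \<phi>) \<phi> \<in> \<real>" "0 \<le> Re (cinner (op_shift z S \<phi>) \<phi>)"
  "ennreal (Re (cinner (op_shift z S \<phi>) \<phi>)) = weight z \<phi>"
proof -
  let ?a = "op_adj (tf_shift z) \<phi>"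
  have eq: "cinner (op_shift z S \<phi>) \<phi> = cinner (S ?a) ?a"
    by (simp add: op_shift_def op_adj_tf_shift)
  show "cinner (op_shift z S \<phi>) \<phi> \<in> \<real>" "0 \<le> Re (cinner (op_shift z S \<phi>) \<phi>)"
    using S_positive by (simp_all add: eq positive_op_def)
  have "(\<lambda>n. Re (complex_of_real ((cmod (cinner \<phi> (tf_shift z (g n))))\<^sup>2))) sums Re (cinner (op_shift z S \<phi>) \<phi>)"
    using shift_sums[of \<phi> z \<phi>] unfolding cinner_mult_commute by (rule sums_Re)
  then show "ennreal (Re (cinner (op_shift z S \<phi>) \<phi>)) = weight z \<phi>"
    unfolding weight_def by (intro suminf_ennreal_eq[symmetric]) simp_all
qed

text \<open>Bessel's inequality for each \<open>tf_shift z (g n)\<close>, summed over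
  \<open>n\<close>: partial traces of the shifted operator are at most 1.\<close>

lemma weight_Bessel:
  assumes "orthonormal F" "finite F"
  shows "(\<Sum>e\<in>F. weight z e) \<le> 1"
proof -
  have "(\<Sum>e\<in>F. weight z e) = (\<Sum>n. \<Sum>e\<in>F. ennreal ((cmod (cinner e (tf_shift z (g n))))\<^sup>2))"
    unfolding weight_def by (rule suminf_sum[symmetric]) simp
  also have "\<dots> \<le> (\<Sum>n. ennreal ((norm (g n))\<^sup>2))"
  proof (intro suminf_le summableI)
    fix n
    have "(\<Sum>e\<in>F. (cmod (cinner e (tf_shift z (g n))))\<^sup>2) \<le> (norm (g n))\<^sup>2"
      using Bessel_finite[OF assms, of "tf_shift z (g n)"] by (simp add: cmod_cinner_commute)
    then show "(\<Sum>e\<in>F. ennreal ((cmod (cinner e (tf_shift z (g n))))\<^sup>2)) \<le> ennreal ((norm (g n))\<^sup>2)"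
      by (subst sum_ennreal) (auto intro: ennreal_leI)
  qed
  finally show ?thesis by (simp add: g_suminf)
qed

text \<open>Moyal's identity termwise: the shifted operators integrate to the identity over phase
  space.\<close>

lemma weight_total: "(\<integral>\<^sup>+z. weight z \<phi> \<partial>lborel) = ennreal ((norm \<phi>)\<^sup>2)"
proof -
  have "(\<integral>\<^sup>+z. weight z \<phi> \<partial>lborel)
      = (\<Sum>n. \<integral>\<^sup>+z. ennreal ((cmod (cinner \<phi> (tf_shift z (g n))))\<^sup>2) \<partial>lborel)"
    unfolding weight_def by (rule nn_integral_suminf) measurable
  then show ?thesis by (simp add: Moyal g_suminf)
qed

lemma shift_bound: "\<exists>K\<ge>0. \<forall>z \<phi> \<psi>. cmod (cinner (op_shift z S \<phi>) \<psi>) \<le> K * norm \<phi> * norm \<psi>"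
proof -
  obtain K where K: "K > 0" "\<And>x. norm (S x) \<le> K * norm x"
    using bounded_op_norm_bound[OF positive_op_bounded[OF S_positive]] by blast
  have "cmod (cinner (op_shift z S \<phi>) \<psi>) \<le> K * norm \<phi> * norm \<psi>" for z \<phi> \<psi>
  proof -
    have "norm (op_adj (tf_shift z) \<phi>) = norm \<phi>"
      using norm_tf_shift[of z "op_adj (tf_shift z) \<phi>"] by (simp add: tf_shift_op_adj)
    then have "norm (op_shift z S \<phi>) \<le> K * norm \<phi>"
      using K(2)[of "op_adj (tf_shift z) \<phi>"] by (simp add: op_shift_def)
    then show ?thesis
      using cinner_Cauchy_Schwarz[of "op_shift z S \<phi>" \<psi>] mult_right_mono[OF _ norm_ge_zero[of \<psi>]]
      by (meson order_trans)
  qed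
  with K(1) show ?thesis by (intro exI[of _ K]) auto
qed

lemma shift_linear:
  "cinner (op_shift z S (\<phi> + \<phi>')) \<psi> = cinner (op_shift z S \<phi>) \<psi> + cinner (op_shift z S \<phi>') \<psi>"
  "cinner (op_shift z S (c *\<^sub>C \<phi>)) \<psi> = c * cinner (op_shift z S \<phi>) \<psi>"
proof -
  show "cinner (op_shift z S (\<phi> + \<phi>')) \<psi> = cinner (op_shift z S \<phi>) \<psi> + cinner (op_shift z S \<phi>') \<psi>"
    using sums_unique2[OF shift_sums[of "\<phi> + \<phi>'" z \<psi>]] sums_add[OF shift_sums[of \<phi> z \<psi>] shift_sums[of \<phi>' z \<psi>]]
    by (simp add: cinner_add_left ring_distribs)
  show "cinner (op_shift z S (c *\<^sub>C \<phi>)) \<psi> = c * cinner (op_shift z S \<phi>) \<psi>"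
    using sums_unique2[OF shift_sums[of "c *\<^sub>C \<phi>" z \<psi>]] sums_mult[OF shift_sums[of \<phi> z \<psi>], of c]
    by (simp add: cinner_scaleC_left mult_ac)
qed

text \<open>The trace of \<open>S\<close> composed with its shift by \<open>w\<close>. It is a
  probability density on phase space, by \<open>corr_total\<close>.\<close>

definition corr :: "'a \<times> 'a \<Rightarrow> ennreal" where
  "corr w = (\<Sum>m. weight w (g m))"

lemma corr_measurable [measurable]: "corr \<in> borel_measurable borel"
  unfolding corr_def[abs_def] by measurable

lemma corr_total: "(\<integral>\<^sup>+w. corr w \<partial>lborel) = 1"
proof -
  have "(\<integral>\<^sup>+w. corr w \<partial>lborel) = (\<Sum>m. \<integral>\<^sup>+w. weight w (g m) \<partial>lborel)"
    unfolding corr_def by (rule nn_integral_suminf) measurable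
  then show ?thesis by (simp add: weight_total g_suminf)
qed

context
  fixes D :: "('a \<times> 'a) set"
  assumes D: "D \<in> sets borel" "emeasure lborel D < \<infinity>"
begin

abbreviation "T \<equiv> op_conv (indicator D) S"

section \<open>The convolution of the mixture with an indicator function\<close>

lemma conv_integrable: "integrable lborel (\<lambda>z. indicator D z * cinner (op_shift z S \<phi>) \<psi>)"
proof -
  obtain K where K: "K \<ge> 0" "\<And>z. cmod (cinner (op_shift z S \<phi>) \<psi>) \<le> K * norm \<phi> * norm \<psi>"
    using shift_bound by blast
  have [measurable]: "D \<in> sets borel" by (rule D)
  show ?thesis
  proof (rule Bochner_Integration.integrable_bound)
    show "integrable lborel (\<lambda>z. indicator D z * (K * norm \<phi> * norm \<psi>))"
      using D by (simp add: integrable_indicator_iff)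
    show "AE z in lborel. norm (indicator D z * cinner (op_shift z S \<phi>) \<psi>) \<le> norm (indicator D z * (K * norm \<phi> * norm \<psi>))"
      using K by (intro AE_I2) (auto simp: norm_mult abs_mult split: split_indicator)
  qed measurable
qed

lemma conv_bound: "\<exists>K\<ge>0. \<forall>\<phi> \<psi>. cmod (LINT z|lborel. indicator D z * cinner (op_shift z S \<phi>) \<psi>) \<le> K * norm \<phi> * norm \<psi>"
proof -
  obtain K where K: "K \<ge> 0" "\<And>z \<phi> \<psi>. cmod (cinner (op_shift z S \<phi>) \<psi>) \<le> K * norm \<phi> * norm \<psi>"
    using shift_bound by blast
  have "cmod (LINT z|lborel. indicator D z * cinner (op_shift z S \<phi>) \<psi>) \<le> (measure lborel D * K) * norm \<phi> * norm \<psi>" for \<phi> \<psi>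
  proof -
    have "cmod (LINT z|lborel. indicator D z * cinner (op_shift z S \<phi>) \<psi>)
      \<le> (LINT z|lborel. norm (indicator D z * cinner (op_shift z S \<phi>) \<psi>))"
      by (rule integral_norm_bound)
    also have "\<dots> \<le> (LINT z|lborel. indicator D z * (K * norm \<phi> * norm \<psi>))"
      by (rule integral_mono[OF integrable_norm[OF conv_integrable]])
        (use D K in \<open>auto simp: integrable_indicator_iff norm_mult split: split_indicator\<close>)
    also have "\<dots> = (measure lborel D * K) * norm \<phi> * norm \<psi>"
      using D by simp
    finally show ?thesis .
  qed
  with K(1) show ?thesis by (intro exI[of _ "measure lborel D * K"]) auto
qed

text \<open>Riesz representation supplies the vector described in \<open>op_conv\<close>, and inner
  products determine it uniquely, so the definite description denotes.\<close>

lemma conv_cinner: "cinner (T \<phi>) \<psi> = (LINT z|lborel. indicator D z * cinner (op_shift z S \<phi>) \<psi>)"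
proof -
  let ?L = "\<lambda>\<psi>. LINT z|lborel. indicator D z * cinner (op_shift z S \<phi>) \<psi>"
  obtain K where K: "\<And>\<psi>. cmod (?L \<psi>) \<le> K * norm \<phi> * norm \<psi>"
    using conv_bound by blast
  have "\<exists>\<eta>. \<forall>\<psi>. cinner \<eta> \<psi> = ?L \<psi>"
  proof (rule Riesz_l2)
    show "?L (x + y) = ?L x + ?L y" for x y
      by (simp add: cinner_add_right ring_distribs conv_integrable)
    show "?L (c *\<^sub>C x) = cnj c * ?L x" for c x
      by (subst integral_mult_right_zero[symmetric]) (simp add: cinner_scaleC_right mult_ac)
  qed (rule K)
  then obtain \<eta> where \<eta>: "\<forall>\<psi>. cinner \<eta> \<psi> = ?L \<psi>" by blast
  have "T \<phi> = \<eta>"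
    unfolding op_conv_def
    by (rule the_equality) (use \<eta> in \<open>auto intro: cinner_ext\<close>)
  then show ?thesis using \<eta> by simp
qed

lemma conv_positive: "positive_op T"
proof -
  have add: "T (x + y) = T x + T y" for x y
    by (rule cinner_ext) (simp add: conv_cinner cinner_add_left shift_linear ring_distribs conv_integrable)
  have scale: "T (c *\<^sub>C x) = c *\<^sub>C T x" for c x
  proof (rule cinner_ext)
    fix \<psi>
    show "cinner (T (c *\<^sub>C x)) \<psi> = cinner (c *\<^sub>C T x) \<psi>"
      unfolding conv_cinner cinner_scaleC_left shift_linear
      by (subst integral_mult_right_zero[symmetric]) (simp add: mult_ac)
  qed
  obtain K where K: "\<And>\<phi> \<psi>. cmod (cinner (T \<phi>) \<psi>) \<le> K * norm \<phi> * norm \<psi>"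
    using conv_bound unfolding conv_cinner[symmetric] by blast
  have "norm (T \<phi>) \<le> norm \<phi> * K" for \<phi>
  proof (cases "T \<phi> = 0")
    case True
    show ?thesis
    proof (cases "\<phi> = 0")
      case False
      have "0 \<le> K * norm \<phi> * norm \<phi>" using order_trans[OF norm_ge_zero K[of \<phi> \<phi>]] .
      then have "0 \<le> K" using False by (simp add: zero_le_mult_iff)
      then show ?thesis using True by simp
    qed (use True in simp)
  next
    case False
    \<comment> \<open>The bound on the form, tested with \<open>T \<phi>\<close> as second
      argument.\<close>
    have "norm (T \<phi>) * norm (T \<phi>) \<le> K * norm \<phi> * norm (T \<phi>)"
      using K[of \<phi> "T \<phi>"] by (simp add: cinner_self power2_eq_square norm_mult)
    then show ?thesis using False by (simp add: mult.commute)
  qed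
  then have "bounded_linear T"
    by (intro bounded_linear_intro[where K = K]) (simp_all add: add scaleR_eq_scaleC scale)
  then have b: "bounded_op T" by (simp add: bounded_op_def scale)
  have "cinner (T \<phi>) \<phi> = complex_of_real (LINT z|lborel. indicator D z * Re (cinner (op_shift z S \<phi>) \<phi>))" for \<phi>
    unfolding conv_cinner integral_complex_of_real[symmetric]
    using shift_weight(1) by (intro Bochner_Integration.integral_cong) (auto simp: complex_is_Real_iff complex_eq_iff split: split_indicator)
  moreover have "0 \<le> (LINT z|lborel. indicator D z * Re (cinner (op_shift z S \<phi>) \<phi>))" for \<phi>
    by (intro Bochner_Integration.integral_nonneg mult_nonneg_nonneg shift_weight) simp
  ultimately show ?thesis using b by (simp add: positive_op_def)
qed

text \<open>Passing to a nonnegative integral here is what the bound by the identity, the trace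
  bound and the formula for the square sum all rest on.\<close>

lemma conv_quadratic: "ennreal (inner (T \<phi>) \<phi>) = (\<integral>\<^sup>+z. indicator D z * weight z \<phi> \<partial>lborel)"
proof -
  have "Re (cinner (T \<phi>) \<phi>) = (LINT z|lborel. Re (indicator D z * cinner (op_shift z S \<phi>) \<phi>))"
    unfolding conv_cinner by (rule integral_Re[symmetric]) (rule conv_integrable)
  then have "ennreal (inner (T \<phi>) \<phi>) = ennreal (LINT z|lborel. Re (indicator D z * cinner (op_shift z S \<phi>) \<phi>))"
    by (simp add: inner_l2_def)
  also have "\<dots> = (\<integral>\<^sup>+z. ennreal (Re (indicator D z * cinner (op_shift z S \<phi>) \<phi>)) \<partial>lborel)"
    using shift_weight(2) conv_integrable
    by (intro nn_integral_eq_integral[symmetric] integrable_Re AE_I2) (auto split: split_indicator)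
  also have "\<dots> = (\<integral>\<^sup>+z. indicator D z * weight z \<phi> \<partial>lborel)"
    by (intro nn_integral_cong) (auto simp: shift_weight(3) split: split_indicator)
  finally show ?thesis .
qed

text \<open>Enlarging \<open>D\<close> to the whole phase space only increases the integral, which
  then is the squared norm by \<open>weight_total\<close>.\<close>

lemma conv_le_identity: "inner (T \<phi>) \<phi> \<le> (norm \<phi>)\<^sup>2"
proof -
  have "ennreal (inner (T \<phi>) \<phi>) \<le> (\<integral>\<^sup>+z. weight z \<phi> \<partial>lborel)"
    unfolding conv_quadratic by (intro nn_integral_mono) (auto split: split_indicator)
  then show ?thesis unfolding weight_total by (simp add: ennreal_le_iff)
qed

text \<open>Every finite partial trace is an integral over \<open>D\<close> of a quantity that
  \<open>weight_Bessel\<close> bounds by 1. The bound gives both summability and the estimate of the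
  sum.\<close>

lemma conv_trace:
  assumes E: "orthonormal E"
  obtains t where "((\<lambda>e. inner (T e) e) has_sum t) E" "t \<le> measure lborel D"
proof -
  have fin: "(\<Sum>e\<in>F. inner (T e) e) \<le> measure lborel D" if F: "finite F" "F \<subseteq> E" for F
  proof -
    have [measurable]: "D \<in> sets borel" by (rule D)
    have "ennreal (\<Sum>e\<in>F. inner (T e) e) = (\<Sum>e\<in>F. \<integral>\<^sup>+z. indicator D z * weight z e \<partial>lborel)"
      unfolding conv_quadratic[symmetric]
      by (rule sum_ennreal[symmetric]) (rule positive_op_inner[OF conv_positive])
    also have "\<dots> = (\<integral>\<^sup>+z. (\<Sum>e\<in>F. indicator D z * weight z e) \<partial>lborel)"
      by (rule nn_integral_sum[symmetric]) measurable
    also have "\<dots> \<le> (\<integral>\<^sup>+z. indicator D z * 1 \<partial>lborel)"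
      unfolding sum_distrib_left[symmetric]
      by (intro nn_integral_mono mult_left_mono weight_Bessel orthonormal_mono[OF E] F) auto
    also have "\<dots> = emeasure lborel D" by simp
    also have "\<dots> = ennreal (measure lborel D)"
      using D by (intro emeasure_eq_ennreal_measure) auto
    finally show ?thesis by (simp add: ennreal_le_iff)
  qed
  have "(\<lambda>e. inner (T e) e) summable_on E"
  proof (rule nonneg_bdd_above_summable_on)
    show "bdd_above (sum (\<lambda>e. inner (T e) e) ` {F. F \<subseteq> E \<and> finite F})"
      by (rule bdd_aboveI2[where M = "measure lborel D"]) (use fin in auto)
  qed (rule positive_op_inner[OF conv_positive])
  then obtain t where t: "((\<lambda>e. inner (T e) e) has_sum t) E"
    by (auto simp: summable_on_def)
  moreover have "t \<le> measure lborel D"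
    by (rule has_sum_le_finite_sums[OF t fin])
  ultimately show thesis by (rule that)
qed

text \<open>One factor \<open>l n\<close> is replaced by the quadratic form of \<open>T\<close> at
  \<open>h n\<close>, an integral over \<open>z\<close>. Under this integral, expanding the weights
  in the vectors \<open>g m\<close> and reading the sum over \<open>n\<close> as the quadratic form
  of \<open>T\<close> at \<open>tf_shift z (g m)\<close> produces the second integral, over
  \<open>w\<close>.\<close>

lemma conv_square_sum:
  assumes d: "diagonalises T h l"
  shows "(\<Sum>n. ennreal ((l n)\<^sup>2))
    = (\<integral>\<^sup>+z. indicator D z * (\<integral>\<^sup>+w. indicator D w * corr (w - z) \<partial>lborel) \<partial>lborel)"
proof -
  have [measurable]: "D \<in> sets borel" by (rule D)
  have l0: "l n \<ge> 0" for n using d by (simp add: diagonalises_def)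
  have quad: "ennreal (inner (T x) x) = (\<Sum>n. ennreal (l n) * ennreal ((cmod (cinner (h n) x))\<^sup>2))" for x
  proof -
    have "(\<lambda>n. Re (complex_of_real (l n * (cmod (cinner x (h n)))\<^sup>2))) sums Re (cinner (T x) x)"
    proof (rule sums_Re)
      have "(\<lambda>n. l n * (cinner x (h n) * cinner (h n) x)) sums cinner (T x) x"
        using d by (simp add: diagonalises_def)
      then show "(\<lambda>n. complex_of_real (l n * (cmod (cinner x (h n)))\<^sup>2)) sums cinner (T x) x"
        by (simp add: cinner_mult_commute)
    qed
    then have "(\<Sum>n. ennreal (l n * (cmod (cinner x (h n)))\<^sup>2)) = ennreal (inner (T x) x)"
      unfolding inner_l2_def by (intro suminf_ennreal_eq) (simp_all add: l0)
    then show ?thesis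
      by (simp add: ennreal_mult' l0 cmod_cinner_commute[of x])
  qed
  have "inner (T (h n)) (h n) = l n" for n
  proof (cases "l n = 0")
    case False
    then have "inner (h n) (h n) = 1" using d by (simp add: diagonalises_def inner_l2_def)
    then show ?thesis using d by (simp add: diagonalises_def)
  qed (use d in \<open>simp add: diagonalises_def\<close>)
  then have "ennreal ((l n)\<^sup>2) = ennreal (l n) * (\<integral>\<^sup>+z. indicator D z * weight z (h n) \<partial>lborel)" for n
    unfolding conv_quadratic[symmetric] by (simp add: power2_eq_square ennreal_mult l0)
  then have "(\<Sum>n. ennreal ((l n)\<^sup>2)) = (\<Sum>n. \<integral>\<^sup>+z. ennreal (l n) * (indicator D z * weight z (h n)) \<partial>lborel)"
    by (simp add: nn_integral_cmult)
  also have "\<dots> = (\<integral>\<^sup>+z. (\<Sum>n. ennreal (l n) * (indicator D z * weight z (h n))) \<partial>lborel)"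
    by (rule nn_integral_suminf[symmetric]) measurable
  also have "\<dots> = (\<integral>\<^sup>+z. indicator D z * (\<Sum>n. ennreal (l n) * weight z (h n)) \<partial>lborel)"
    by (intro nn_integral_cong) (auto split: split_indicator)
  also have "\<dots> = (\<integral>\<^sup>+z. indicator D z * (\<integral>\<^sup>+w. indicator D w * corr (w - z) \<partial>lborel) \<partial>lborel)"
  proof (intro nn_integral_cong arg_cong2[where f = "(*)"] refl)
    fix z
    have "(\<Sum>n. ennreal (l n) * weight z (h n))
      = (\<Sum>n. \<Sum>m. ennreal (l n) * ennreal ((cmod (cinner (h n) (tf_shift z (g m))))\<^sup>2))"
      unfolding weight_def by simp
    also have "\<dots> = (\<Sum>m. \<Sum>n. ennreal (l n) * ennreal ((cmod (cinner (h n) (tf_shift z (g m))))\<^sup>2))"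
      by (rule suminf_swap_ennreal)
    also have "\<dots> = (\<Sum>m. \<integral>\<^sup>+w. indicator D w * weight w (tf_shift z (g m)) \<partial>lborel)"
      unfolding quad[symmetric] conv_quadratic ..
    also have "\<dots> = (\<integral>\<^sup>+w. (\<Sum>m. indicator D w * weight w (tf_shift z (g m))) \<partial>lborel)"
      by (rule nn_integral_suminf[symmetric]) measurable
    also have "\<dots> = (\<integral>\<^sup>+w. indicator D w * corr (w - z) \<partial>lborel)"
      unfolding corr_def weight_def by (simp add: cmod_cinner_tf_shift_diff)
    finally show "(\<Sum>n. ennreal (l n) * weight z (h n)) = (\<integral>\<^sup>+w. indicator D w * corr (w - z) \<partial>lborel)" .
  qed
  finally show ?thesis .
qed

end

end

section \<open>Counting eigenvalues\<close>

lemma orthonormal_independent: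
  assumes "orthonormal G" "finite G"
  shows "l2.independent G"
proof
  assume "l2.dependent G"
  then obtain u v where v: "v \<in> G" "u v \<noteq> 0" and "(\<Sum>f\<in>G. u f *\<^sub>C f) = 0"
    using l2.dependent_finite[OF assms(2)] by blast
  then show False
    using cinner_orthonormal_sum[OF assms(1) subset_refl assms(2) v(1), of u] by simp
qed

text \<open>Subtract from an eigenvector its projection \<open>p\<close> to the listed vectors of
  eigenvalue \<open>\<mu>\<close>. The remainder is orthogonal to these by construction and to those
  of other nonzero eigenvalues by self-adjointness, so the expansion of \<open>A\<close> annihilates
  it. It is still in the eigenspace of \<open>\<mu> > 0\<close>, hence it is 0.\<close>

lemma diagonalises_eigenspace:
  assumes A: "positive_op A" and d: "diagonalises A h m" and fin: "finite {n. m n = \<mu>}" and \<mu>: "\<mu> > 0"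
  shows "orthonormal (h ` {n. m n = \<mu>})" "inj_on h {n. m n = \<mu>}"
    "l2.span (h ` {n. m n = \<mu>}) = eigenspace A \<mu>"
proof -
  let ?N = "{n. m n = \<mu>}"
  note b = positive_op_bounded[OF A]
  have ip: "cinner (h i) (h j) = (if i = j then 1 else 0)" if "m i \<noteq> 0" "m j \<noteq> 0" for i j
    using d that by (simp add: diagonalises_def)
  show inj: "inj_on h ?N"
  proof (rule inj_onI)
    fix i j assume "i \<in> ?N" "j \<in> ?N" "h i = h j"
    then show "i = j" using ip[of i j] ip[of j j] \<mu> by (auto split: if_splits)
  qed
  then show on: "orthonormal (h ` ?N)"
    using \<mu> by (auto simp: orthonormal_def ip inj_on_eq_iff[OF inj])
  have sub: "l2.subspace (eigenspace A \<mu>)"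
    unfolding l2.subspace_def eigenspace_def
    by (simp add: bounded_op_zero[OF b] bounded_op_add[OF b] bounded_op_scaleC[OF b] l2.scale_right_distrib mult.commute)
  have incl: "h ` ?N \<subseteq> eigenspace A \<mu>"
    using d by (auto simp: diagonalises_def eigenspace_def scaleR_eq_scaleC)
  show "l2.span (h ` ?N) = eigenspace A \<mu>"
  proof
    show "l2.span (h ` ?N) \<subseteq> eigenspace A \<mu>"
      by (rule l2.span_minimal[OF incl sub])
    show "eigenspace A \<mu> \<subseteq> l2.span (h ` ?N)"
    proof
      fix \<phi> assume \<phi>: "\<phi> \<in> eigenspace A \<mu>"
      define p where "p = (\<Sum>f\<in>h ` ?N. cinner \<phi> f *\<^sub>C f)"
      have p: "p \<in> l2.span (h ` ?N)"
        unfolding p_def by (intro l2.span_sum l2.span_scale l2.span_base)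
      have "\<phi> - p \<in> eigenspace A \<mu>"
        using p l2.span_minimal[OF incl sub] \<phi> sub by (intro l2.subspace_diff) auto
      then have Ar: "A (\<phi> - p) = \<mu> *\<^sub>C (\<phi> - p)" by (simp add: eigenspace_def)
      have orth: "cinner (\<phi> - p) (h n) = 0" if "m n \<noteq> 0" for n
      proof (cases "m n = \<mu>")
        case True
        then have "h n \<in> h ` ?N" by blast
        then show ?thesis
          using cinner_orthonormal_sum[OF on subset_refl finite_imageI[OF fin], of "h n" "cinner \<phi>"]
          by (simp add: cinner_diff_left p_def)
      next
        case False
        have "\<mu> * cinner (\<phi> - p) (h n) = m n * cinner (\<phi> - p) (h n)"
          using positive_op_selfadjoint[OF A, of "\<phi> - p" "h n"] d
          by (simp add: Ar diagonalises_def cinner_scaleC_left cinner_scaleC_right scaleR_eq_scaleC)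
        then show ?thesis using False by simp
      qed
      have "A (\<phi> - p) = 0"
      proof (rule cinner_ext)
        fix \<psi>
        have "(\<lambda>n. m n * (cinner (\<phi> - p) (h n) * cinner (h n) \<psi>)) sums cinner (A (\<phi> - p)) \<psi>"
          using d by (simp add: diagonalises_def)
        moreover have "m n * (cinner (\<phi> - p) (h n) * cinner (h n) \<psi>) = 0" for n
          using orth[of n] by (cases "m n = 0") auto
        ultimately have "(\<lambda>n. 0) sums cinner (A (\<phi> - p)) \<psi>" by (simp only:)
        then show "cinner (A (\<phi> - p)) \<psi> = cinner 0 \<psi>"
          using sums_unique2[OF sums_zero] by auto
      qed
      then have "\<phi> = p" using Ar \<mu> by simp
      then show "\<phi> \<in> l2.span (h ` ?N)" using p by simp
    qed
  qed
qed

text \<open>At each level above \<open>c\<close> both sequences have as many entries as a basis of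
  the same eigenspace has elements. Since \<open>m\<close> tends to 0, only finitely many levels
  occur, and the counts are added over them.\<close>

lemma eigenvalue_count:
  assumes A: "positive_op A" and d: "diagonalises A h m" and sm: "summable m"
    and es: "eigenvalue_sequence A l" and c: "c > 0"
  shows "card {k. l k > c} = card {n. m n > c}" "finite {n. m n > c}"
proof -
  have "\<forall>\<^sub>F n in sequentially. m n < c"
    by (rule order_tendstoD(2)[OF summable_LIMSEQ_zero[OF sm] c])
  then obtain n0 where n0: "\<And>n. n \<ge> n0 \<Longrightarrow> m n < c"
    by (auto simp: eventually_sequentially)
  have "{n. m n \<ge> c} \<subseteq> {..<n0}"
    using n0 by (force simp: not_le[symmetric])
  then have fin': "finite {n. m n \<ge> c}" by (rule finite_subset) simp
  show fin: "finite {n. m n > c}"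
    by (rule finite_subset[OF _ fin']) auto
  have level: "finite {k. l k = \<mu>} \<and> finite {n. m n = \<mu>} \<and> card {k. l k = \<mu>} = card {n. m n = \<mu>}"
    if \<mu>: "\<mu> > c" for \<mu>
  proof -
    have fN: "finite {n. m n = \<mu>}"
      by (rule finite_subset[OF _ fin']) (use \<mu> in auto)
    have \<mu>0: "\<mu> > 0" using \<mu> c by simp
    note es_h = diagonalises_eigenspace[OF A d fN \<mu>0]
    obtain B where B: "l2.independent B" "l2.span B = eigenspace A \<mu>" "{k. complex_of_real (l k) = complex_of_real \<mu>} \<approx> B"
      using es \<mu>0 unfolding eigenvalue_sequence_def by (metis of_real_eq_0_iff order_less_irrefl)
    obtain f where "bij_betw f B (h ` {n. m n = \<mu>})"
      using l2.bij_if_span_eq_span_bases[OF B(1) orthonormal_independent[OF es_h(1) finite_imageI[OF fN]]]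
        B(2) es_h(3) by auto
    then have "B \<approx> h ` {n. m n = \<mu>}" by (auto simp: eqpoll_def)
    also have "h ` {n. m n = \<mu>} \<approx> {n. m n = \<mu>}"
      using es_h(2) by (rule inj_on_image_eqpoll_self)
    finally (eqpoll_trans) have "B \<approx> {n. m n = \<mu>}" .
    with B(3) have e: "{k. l k = \<mu>} \<approx> {n. m n = \<mu>}"
      by (simp add: eqpoll_trans)
    then have "finite {k. l k = \<mu>}" using fN eqpoll_finite_iff by blast
    with e fN show ?thesis by (simp add: eqpoll_iff_card)
  qed
  define M where "M = m ` {n. m n > c}"
  have Mfin: "finite M" using fin by (simp add: M_def)
  have Mc: "\<mu> > c" if "\<mu> \<in> M" for \<mu> using that by (auto simp: M_def)
  \<comment> \<open>A level of \<open>l\<close> above \<open>c\<close> missed by \<open>m\<close>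
    would have an empty fibre in \<open>m\<close>, and by \<open>level\<close> also in
    \<open>l\<close>.\<close>
  have "l k \<in> M" if "l k > c" for k
  proof (rule ccontr)
    assume "l k \<notin> M"
    then have "m n \<noteq> l k" for n using that by (metis M_def imageI mem_Collect_eq)
    then have "{n. m n = l k} = {}" by simp
    then have "{k'. l k' = l k} = {}" using level[OF that] by (metis card.empty card_0_eq)
    then show False by blast
  qed
  then have "{k. l k > c} = (\<Union>\<mu>\<in>M. {k. l k = \<mu>})" using Mc by auto
  moreover have "{n. m n > c} = (\<Union>\<mu>\<in>M. {n. m n = \<mu>})" by (auto simp: M_def)
  moreover have "card (\<Union>\<mu>\<in>M. {k. l k = \<mu>}) = (\<Sum>\<mu>\<in>M. card {k. l k = \<mu>})"
    using level Mc Mfin by (intro card_UN_disjoint) auto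
  moreover have "card (\<Union>\<mu>\<in>M. {n. m n = \<mu>}) = (\<Sum>\<mu>\<in>M. card {n. m n = \<mu>})"
    using level Mc Mfin by (intro card_UN_disjoint) auto
  ultimately show "card {k. l k > c} = card {n. m n > c}"
    using level Mc by simp
qed

text \<open>If \<open>x > 1 - \<delta>\<close> then \<open>1 - x \<le> x (1 - x) / (1 - \<delta>)\<close>, and otherwise
  \<open>x \<le> x (1 - x) / \<delta>\<close>.\<close>

lemma count_near_trace:
  fixes m :: "nat \<Rightarrow> real"
  assumes m: "\<And>n. 0 \<le> m n" "\<And>n. m n \<le> 1" and t: "m sums t" and q: "(\<lambda>n. (m n)\<^sup>2) sums q"
    and \<delta>: "0 < \<delta>" "\<delta> < 1" and fin: "finite {n. m n > 1 - \<delta>}"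
  shows "\<bar>real (card {n. m n > 1 - \<delta>}) - t\<bar> \<le> (t - q) / min \<delta> (1 - \<delta>)"
proof -
  let ?\<chi> = "\<lambda>n. if n \<in> {n. m n > 1 - \<delta>} then 1 else (0::real)"
  let ?c = "min \<delta> (1 - \<delta>)"
  have c: "?c > 0" using \<delta> by simp
  have \<chi>: "(\<lambda>n. ?\<chi> n - m n) sums (real (card {n. m n > 1 - \<delta>}) - t)"
    using sums_If_finite_set[OF fin, of "\<lambda>_. 1::real"] t by (intro sums_diff) simp_all
  have r: "(\<lambda>n. (m n - (m n)\<^sup>2) / ?c) sums ((t - q) / ?c)"
    by (intro sums_divide sums_diff t q)
  have b: "\<bar>?\<chi> n - m n\<bar> \<le> (m n - (m n)\<^sup>2) / ?c" for n
  proof -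
    have "?c * \<bar>?\<chi> n - m n\<bar> \<le> m n * (1 - m n)"
    proof (cases "m n > 1 - \<delta>")
      case True
      then have "?c * (1 - m n) \<le> m n * (1 - m n)" using m[of n] by (intro mult_right_mono) auto
      then show ?thesis using True m[of n] by simp
    next
      case False
      then have "m n * ?c \<le> m n * (1 - m n)" using m[of n] by (intro mult_left_mono) auto
      then show ?thesis using False m[of n] by (simp add: mult.commute)
    qed
    then show ?thesis using c by (simp add: field_simps power2_eq_square)
  qed
  have "real (card {n. m n > 1 - \<delta>}) - t \<le> (t - q) / ?c"
    by (rule sums_le[OF _ \<chi> r]) (use b abs_le_D1 in blast)
  moreover have "- ((t - q) / ?c) \<le> real (card {n. m n > 1 - \<delta>}) - t"
    by (rule sums_le[OF _ sums_minus[OF r] \<chi>]) (use b in \<open>smt (verit)\<close>)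
  ultimately show ?thesis by simp
qed

section \<open>Asymptotics\<close>

text \<open>The measure of the intersection of \<open>\<Omega>\<close> with its translate by
  \<open>- u\<close>.\<close>

definition overlap :: "'a::euclidean_space set \<Rightarrow> 'a \<Rightarrow> real" where
  "overlap \<Omega> u = (LINT t|lborel. indicator \<Omega> t * indicator \<Omega> (t + u))"

lemma overlap_props:
  fixes \<Omega> :: "'a::euclidean_space set"
  assumes \<Omega>: "\<Omega> \<in> sets borel" "emeasure lborel \<Omega> < \<infinity>"
  shows "overlap \<Omega> \<in> borel_measurable borel" "0 \<le> overlap \<Omega> u" "overlap \<Omega> u \<le> measure lborel \<Omega>"
    "ennreal (overlap \<Omega> u) = (\<integral>\<^sup>+t. indicator \<Omega> t * indicator \<Omega> (t + u) \<partial>lborel)"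
    "x \<longlonglongrightarrow> 0 \<Longrightarrow> (\<lambda>n. overlap \<Omega> (x n)) \<longlonglongrightarrow> measure lborel \<Omega>"
proof -
  note [measurable] = \<Omega>(1)
  have i: "integrable lborel (indicator \<Omega> :: 'a \<Rightarrow> real)" using \<Omega> by (simp add: integrable_indicator_iff)
  have io: "integrable lborel (\<lambda>t. indicator \<Omega> t * indicator \<Omega> (t + u) :: real)" for u
    by (rule Bochner_Integration.integrable_bound[OF i]) (auto split: split_indicator)
  have "(\<lambda>u. LINT t|lborel. indicator \<Omega> t * indicator \<Omega> (t + u) :: real) \<in> borel_measurable borel"
    by measurable
  then show "overlap \<Omega> \<in> borel_measurable borel" by (simp add: overlap_def[abs_def])
  show "0 \<le> overlap \<Omega> u" unfolding overlap_def by simp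
  have "overlap \<Omega> u \<le> (LINT t|lborel. indicator \<Omega> t)"
    unfolding overlap_def by (rule integral_mono[OF io i]) (auto split: split_indicator)
  then show "overlap \<Omega> u \<le> measure lborel \<Omega>" by simp
  have "ennreal (overlap \<Omega> u) = (\<integral>\<^sup>+t. ennreal (indicator \<Omega> t * indicator \<Omega> (t + u)) \<partial>lborel)"
    unfolding overlap_def by (rule nn_integral_eq_integral[symmetric, OF io]) simp
  also have "\<dots> = (\<integral>\<^sup>+t. indicator \<Omega> t * indicator \<Omega> (t + u) \<partial>lborel)"
    by (intro nn_integral_cong) (auto split: split_indicator)
  finally show "ennreal (overlap \<Omega> u) = (\<integral>\<^sup>+t. indicator \<Omega> t * indicator \<Omega> (t + u) \<partial>lborel)" .
  assume x: "x \<longlonglongrightarrow> 0"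
  show "(\<lambda>n. overlap \<Omega> (x n)) \<longlonglongrightarrow> measure lborel \<Omega>"
  \<comment> \<open>The loss of overlap is at most the distance in mean between the indicator and
    its translate.\<close>
  proof (rule Lim_transform2[OF tendsto_const], rule Lim_null_comparison)
    show "(\<lambda>n. LINT t|lborel. \<bar>indicator \<Omega> (t + x n) - indicator \<Omega> t :: real\<bar>) \<longlonglongrightarrow> 0"
      by (rule translation_continuity_indicator[OF \<Omega> x])
    show "\<forall>\<^sub>F n in sequentially. norm (measure lborel \<Omega> - overlap \<Omega> (x n))
        \<le> (LINT t|lborel. \<bar>indicator \<Omega> (t + x n) - indicator \<Omega> t :: real\<bar>)"
    proof (rule always_eventually, rule allI)
      fix n
      have "measure lborel \<Omega> - overlap \<Omega> (x n) = (LINT t|lborel. indicator \<Omega> t - indicator \<Omega> t * indicator \<Omega> (t + x n))"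
        unfolding overlap_def using i io by simp
      then have "norm (measure lborel \<Omega> - overlap \<Omega> (x n)) \<le> (LINT t|lborel. norm (indicator \<Omega> t - indicator \<Omega> t * indicator \<Omega> (t + x n) :: real))"
        by (simp only: integral_norm_bound)
      also have "\<dots> \<le> (LINT t|lborel. \<bar>indicator \<Omega> (t + x n) - indicator \<Omega> t :: real\<bar>)"
        using i io integrable_lborel_shift[OF i, of "x n"]
        by (intro integral_mono) (auto split: split_indicator)
      finally show "norm (measure lborel \<Omega> - overlap \<Omega> (x n))
        \<le> (LINT t|lborel. \<bar>indicator \<Omega> (t + x n) - indicator \<Omega> t :: real\<bar>)" .
    qed
  qed
qed

lemma emeasure_lborel_scaleR_image:
  fixes \<Omega> :: "'a::euclidean_space set"
  assumes \<Omega>: "compact \<Omega>" and R: "R > 0"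
  shows "(*\<^sub>R) R ` \<Omega> \<in> sets borel" "emeasure lborel ((*\<^sub>R) R ` \<Omega>) < \<infinity>"
    "measure lborel ((*\<^sub>R) R ` \<Omega>) = R ^ DIM('a) * measure lborel \<Omega>"
proof -
  have co: "compact ((*\<^sub>R) R ` \<Omega>)" by (rule compact_scaling[OF \<Omega>])
  then show m: "(*\<^sub>R) R ` \<Omega> \<in> sets borel" by (intro borel_compact)
  show "emeasure lborel ((*\<^sub>R) R ` \<Omega>) < \<infinity>"
    using co by (rule emeasure_compact_finite)
  have [measurable]: "\<Omega> \<in> sets borel" using \<Omega> by (rule borel_compact)
  note [measurable] = m
  have "emeasure lborel ((*\<^sub>R) R ` \<Omega>) = (\<integral>\<^sup>+x. indicator ((*\<^sub>R) R ` \<Omega>) x \<partial>lborel)" by simp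
  also have "\<dots> = ennreal (\<bar>R\<bar> ^ DIM('a)) * (\<integral>\<^sup>+x. indicator ((*\<^sub>R) R ` \<Omega>) (0 + R *\<^sub>R x) \<partial>lborel)"
    by (rule nn_integral_lborel_affine) (use R in auto)
  also have "(\<lambda>x. indicator ((*\<^sub>R) R ` \<Omega>) (0 + R *\<^sub>R x) :: ennreal) = indicator \<Omega>"
    using R by (auto simp: fun_eq_iff image_iff split: split_indicator)
  finally have "emeasure lborel ((*\<^sub>R) R ` \<Omega>) = ennreal (R ^ DIM('a)) * emeasure lborel \<Omega>"
    using R by simp
  then show "measure lborel ((*\<^sub>R) R ` \<Omega>) = R ^ DIM('a) * measure lborel \<Omega>"
    using R by (simp add: measure_def enn2real_mult)
qed

context rank_one_mixture
begin

text \<open>The expected overlap for a displacement drawn from the density \<open>corr\<close> and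
  shrunk by \<open>R\<close>. Up to the factor \<open>R ^ (2 * DIM('a))\<close> it is the trace of
  the squared convolution operator.\<close>

definition mean_overlap :: "('a \<times> 'a) set \<Rightarrow> real \<Rightarrow> ennreal" where
  "mean_overlap \<Omega> R = (\<integral>\<^sup>+v. corr v * ennreal (overlap \<Omega> ((1/R) *\<^sub>R v)) \<partial>lborel)"

text \<open>The shrunken displacement tends to 0, where the overlap is the full measure; as
  \<open>corr\<close> has integral 1, its multiple by this measure dominates.\<close>

lemma mean_overlap_tendsto:
  assumes \<Omega>: "compact \<Omega>" and X: "filterlim X at_top sequentially"
  shows "(\<lambda>n. mean_overlap \<Omega> (X n)) \<longlonglongrightarrow> ennreal (measure lborel \<Omega>)"
proof -
  have O: "\<Omega> \<in> sets borel" "emeasure lborel \<Omega> < \<infinity>"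
    by (rule borel_compact[OF \<Omega>(1)], rule emeasure_compact_finite[OF \<Omega>(1)])
  note [measurable] = overlap_props(1)[OF O]
  have total: "(\<integral>\<^sup>+v. corr v * ennreal (measure lborel \<Omega>) \<partial>lborel) = ennreal (measure lborel \<Omega>)"
    by (subst nn_integral_multc) (simp_all add: corr_total)
  \<comment> \<open>In \<open>ennreal\<close>, multiplication by a constant is sure to preserve
    limits only if the constant is finite.\<close>
  have "AE v in lborel. corr v \<noteq> \<infinity>"
    by (rule nn_integral_PInf_AE) (simp_all add: corr_total)
  have X0: "(\<lambda>n. 1 / X n) \<longlonglongrightarrow> 0"
    using tendsto_inverse_0_at_top[OF X] by (simp add: inverse_eq_divide)
  have "(\<lambda>n. mean_overlap \<Omega> (X n)) \<longlonglongrightarrow> (\<integral>\<^sup>+v. corr v * ennreal (measure lborel \<Omega>) \<partial>lborel)"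
    unfolding mean_overlap_def
  proof (rule nn_integral_dominated_convergence[where w = "\<lambda>v. corr v * ennreal (measure lborel \<Omega>)"])
    show "AE v in lborel. corr v * ennreal (overlap \<Omega> ((1 / X n) *\<^sub>R v)) \<le> corr v * ennreal (measure lborel \<Omega>)" for n
      by (intro AE_I2 mult_left_mono ennreal_leI overlap_props(3)[OF O]) simp
    show "AE v in lborel. (\<lambda>n. corr v * ennreal (overlap \<Omega> ((1 / X n) *\<^sub>R v))) \<longlonglongrightarrow> corr v * ennreal (measure lborel \<Omega>)"
      using \<open>AE v in lborel. corr v \<noteq> \<infinity>\<close>
    proof eventually_elim
      case (elim v)
      have "(\<lambda>n. (1 / X n) *\<^sub>R v) \<longlonglongrightarrow> 0 *\<^sub>R v" by (intro tendsto_intros X0)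
      then have "(\<lambda>n. overlap \<Omega> ((1 / X n) *\<^sub>R v)) \<longlonglongrightarrow> measure lborel \<Omega>"
        by (intro overlap_props(5)[OF O]) simp
      then show ?case
        using elim by (intro ennreal_tendsto_cmult tendsto_ennrealI) (simp_all add: less_top)
    qed
  qed (simp_all add: total)
  then show ?thesis unfolding total .
qed

text \<open>Substitute \<open>w = z + v\<close>, exchange the integrals, then scale \<open>z\<close>
  by \<open>R\<close>. Only \<open>z\<close> is rescaled, so the Jacobian appears once;
  \<open>corr\<close> keeps its scale while the displacement seen by \<open>\<Omega>\<close> is
  divided by \<open>R\<close>.\<close>

lemma mean_overlap_eq:
  assumes \<Omega>: "compact \<Omega>" and R: "R > 0"
  shows "(\<integral>\<^sup>+z. indicator ((*\<^sub>R) R ` \<Omega>) z * (\<integral>\<^sup>+w. indicator ((*\<^sub>R) R ` \<Omega>) w * corr (w - z) \<partial>lborel) \<partial>lborel)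
    = ennreal (R ^ (2 * DIM('a))) * mean_overlap \<Omega> R"
proof -
  let ?D = "(*\<^sub>R) R ` \<Omega>"
  have O: "\<Omega> \<in> sets borel" "emeasure lborel \<Omega> < \<infinity>"
    by (rule borel_compact[OF \<Omega>(1)], rule emeasure_compact_finite[OF \<Omega>(1)])
  note [measurable] = emeasure_lborel_scaleR_image(1)[OF \<Omega> R] O(1) overlap_props(1)[OF O]
  have mem: "indicator ?D (R *\<^sub>R x) = (indicator \<Omega> x :: ennreal)" for x
    using R by (auto simp: image_iff split: split_indicator)
  have "(\<integral>\<^sup>+z. indicator ?D z * (\<integral>\<^sup>+w. indicator ?D w * corr (w - z) \<partial>lborel) \<partial>lborel)
    = (\<integral>\<^sup>+z. \<integral>\<^sup>+v. corr v * (indicator ?D z * indicator ?D (z + v)) \<partial>lborel \<partial>lborel)"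
  proof (rule nn_integral_cong)
    fix z
    have "(\<integral>\<^sup>+w. indicator ?D w * corr (w - z) \<partial>lborel) = (\<integral>\<^sup>+v. indicator ?D (v + z) * corr (v + z - z) \<partial>lborel)"
      by (rule nn_integral_lborel_shift[symmetric, of "\<lambda>w. indicator ?D w * corr (w - z)"]) measurable
    then have "indicator ?D z * (\<integral>\<^sup>+w. indicator ?D w * corr (w - z) \<partial>lborel)
      = (\<integral>\<^sup>+v. indicator ?D z * (indicator ?D (v + z) * corr v) \<partial>lborel)"
      by (subst nn_integral_cmult) (simp_all add: measurable_compose)
    also have "\<dots> = (\<integral>\<^sup>+v. corr v * (indicator ?D z * indicator ?D (z + v)) \<partial>lborel)"
      by (simp add: mult_ac add.commute)
    finally show "indicator ?D z * (\<integral>\<^sup>+w. indicator ?D w * corr (w - z) \<partial>lborel)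
      = (\<integral>\<^sup>+v. corr v * (indicator ?D z * indicator ?D (z + v)) \<partial>lborel)" .
  qed
  also have "\<dots> = (\<integral>\<^sup>+v. \<integral>\<^sup>+z. corr v * (indicator ?D z * indicator ?D (z + v)) \<partial>lborel \<partial>lborel)"
    by (rule lborel_pair.Fubini'[symmetric]) measurable
  also have "\<dots> = (\<integral>\<^sup>+v. ennreal (R ^ (2 * DIM('a))) * (corr v * ennreal (overlap \<Omega> ((1/R) *\<^sub>R v))) \<partial>lborel)"
  proof (rule nn_integral_cong)
    fix v
    have "(\<integral>\<^sup>+z. indicator ?D z * indicator ?D (z + v) \<partial>lborel)
      = ennreal (\<bar>R\<bar> ^ DIM('a \<times> 'a)) * (\<integral>\<^sup>+x. indicator ?D (0 + R *\<^sub>R x) * indicator ?D (0 + R *\<^sub>R x + v) \<partial>lborel)"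
      by (rule nn_integral_lborel_affine) (use R in auto)
    also have "(\<lambda>x. indicator ?D (0 + R *\<^sub>R x) * indicator ?D (0 + R *\<^sub>R x + v))
      = (\<lambda>x. indicator \<Omega> x * (indicator \<Omega> (x + (1/R) *\<^sub>R v) :: ennreal))"
    proof
      fix x
      have "0 + R *\<^sub>R x + v = R *\<^sub>R (x + (1/R) *\<^sub>R v)" using R by (simp add: scaleR_add_right)
      then show "indicator ?D (0 + R *\<^sub>R x) * indicator ?D (0 + R *\<^sub>R x + v)
        = indicator \<Omega> x * (indicator \<Omega> (x + (1/R) *\<^sub>R v) :: ennreal)"
        by (simp only: add_0 mem)
    qed
    also have "(\<integral>\<^sup>+x. indicator \<Omega> x * indicator \<Omega> (x + (1/R) *\<^sub>R v) \<partial>lborel) = ennreal (overlap \<Omega> ((1/R) *\<^sub>R v))"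
      by (rule overlap_props(4)[OF O, symmetric])
    finally have "(\<integral>\<^sup>+z. indicator ?D z * indicator ?D (z + v) \<partial>lborel)
      = ennreal (R ^ (2 * DIM('a))) * ennreal (overlap \<Omega> ((1/R) *\<^sub>R v))"
      using R by (simp add: mult_2)
    then show "(\<integral>\<^sup>+z. corr v * (indicator ?D z * indicator ?D (z + v)) \<partial>lborel)
      = ennreal (R ^ (2 * DIM('a))) * (corr v * ennreal (overlap \<Omega> ((1/R) *\<^sub>R v)))"
      by (subst nn_integral_cmult) (simp_all add: mult_ac)
  qed
  also have "\<dots> = ennreal (R ^ (2 * DIM('a))) * mean_overlap \<Omega> R"
    unfolding mean_overlap_def by (rule nn_integral_cmult) measurable
  finally show ?thesis .
qed

text \<open>With \<open>q\<close> the sum of squared eigenvalues and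
  \<open>q \<le> t \<le> V\<close>, every error is a multiple of \<open>V - q\<close>. Dividing by
  \<open>V\<close> turns this into the defect of the mean overlap, which depends on \<open>R\<close>
  but no longer on the spectrum.\<close>

lemma count_bound:
  assumes \<Omega>: "compact \<Omega>" "measure lborel \<Omega> > 0" and R: "R > 0" and \<delta>: "0 < \<delta>" "\<delta> < 1"
    and es: "eigenvalue_sequence (op_conv (indicator ((*\<^sub>R) R ` \<Omega>)) S) l"
  shows "\<bar>real (card {k. l k > 1 - \<delta>}) / (R ^ (2 * DIM('a)) * measure lborel \<Omega>) - 1\<bar>
    \<le> (1 / min \<delta> (1 - \<delta>) + 1) * (1 - enn2real (mean_overlap \<Omega> R) / measure lborel \<Omega>)"
proof -
  let ?D = "(*\<^sub>R) R ` \<Omega>"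
  let ?T = "op_conv (indicator ?D) S"
  let ?c = "min \<delta> (1 - \<delta>)"
  define V where "V = R ^ (2 * DIM('a)) * measure lborel \<Omega>"
  note D = emeasure_lborel_scaleR_image[OF \<Omega>(1) R]
  have V: "measure lborel ?D = V" "V > 0"
    using D(3) R \<Omega>(2) by (simp_all add: V_def mult_2)
  note pos = conv_positive[OF D(1,2)]
  obtain t where t: "((\<lambda>e. inner (?T e) e) has_sum t) (SOME E. onb E)" "t \<le> V"
    using conv_trace[OF D(1,2), of "SOME E. onb E"] onb_SOME V(1) by (auto simp: onb_iff)
  obtain h m where d: "diagonalises ?T h m" and m: "m sums t"
    by (rule diagonalisation_exists[OF pos onb_SOME t(1)])
  have m0: "0 \<le> m n" for n using d by (simp add: diagonalises_def)
  have m1: "m n \<le> 1" for n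
  proof (cases "m n = 0")
    case False
    then have "cinner (h n) (h n) = 1" and Th: "?T (h n) = m n *\<^sub>R h n"
      using d by (simp_all add: diagonalises_def)
    then have "inner (h n) (h n) = 1" by (simp add: inner_l2_def)
    then show ?thesis
      using conv_le_identity[OF D(1,2), of "h n"] by (simp add: Th power2_norm_eq_inner)
  qed simp
  have "summable (\<lambda>n. (m n)\<^sup>2)"
  proof (rule summable_comparison_test'[OF sums_summable[OF m]])
    fix n show "norm ((m n)\<^sup>2) \<le> m n"
      using mult_left_mono[OF m1[of n] m0[of n]] by (simp add: power2_eq_square)
  qed
  then obtain q where q: "(\<lambda>n. (m n)\<^sup>2) sums q" by (auto simp: summable_def)
  have q0: "q \<ge> 0" using sums_le[OF _ sums_zero q] by simp
  have "ennreal q = ennreal (R ^ (2 * DIM('a))) * mean_overlap \<Omega> R"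
    using suminf_ennreal_eq[OF _ q] conv_square_sum[OF D(1,2) d] mean_overlap_eq[OF \<Omega>(1) R] by simp
  then have "q = R ^ (2 * DIM('a)) * enn2real (mean_overlap \<Omega> R)"
    using q0 R enn2real_ennreal[of q] by (simp add: enn2real_mult)
  then have qV: "q / V = enn2real (mean_overlap \<Omega> R) / measure lborel \<Omega>"
    using R by (simp add: V_def)
  have qt: "q \<le> t"
    by (rule sums_le[OF _ q m]) (use mult_left_mono[OF m1 m0] in \<open>simp add: power2_eq_square\<close>)
  have c: "?c > 0" using \<delta> by simp
  note cnt = eigenvalue_count[OF pos d sums_summable[OF m] es, of "1 - \<delta>"]
  have "\<bar>real (card {k. l k > 1 - \<delta>}) - t\<bar> \<le> (t - q) / ?c"
    using count_near_trace[OF m0 m1 m q \<delta>] cnt \<delta> by simp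
  also have "\<dots> \<le> (V - q) / ?c" using t(2) c by (intro divide_right_mono) auto
  \<comment> \<open>Passing from \<open>t\<close> to \<open>V\<close> costs
    \<open>V - t \<le> V - q\<close>, the source of the summand 1 in the constant.\<close>
  finally have "\<bar>real (card {k. l k > 1 - \<delta>}) - V\<bar> \<le> (V - q) / ?c + (V - q)"
    using t(2) qt by linarith
  then have "\<bar>real (card {k. l k > 1 - \<delta>}) - V\<bar> / V \<le> ((V - q) / ?c + (V - q)) / V"
    using V(2) by (intro divide_right_mono) auto
  also have "((V - q) / ?c + (V - q)) / V = (1 / ?c + 1) * (1 - q / V)"
    using V(2) by (simp add: field_simps)
  also have "\<bar>real (card {k. l k > 1 - \<delta>}) - V\<bar> / V = \<bar>(real (card {k. l k > 1 - \<delta>}) - V) / V\<bar>"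
    using V(2) by simp
  also have "(real (card {k. l k > 1 - \<delta>}) - V) / V = real (card {k. l k > 1 - \<delta>}) / V - 1"
    using V(2) by (simp add: diff_divide_distrib)
  finally show ?thesis unfolding qV unfolding V_def .
qed

text \<open>Dominated convergence works along sequences, so the limit is tested on sequences tending
  to infinity; their terms are positive only eventually, which suffices for the bound.\<close>

lemma count_tendsto:
  assumes \<Omega>: "compact \<Omega>" "measure lborel \<Omega> > 0" and \<delta>: "0 < \<delta>" "\<delta> < 1"
    and es: "\<And>R. R > 0 \<Longrightarrow> eigenvalue_sequence (op_conv (indicator ((*\<^sub>R) R ` \<Omega>)) S) (l R)"
  shows "((\<lambda>R. real (card {k. l R k > 1 - \<delta>}) / (R ^ (2 * DIM('a)) * measure lborel \<Omega>)) \<longlongrightarrow> 1) at_top"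
proof (rule tendsto_at_topI_sequentially)
  fix X :: "nat \<Rightarrow> real" assume X: "filterlim X at_top sequentially"
  let ?b = "\<lambda>R. (1 / min \<delta> (1 - \<delta>) + 1) * (1 - enn2real (mean_overlap \<Omega> R) / measure lborel \<Omega>)"
  have "(\<lambda>n. enn2real (mean_overlap \<Omega> (X n))) \<longlonglongrightarrow> measure lborel \<Omega>"
    using tendsto_enn2real[OF mean_overlap_tendsto[OF \<Omega>(1) X]] by simp
  then have "(\<lambda>n. ?b (X n)) \<longlonglongrightarrow> (1 / min \<delta> (1 - \<delta>) + 1) * (1 - measure lborel \<Omega> / measure lborel \<Omega>)"
    using \<Omega>(2) by (intro tendsto_mult tendsto_const tendsto_diff tendsto_divide) auto
  then have b: "(\<lambda>n. ?b (X n)) \<longlonglongrightarrow> 0" using \<Omega>(2) by simp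
  have "\<forall>\<^sub>F n in sequentially. X n > 0"
    using X by (simp add: filterlim_at_top_dense)
  then have "\<forall>\<^sub>F n in sequentially. norm (real (card {k. l (X n) k > 1 - \<delta>}) / (X n ^ (2 * DIM('a)) * measure lborel \<Omega>) - 1) \<le> ?b (X n)"
  proof eventually_elim
    case (elim n)
    then show ?case using count_bound[OF \<Omega> elim \<delta> es[OF elim]] by simp
  qed
  from Lim_null_comparison[OF this b]
  show "(\<lambda>n. real (card {k. l (X n) k > 1 - \<delta>}) / (X n ^ (2 * DIM('a)) * measure lborel \<Omega>)) \<longlonglongrightarrow> 1"
    by (simp add: LIM_zero_iff)
qed

end

theorem theorem4p4:
  fixes S :: "(real ^ 'n) l2 \<Rightarrow> (real ^ 'n) l2"
    and \<Omega> :: "((real ^ 'n) \<times> (real ^ 'n)) set"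
    and \<delta> :: real
    and l :: "real \<Rightarrow> nat \<Rightarrow> real"
  assumes "density_operator S"
    and "compact \<Omega>" and "measure lborel \<Omega> > 0"
    and "0 < \<delta>" and "\<delta> < 1"
    and "\<And>R. R > 0 \<Longrightarrow> eigenvalue_sequence (op_conv (indicator ((*\<^sub>R) R ` \<Omega>)) S) (l R)"
  shows "((\<lambda>R. real (card {k. l R k > 1 - \<delta>}) / (R ^ (2 * CARD('n)) * measure lborel \<Omega>))
           \<longlongrightarrow> 1) at_top"
proof -
  obtain g where "rank_one_mixture S g"
    by (rule density_operator_mixture[OF assms(1)])
  from rank_one_mixture.count_tendsto[OF this assms(2-6)] show ?thesis by simp
qed

end
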